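(* Fix an integer $g\ge 1$. For each $n$, let $\boldsymbol F^{g-1}_n$ and $\boldsymbol F^g_n$ be uniform random elements of $\mathcal F^{g-1}_n$ and $\mathcal F^g_n$ respectively, and let $\Lambda$ be the random map from $\mathcal F^{g-1}_n\uplus\{\dag\}$ to $\mathcal F^g_n\uplus\{\dag\}$ described in the context. Then \[\lim_{n\to\infty} d_{TV}\big[\Lambda(\boldsymbol F^{g-1}_n),\boldsymbol F^g_n\big]=0,\] where $d_{TV}$ denotes the total variation distance between the laws of the two random variables (seen as random variables in $\mathcal F^g_n\uplus\{\dag\}$).
   Context: Permutations are composed from left to right: $\sigma\tau$ means $\sigma$ is applied first, then $\tau$. $\mathbb T_n$ is the set of transpositions of the symmetric group $S_n$. For $n\ge1$, $g\ge0$, \[\mathcal F^g_n=\{(t_1,\dots,t_{n-1+2g})\in\mathbb T_n^{\,n-1+2g}:\ t_1\cdots t_{n-1+2g}=(1\,2\,\cdots\,n)\}\] is the set of genus $g$ factorizations of the long cycle. Random map $\Lambda$ (for $g\ge1$). Let $F=(t_1,\dots,t_{n-1+2(g-1)})\in\mathcal F^{g-1}_n$. Pick a uniform random pair of integers $v<w$ in $[1,n-1+2g]$ and a uniform random triple of integers $a<b<c$ in $[1,n]$, independently of each other and of $F$. Step (i). Define \[\overline F_1=(t_1,\dots,t_{v-1},(a\,c),t_v,\dots,t_{w-2},(a\,b),t_{w-1},\dots,t_{n-1+2(g-1)}),\] \[\overline F_2=(t_1,\dots,t_{v-1},(a\,b),t_v,\dots,t_{w-2},(a\,c),t_{w-1},\dots,t_{n-1+2(g-1)}).\]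 If the product of all transpositions in $\overline F_1$ is a single cycle $\zeta$ of length $n$, set $\overline F=\overline F_1$. Otherwise, if the product of all transpositions in $\overline F_2$ is a single cycle $\zeta$ of length $n$, set $\overline F=\overline F_2$. Otherwise set $\overline F=\dag$, a formal symbol for failure. Step (ii). If $\overline F\ne\dag$, let $\sigma$ be the unique permutation of $\{1,\dots,n\}$ with $\sigma(1)=1$ and $\sigma^{-1}\zeta\sigma=(1\,\cdots\,n)$, and let $\Lambda(F)$ be obtained from $\overline F$ by replacing each transposition $(i\,j)$ by $\sigma^{-1}(i\,j)\sigma=(\sigma(i)\,\sigma(j))$; this is an element of $\mathcal F^g_n$. If $\overline F=\dag$, set $\Lambda(F)=\dag$. By convention $\Lambda(\dag)=\dag$. *)

theory Defs
  imports "HOL-Probability.Probability" "HOL-Combinatorics.Combinatorics"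
begin

type_synonym perm = "nat \<Rightarrow> nat"

definition transpositions :: "nat \<Rightarrow> perm set" where
  "transpositions n = {Transposition.transpose i j | i j. i \<in> {1..n} \<and> j \<in> {1..n} \<and> i \<noteq> j}"

definition long_cycle :: "nat \<Rightarrow> perm" where
  "long_cycle n = cycle_of_list [1..<Suc n]"

text \<open>Products are taken from left to right: the head of the list acts first.\<close>

fun prod_lr :: "perm list \<Rightarrow> perm" where
  "prod_lr [] = id"
| "prod_lr (t # ts) = prod_lr ts \<circ> t"

definition is_full_cycle :: "nat \<Rightarrow> perm \<Rightarrow> bool" where
  "is_full_cycle n \<zeta> \<longleftrightarrow> (\<exists>cs. distinct cs \<and> set cs = {1..n} \<and> \<zeta> = cycle_of_list cs)"

definition factorizations :: "nat \<Rightarrow> nat \<Rightarrow> perm list set" where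
  "factorizations g n =
     {ts. length ts = n - 1 + 2 * g \<and> set ts \<subseteq> transpositions n \<and> prod_lr ts = long_cycle n}"

text \<open>
  For \<open>1 \<le> v < w \<le> length ts + 2\<close>, the list obtained from \<open>ts\<close> by inserting \<open>x\<close> and \<open>y\<close> so
  that (counting from 1) they occupy the positions \<open>v\<close> and \<open>w\<close> of the new list.
\<close>

definition insert2 :: "nat \<Rightarrow> nat \<Rightarrow> 'a \<Rightarrow> 'a \<Rightarrow> 'a list \<Rightarrow> 'a list" where
  "insert2 v w x y ts =
     take (v - 1) ts @ [x] @ drop (v - 1) (take (w - 2) ts) @ [y] @ drop (w - 2) ts"

text \<open>The failure symbol is \<^const>\<open>None\<close>.\<close>

definition step_i :: "nat \<Rightarrow> nat \<times> nat \<Rightarrow> nat \<times> nat \<times> nat \<Rightarrow> perm list \<Rightarrow> perm list option" where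
  "step_i n = (\<lambda>(v, w) (a, b, c) ts.
     let F1 = insert2 v w (Transposition.transpose a c) (Transposition.transpose a b) ts;
         F2 = insert2 v w (Transposition.transpose a b) (Transposition.transpose a c) ts
     in if is_full_cycle n (prod_lr F1) then Some F1
        else if is_full_cycle n (prod_lr F2) then Some F2
        else None)"

definition relabelling :: "nat \<Rightarrow> perm \<Rightarrow> perm" where
  "relabelling n \<zeta> =
     (THE \<sigma>. \<sigma> permutes {1..n} \<and> \<sigma> 1 = 1 \<and> prod_lr [inv \<sigma>, \<zeta>, \<sigma>] = long_cycle n)"

definition step_ii :: "nat \<Rightarrow> perm list \<Rightarrow> perm list" where
  "step_ii n ts =
     (let \<sigma> = relabelling n (prod_lr ts) in map (\<lambda>t. prod_lr [inv \<sigma>, t, \<sigma>]) ts)"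

definition position_pairs :: "nat \<Rightarrow> nat \<Rightarrow> (nat \<times> nat) set" where
  "position_pairs g n = {(v, w). 1 \<le> v \<and> v < w \<and> w \<le> n - 1 + 2 * g}"

definition label_triples :: "nat \<Rightarrow> (nat \<times> nat \<times> nat) set" where
  "label_triples n = {(a, b, c). 1 \<le> a \<and> a < b \<and> b < c \<and> c \<le> n}"

text \<open>
  The random map sends each possible input to the law of its image. Here \<open>g\<close> is the genus of
  the output, so the input has genus \<open>g - 1\<close>. For \<open>n < 3\<close> there are no triples, and
  \<^const>\<open>pmf_of_set\<close> of the empty set is an unspecified distribution; only the behaviour for
  large \<open>n\<close> matters.
\<close>

fun Lambda :: "nat \<Rightarrow> nat \<Rightarrow> perm list option \<Rightarrow> perm list option pmf" where
  "Lambda g n None = return_pmf None"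
| "Lambda g n (Some ts) =
     do {
       vw \<leftarrow> pmf_of_set (position_pairs g n);
       abc \<leftarrow> pmf_of_set (label_triples n);
       return_pmf (map_option (step_ii n) (step_i n vw abc ts))
     }"

definition uniform_factorization :: "nat \<Rightarrow> nat \<Rightarrow> perm list option pmf" where
  "uniform_factorization g n = map_pmf Some (pmf_of_set (factorizations g n))"

definition tv_dist :: "'a pmf \<Rightarrow> 'a pmf \<Rightarrow> real" where
  "tv_dist p q = (SUP A. \<bar>measure_pmf.prob p A - measure_pmf.prob q A\<bar>)"

end

theory Submission
  imports Defs "HOL-Complex_Analysis.Complex_Analysis" "HOL-Real_Asymp.Real_Asymp"
begin

text \<open>
  Write \<open>h = g - 1\<close> and call \<open>(F, (v, w), (a, b, c))\<close>, with \<open>F\<close> of genus \<open>h\<close>, a sample. The image of a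
  uniform random factorization under the random map gives a factorization \<open>G\<close> of genus \<open>g\<close> the mass
  \<open>N(G) / S\<close>, where \<open>S\<close> is the number of samples and \<open>N(G)\<close> the number of samples sent to \<open>G\<close>. This
  law is close to uniform because of two facts: \<open>S\<close> is asymptotically \<open>2 g\<close> times the number of
  factorizations of genus \<open>g\<close> (\<open>ratio_genus_tendsto\<close>), and once a vanishing proportion of
  samples has been discarded (\<open>few_bad_samples\<close>), each \<open>G\<close> has at most \<open>2 g\<close> preimages
  (\<open>card_fibre\<close>). Almost all of the mass is then spread over the factorizations of genus \<open>g\<close> with a
  uniform bound which is asymptotically the mass of the uniform law, so there is no room for a
  discrepancy (\<open>tv_one_sided\<close>); the same comparison shows that failure has vanishing probability.

  The count is exact. A principal minor of the matrix of a permutation \<open>\<pi>\<close>, as a function of \<open>\<pi>\<close>, is a sum of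
  two eigenfunctions of the operator that multiplies \<open>\<pi>\<close> by a random transposition
  (\<open>sum_words_minor_det\<close>), and the indicator of the full cycles is an alternating sum of such minors
  (\<open>full_cycle_indicator\<close>). The number of factorizations is therefore an alternating sum of powers
  of eigenvalues, and this sum is a coefficient of a power of \<open>exp (z/2) - exp (-z/2)\<close>
  (\<open>card_factorizations\<close>), from which all asymptotics are read off.

  The bound on preimages uses rounds. Follow the labels through \<open>F = (t\<^sub>1, t\<^sub>2, \<dots>)\<close>: the round of the
  label \<open>x\<close> after \<open>k\<close> steps is the label that \<open>t\<^sub>1, \<dots>, t\<^sub>k\<close> have moved to \<open>x\<close>. A step \<open>(x y)\<close>
  exchanges the rounds of \<open>x\<close> and \<open>y\<close>, so exactly one of them descends, and a factorization of genus
  \<open>g\<close> has \<open>n - 1 + 2 g\<close> descents. Every label other than 1 begins at round \<open>x\<close>, ends at round \<open>x - 1\<close>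
  and so has a descent of its own; hence at most \<open>2 g\<close> labels have two of them
  (\<open>card_multiple_descents\<close>; this plays the part of Chapuy's trisection lemma for unicellular maps).
  In a good sample the insertion turns the label \<open>a\<close> into a label with two descents, and the positions
  \<open>v\<close>, \<open>w\<close>, then the whole sample, can be recovered from the rounds of that label
  (\<open>good_insertion\<close>, \<open>good_insertion_inj\<close>).

  A sample is good when the rounds of \<open>a\<close>, \<open>b\<close>, \<open>c\<close> always stay near these labels and go around the
  circle only once, and \<open>a\<close>, \<open>b\<close>, \<open>c\<close> are far apart. That most labels have this property
  (\<open>few_not_tame\<close>) follows if few transpositions exchange two rounds that are far apart on the circle.
  Moving a transposition to the front, it suffices to look at the first one. If it cuts the long cycle
  into arcs of lengths \<open>s\<close> and \<open>n - s\<close>, then shuffling factorizations of the two arcs gives a lower bound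
  for the number of completions, whose proportion converges to \<open>s\<^sup>s\<^sup>-\<^sup>1 exp (-s) / s!\<close>. These numbers form
  the Borel distribution and have sum 1 (\<open>borel_sum\<close>), so bounded arcs already account for everything
  (\<open>few_wide_first_steps\<close>).
\<close>

unbundle no vec_syntax
unbundle fps_syntax

section \<open>Words in transpositions\<close>

abbreviation swap :: "nat \<Rightarrow> nat \<Rightarrow> perm" where
  "swap \<equiv> Transposition.transpose"

definition transps :: "nat set \<Rightarrow> perm set" where
  "transps X = {swap i j | i j. i \<in> X \<and> j \<in> X \<and> i \<noteq> j}"

definition words :: "nat set \<Rightarrow> nat \<Rightarrow> perm list set" where
  "words X m = {ts. length ts = m \<and> set ts \<subseteq> transps X}"

text \<open>
  Transitivity, rather than a list of the points in cyclic order, is what the minors detect.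
\<close>

definition full_cycle_on :: "nat set \<Rightarrow> perm \<Rightarrow> bool" where
  "full_cycle_on X \<zeta> \<longleftrightarrow> \<zeta> permutes X \<and> (\<forall>B\<subseteq>X. B \<noteq> {} \<longrightarrow> \<zeta> ` B \<subseteq> B \<longrightarrow> B = X)"

lemma transpositions_eq_transps: "transpositions n = transps {1..n}"
  by (simp add: transpositions_def transps_def)

lemma transps_permutes: "t \<in> transps X \<Longrightarrow> t permutes X"
  by (auto simp: transps_def intro: permutes_swap_id)

lemma transps_image:
  "transps X = (\<lambda>(i, j). swap i j) ` {(i, j). i \<in> X \<and> j \<in> X \<and> i < j}"
proof -
  have 1: "swap i j \<in> (\<lambda>(i, j). swap i j) ` {(i, j). i \<in> X \<and> j \<in> X \<and> i < j}"
    if "i \<in> X" "j \<in> X" "i \<noteq> j" for i j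
  proof (cases "i < j")
    case True
    show ?thesis by (rule image_eqI[of _ _ "(i, j)"]) (use True that in auto)
  next
    case False
    show ?thesis by (rule image_eqI[of _ _ "(j, i)"]) (use False that in \<open>auto simp: transpose_commute\<close>)
  qed
  show ?thesis
  proof (intro equalityI subsetI)
    fix t assume "t \<in> transps X"
    thus "t \<in> (\<lambda>(i, j). swap i j) ` {(i, j). i \<in> X \<and> j \<in> X \<and> i < j}"
      using 1 unfolding transps_def by blast
  next
    fix t assume "t \<in> (\<lambda>(i, j). swap i j) ` {(i, j). i \<in> X \<and> j \<in> X \<and> i < j}"
    then obtain i j where "t = swap i j" "i \<in> X" "j \<in> X" "i < j" by auto
    thus "t \<in> transps X" unfolding transps_def by blast
  qed
qed

lemma transpose_eq_iff_ordered:
  fixes i j :: nat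
  assumes "i < j" "k < l"
  shows "swap i j = swap k l \<longleftrightarrow> i = k \<and> j = l"
proof
  assume *: "swap i j = swap k l"
  have "swap k l i = j" "swap k l j = i"
    using *[symmetric] by auto
  thus "i = k \<and> j = l" using assms by (auto simp: Transposition.transpose_def split: if_splits)
qed auto

lemma inj_on_transpose_ordered:
  "inj_on (\<lambda>(i, j). swap i j) {(i :: nat, j). i \<in> X \<and> j \<in> X \<and> i < j}"
  by (auto simp: inj_on_def transpose_eq_iff_ordered)

lemma finite_transps:
  assumes "finite X"
  shows "finite (transps X)"
proof -
  have "finite {(i, j). i \<in> X \<and> j \<in> X \<and> i < j}"
    by (rule finite_subset[of _ "X \<times> X"]) (use assms in auto)
  thus ?thesis unfolding transps_image by (rule finite_imageI)
qed

lemma finite_words: "finite X \<Longrightarrow> finite (words X m)"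
  using finite_lists_length_eq[OF finite_transps, of X m] by (simp add: words_def conj_commute)

lemma prod_lr_append: "prod_lr (xs @ ys) = prod_lr ys \<circ> prod_lr xs"
  by (induction xs) auto

lemma prod_lr_permutes: "(\<And>t. t \<in> set ts \<Longrightarrow> t permutes X) \<Longrightarrow> prod_lr ts permutes X"
  by (induction ts) (auto intro: permutes_compose permutes_id)

lemma prod_lr_words_permutes: "ts \<in> words X m \<Longrightarrow> prod_lr ts permutes X"
  by (rule prod_lr_permutes) (auto simp: words_def dest: transps_permutes)

lemma sum_transpose_pairs:
  fixes h :: "perm \<Rightarrow> real"
  assumes "finite X"
  shows "(\<Sum>i\<in>X. \<Sum>j\<in>X. h (swap i j)) = 2 * (\<Sum>t\<in>transps X. h t) + card X * h id"
proof -
  let ?t = "\<lambda>(i, j). h (swap i j)"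
  let ?A = "{(i, j). i \<in> X \<and> j \<in> X \<and> i < j}"
  let ?B = "{(i, j). i \<in> X \<and> j \<in> X \<and> j < i}"
  let ?C = "(\<lambda>i. (i, i)) ` X"
  have fin: "finite ?A" "finite ?B" "finite ?C"
    using assms by (auto intro: finite_subset[where B = "X \<times> X"])
  have "(\<Sum>i\<in>X. \<Sum>j\<in>X. h (swap i j)) = sum ?t (X \<times> X)"
    by (simp add: sum.cartesian_product)
  also have "X \<times> X = (?A \<union> ?B) \<union> ?C"
    by auto
  also have "sum ?t \<dots> = (sum ?t ?A + sum ?t ?B) + sum ?t ?C"
    using fin by (subst sum.union_disjoint; (subst sum.union_disjoint)?) auto
  also have "sum ?t ?B = sum ?t ?A"
    by (rule sum.reindex_bij_witness[where i = "\<lambda>(i, j). (j, i)" and j = "\<lambda>(i, j). (j, i)"])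
      (auto simp: transpose_commute)
  also have "sum ?t ?A = (\<Sum>t\<in>transps X. h t)"
    unfolding transps_image by (subst sum.reindex[OF inj_on_transpose_ordered]) (auto intro: sum.cong)
  also have "sum ?t ?C = card X * h id"
    by (subst sum.reindex) (auto simp: inj_on_def id_def)
  finally show ?thesis by simp
qed

section \<open>Minors of permutation matrices\<close>

text \<open>
  The Leibniz formula, with rows and columns indexed by an arbitrary set of labels; the first
  argument of the entry function is the row.
\<close>

definition minor_det :: "nat set \<Rightarrow> (nat \<Rightarrow> nat \<Rightarrow> real) \<Rightarrow> real" where
  "minor_det S f = (\<Sum>p | p permutes S. of_int (sign p) * (\<Prod>i\<in>S. f (p i) i))"

lemma minor_det_cong:
  assumes "\<And>r c. r \<in> S \<Longrightarrow> c \<in> S \<Longrightarrow> f r c = g r c"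
  shows "minor_det S f = minor_det S g"
  unfolding minor_det_def
  by (intro sum.cong refl arg_cong2[where f = "(*)"] prod.cong assms) (auto simp: permutes_in_image)

lemma minor_det_column:
  assumes "finite S" "l \<in> S"
  shows "minor_det S (\<lambda>r c. if c = l then v r else f r c) =
    (\<Sum>p | p permutes S. v (p l) * (of_int (sign p) * (\<Prod>i\<in>S - {l}. f (p i) i)))"
  unfolding minor_det_def
proof (intro sum.cong refl)
  fix p
  have "(\<Prod>i\<in>S. if i = l then v (p i) else f (p i) i) = v (p l) * (\<Prod>i\<in>S - {l}. f (p i) i)"
    using assms by (subst prod.remove[of _ l]) (auto intro: prod.cong)
  thus "of_int (sign p) * (\<Prod>i\<in>S. if i = l then v (p i) else f (p i) i) =
      v (p l) * (of_int (sign p) * (\<Prod>i\<in>S - {l}. f (p i) i))"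
    by simp
qed

lemma minor_det_column_sum:
  assumes "finite S" "l \<in> S"
  shows "minor_det S (\<lambda>r c. if c = l then \<Sum>x\<in>I. g x r else f r c) =
    (\<Sum>x\<in>I. minor_det S (\<lambda>r c. if c = l then g x r else f r c))"
  unfolding minor_det_column[OF assms, of "\<lambda>r. \<Sum>x\<in>I. g x r" f]
    minor_det_column[OF assms, of "g _" f]
  by (subst sum.swap) (simp add: sum_distrib_right)

lemma minor_det_swap:
  assumes "finite S" "k \<in> S" "l \<in> S" "k \<noteq> l"
  shows "minor_det S (\<lambda>r c. f r (swap k l c)) = - minor_det S f"
proof -
  let ?t = "swap k l"
  have t: "?t permutes S" using assms by (simp add: permutes_swap_id)
  have "minor_det S (\<lambda>r c. f r (?t c)) = (\<Sum>p | p permutes S. - (of_int (sign p) * (\<Prod>i\<in>S. f (p i) i)))"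
    unfolding minor_det_def
  proof (rule sum.reindex_bij_witness[where i = "\<lambda>p. p \<circ> ?t" and j = "\<lambda>p. p \<circ> ?t"])
    fix p assume "p \<in> {p. p permutes S}"
    hence p: "p permutes S" by simp
    show "p \<circ> ?t \<circ> ?t = p" by (simp add: comp_assoc)
    show "p \<circ> ?t \<in> {p. p permutes S}" using p t permutes_compose by blast
    have "sign (p \<circ> ?t) = - sign p"
      using p t assms by (subst sign_compose) (auto simp: sign_swap_id permutation_permutes)
    moreover have "(\<Prod>i\<in>S. f ((p \<circ> ?t) i) i) = (\<Prod>i\<in>S. f (p i) (?t i))"
      by (rule prod.reindex_bij_witness[where i = ?t and j = ?t]) (use t in \<open>auto simp: permutes_in_image\<close>)
    ultimately show "- (of_int (sign (p \<circ> ?t)) * (\<Prod>i\<in>S. f ((p \<circ> ?t) i) i)) =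
        of_int (sign p) * (\<Prod>i\<in>S. f (p i) (?t i))" by simp
    show "p \<circ> ?t \<circ> ?t = p" by (simp add: comp_assoc)
    show "p \<circ> ?t \<in> {p. p permutes S}" using p t permutes_compose by blast
  qed
  thus ?thesis by (simp add: minor_det_def sum_negf)
qed

lemma minor_det_equal_columns:
  assumes "finite S" "k \<in> S" "l \<in> S" "k \<noteq> l" "\<And>r. r \<in> S \<Longrightarrow> f r k = f r l"
  shows "minor_det S f = 0"
proof -
  have "minor_det S f = minor_det S (\<lambda>r c. f r (swap k l c))"
    by (rule minor_det_cong) (use assms(5) in \<open>auto simp: Transposition.transpose_def\<close>)
  thus ?thesis using minor_det_swap[OF assms(1-4), of f] by simp
qed

text \<open>
  The matrix of \<open>\<pi>\<close> with the columns outside \<open>L\<close> replaced by columns of ones. A column of ones is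
  the sum of all columns of a permutation matrix.
\<close>

definition perm_columns :: "perm \<Rightarrow> nat set \<Rightarrow> nat \<Rightarrow> nat \<Rightarrow> real" where
  "perm_columns \<pi> L r c = (if c \<in> L then of_bool (r = \<pi> c) else 1)"

lemma sum_perm_row:
  assumes "\<pi> permutes X" "finite X" "r \<in> X"
  shows "(\<Sum>j\<in>X. of_bool (r = \<pi> j) :: real) = 1"
proof -
  have "(\<Sum>j\<in>X. of_bool (r = \<pi> j) :: real) = (\<Sum>j\<in>X. of_bool (r = j))"
    by (rule sum.permute[OF assms(1), of "\<lambda>j. of_bool (r = j)", symmetric, unfolded comp_def])
  also have "\<dots> = 1" using assms by (simp add: of_bool_def)
  finally show ?thesis .
qed

text \<open>
  Multiplying \<open>\<pi>\<close> by \<open>(l j)\<close> with \<open>j\<close> outside \<open>L\<close> puts the column of \<open>j\<close> in the place of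
  the column of \<open>l\<close>. Summed over all \<open>j\<close> this gives a column of ones, and the terms with
  \<open>j\<close> in \<open>L\<close> other than \<open>l\<close> vanish because a column is repeated.
\<close>

lemma sum_minor_det_replace_column:
  assumes X: "finite X" "S \<subseteq> X" "L \<subseteq> S" "\<pi> permutes X" and l: "l \<in> L"
  shows "(\<Sum>j\<in>X - L. minor_det S (perm_columns (\<pi> \<circ> swap l j) L)) =
    minor_det S (perm_columns \<pi> (L - {l})) - minor_det S (perm_columns \<pi> L)"
proof -
  have fin: "finite S" "finite L" using X finite_subset by metis+
  have lS: "l \<in> S" using l X by auto
  define D where "D j = minor_det S (\<lambda>r c. if c = l then of_bool (r = \<pi> j) else perm_columns \<pi> L r c)" for j
  have 1: "minor_det S (perm_columns (\<pi> \<circ> swap l j) L) = D j" if "j \<in> X - L" for j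
    unfolding D_def by (rule minor_det_cong)
      (use that l in \<open>auto simp: perm_columns_def Transposition.transpose_def\<close>)
  have "sum D X = minor_det S (\<lambda>r c. if c = l then \<Sum>j\<in>X. of_bool (r = \<pi> j) else perm_columns \<pi> L r c)"
    unfolding D_def by (rule minor_det_column_sum[OF fin(1) lS, symmetric])
  also have "\<dots> = minor_det S (perm_columns \<pi> (L - {l}))"
    by (rule minor_det_cong) (use X sum_perm_row[OF X(4,1)] in \<open>auto simp: perm_columns_def\<close>)
  finally have 2: "sum D X = minor_det S (perm_columns \<pi> (L - {l}))" .
  have "D j = 0" if "j \<in> L - {l}" for j
    unfolding D_def by (rule minor_det_equal_columns[of S l j])
      (use that X lS fin in \<open>auto simp: perm_columns_def\<close>)
  hence "sum D (L - {l}) = 0" by simp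
  moreover have "D l = minor_det S (perm_columns \<pi> L)"
    unfolding D_def by (rule minor_det_cong) (use l in \<open>auto simp: perm_columns_def\<close>)
  ultimately have 3: "sum D L = minor_det S (perm_columns \<pi> L)"
    using fin l by (simp add: sum.remove[of L l])
  have "sum D X = sum D (X - L) + sum D L"
    using X by (intro sum.subset_diff) auto
  thus ?thesis using 1 2 3 by simp
qed

text \<open>
  The sum of the contents of the hook partition \<open>(n - k, 1\<^sup>k)\<close>, which is the eigenvalue of the sum of
  all transpositions on the corresponding representation, an exterior power of the standard one.
\<close>

definition hook_content :: "nat \<Rightarrow> nat \<Rightarrow> real" where
  "hook_content n k = real n * (real n - 1) / 2 - real n * real k"

text \<open>
  Right multiplication by a transposition permutes the columns: it changes the sign of the minor if
  both labels are in \<open>L\<close>, changes nothing if neither is, and otherwise replaces a column. Counting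
  ordered pairs of labels, equal ones included, avoids case distinctions.
\<close>

lemma sum_minor_det_transps:
  assumes X: "finite X" "S \<subseteq> X" "L \<subseteq> S" "\<pi> permutes X"
  shows "(\<Sum>t\<in>transps X. minor_det S (perm_columns (\<pi> \<circ> t) L)) =
    hook_content (card X) (card L) * minor_det S (perm_columns \<pi> L) +
    (\<Sum>l\<in>L. minor_det S (perm_columns \<pi> (L - {l})))"
proof -
  have fin: "finite S" "finite L" using X finite_subset by metis+
  have LX: "L \<subseteq> X" using X by auto
  define h where "h t = minor_det S (perm_columns (\<pi> \<circ> t) L)" for t
  define D where "D = minor_det S (perm_columns \<pi> L)"
  define k where "k = real (card L)"
  define n where "n = real (card X)"
  define W where "W = (\<Sum>l\<in>L. minor_det S (perm_columns \<pi> (L - {l})))"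
  have cXL: "real (card (X - L)) = n - k"
    using LX X(1) fin by (simp add: card_Diff_subset n_def k_def card_mono of_nat_diff)
  let ?T = "swap :: nat \<Rightarrow> nat \<Rightarrow> perm"
  have out: "h (?T i j) = D" if "i \<in> X - L" "j \<in> X - L" for i j
    unfolding h_def D_def by (rule minor_det_cong)
      (use that in \<open>auto simp: perm_columns_def Transposition.transpose_def\<close>)
  have ins: "h (?T i j) = (if i = j then D else - D)" if "i \<in> L" "j \<in> L" for i j
  proof (cases "i = j")
    case False
    have "h (?T i j) = minor_det S (\<lambda>r c. perm_columns \<pi> L r (?T i j c))"
      unfolding h_def by (rule minor_det_cong)
        (use that in \<open>auto simp: perm_columns_def Transposition.transpose_def\<close>)
    thus ?thesis using minor_det_swap[of S i j "perm_columns \<pi> L"] False that X fin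
      by (auto simp: D_def)
  qed (auto simp: h_def D_def)
  have A: "(\<Sum>i\<in>X - L. \<Sum>j\<in>X - L. h (?T i j)) = (n - k) * (n - k) * D"
    using out by (simp add: cXL)
  have "(\<Sum>j\<in>L. h (?T i j)) = D - (k - 1) * D" if "i \<in> L" for i
  proof -
    have "(\<Sum>j\<in>L. h (?T i j)) = D + (\<Sum>j\<in>L - {i}. h (?T i j))"
      using fin that ins[of i i] by (subst sum.remove[of L i]) auto
    also have "(\<Sum>j\<in>L - {i}. h (?T i j)) = (\<Sum>j\<in>L - {i}. - D)"
      using ins that by (intro sum.cong) auto
    also have "\<dots> = - (k - 1) * D"
      using card.remove[OF fin(2) that] by (simp add: k_def)
    finally show ?thesis by (simp add: algebra_simps)
  qed
  hence B: "(\<Sum>i\<in>L. \<Sum>j\<in>L. h (?T i j)) = k * (D - (k - 1) * D)"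
    by (simp add: k_def)
  have "(\<Sum>j\<in>X - L. h (?T i j)) = minor_det S (perm_columns \<pi> (L - {i})) - D" if "i \<in> L" for i
    unfolding h_def D_def by (rule sum_minor_det_replace_column[OF X that])
  hence C: "(\<Sum>i\<in>L. \<Sum>j\<in>X - L. h (?T i j)) = W - k * D"
    by (simp add: sum_subtractf W_def k_def)
  have C': "(\<Sum>i\<in>X - L. \<Sum>j\<in>L. h (?T i j)) = W - k * D"
    unfolding C[symmetric] by (subst sum.swap) (simp add: transpose_commute)
  have split: "(\<Sum>j\<in>X. g j) = (\<Sum>j\<in>X - L. g j) + (\<Sum>j\<in>L. g j)" for g :: "nat \<Rightarrow> real"
    using LX X by (intro sum.subset_diff) auto
  have "(\<Sum>i\<in>X. \<Sum>j\<in>X. h (?T i j)) = (n - k) * (n - k) * D + (W - k * D) + ((W - k * D) + k * (D - (k - 1) * D))"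
    unfolding split sum.distrib A B C C' by simp
  moreover have "h id = D" by (simp add: h_def D_def)
  ultimately have "2 * (\<Sum>t\<in>transps X. h t) = 2 * (hook_content (card X) (card L) * D + W)"
    using sum_transpose_pairs[OF X(1), of h]
    by (simp add: hook_content_def n_def[symmetric] k_def[symmetric] field_simps)
  thus ?thesis by (simp add: h_def D_def W_def)
qed

lemma sum_words_Suc:
  "(\<Sum>ts\<in>words X (Suc m). g (prod_lr ts)) = (\<Sum>ts\<in>words X m. \<Sum>t\<in>transps X. g (prod_lr ts \<circ> t))"
proof -
  have "(\<Sum>ts\<in>words X m. \<Sum>t\<in>transps X. g (prod_lr ts \<circ> t)) =
      (\<Sum>(ts, t)\<in>words X m \<times> transps X. g (prod_lr ts \<circ> t))"
    by (simp add: sum.cartesian_product)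
  also have "\<dots> = (\<Sum>ts\<in>words X (Suc m). g (prod_lr ts))"
    by (rule sum.reindex_bij_witness[where i = "\<lambda>ts. (tl ts, hd ts)" and j = "\<lambda>(ts, t). t # ts"])
      (auto simp: words_def length_Suc_conv)
  finally show ?thesis by simp
qed

text \<open>
  With one column of ones present, the additional terms of \<open>sum_minor_det_transps\<close> have two such
  columns and vanish, so this minor is an eigenfunction.
\<close>

lemma sum_words_minor_det_ones:
  assumes X: "finite X" "S \<subseteq> X" and l: "l \<in> S"
  shows "(\<Sum>ts\<in>words X m. minor_det S (perm_columns (prod_lr ts) (S - {l}))) = hook_content (card X) (card S - 1) ^ m"
proof (induction m)
  case 0
  have fin: "finite S" using X finite_subset by metis
  have "minor_det S (perm_columns id (S - {l})) = (\<Sum>p\<in>{id :: perm}. 1)"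
    unfolding minor_det_def
  proof (rule sum.mono_neutral_cong_right)
    show "\<forall>p\<in>{p. p permutes S} - {id}. of_int (sign p) * (\<Prod>i\<in>S. perm_columns id (S - {l}) (p i) i) = 0"
    proof (intro ballI, rule ccontr)
      fix p assume "p \<in> {p. p permutes S} - {id}"
        and nz: "of_int (sign p) * (\<Prod>i\<in>S. perm_columns id (S - {l}) (p i) i) \<noteq> 0"
      hence p: "p permutes S" "p \<noteq> id" by auto
      have eq: "p i = i" if "i \<in> S - {l}" for i
        using nz fin that by (auto simp: perm_columns_def prod_zero_iff)
      have "p permutes {l}"
        by (rule permutes_superset[OF p(1)]) (use eq in auto)
      thus False using p by (simp add: permutes_sing)
    qed
  qed (auto simp: permutes_id finite_permutations fin perm_columns_def intro!: prod.neutral)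
  moreover have "words X 0 = {[]}" by (auto simp: words_def)
  ultimately show ?case by (simp add: id_def)
next
  case (Suc m)
  have fin: "finite S" using X finite_subset by metis
  have "(\<Sum>ts\<in>words X (Suc m). minor_det S (perm_columns (prod_lr ts) (S - {l}))) =
      (\<Sum>ts\<in>words X m. \<Sum>t\<in>transps X. minor_det S (perm_columns (prod_lr ts \<circ> t) (S - {l})))"
    by (rule sum_words_Suc)
  also have "\<dots> = (\<Sum>ts\<in>words X m. hook_content (card X) (card S - 1) * minor_det S (perm_columns (prod_lr ts) (S - {l})))"
  proof (rule sum.cong[OF refl])
    fix ts assume ts: "ts \<in> words X m"
    have "minor_det S (perm_columns (prod_lr ts) (S - {l} - {l'})) = 0" if "l' \<in> S - {l}" for l'
      by (rule minor_det_equal_columns[of S l l']) (use that l fin in \<open>auto simp: perm_columns_def\<close>)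
    thus "(\<Sum>t\<in>transps X. minor_det S (perm_columns (prod_lr ts \<circ> t) (S - {l}))) =
      hook_content (card X) (card S - 1) * minor_det S (perm_columns (prod_lr ts) (S - {l}))"
      using l fin by (subst sum_minor_det_transps[OF X(1,2) _ prod_lr_words_permutes[OF ts]]) auto
  qed
  also have "\<dots> = hook_content (card X) (card S - 1) ^ Suc m"
    by (simp add: sum_distrib_left[symmetric] Suc.IH)
  finally show ?case .
qed

text \<open>
  The minor itself satisfies an inhomogeneous recurrence whose source is the eigenfunction with one
  column of ones. The two eigenvalues differ by the number of labels, which is the reason for the
  factor on the left.
\<close>

lemma sum_words_minor_det:
  assumes X: "finite X" "S \<subseteq> X"
  shows "real (card X) * (\<Sum>ts\<in>words X m. minor_det S (perm_columns (prod_lr ts) S)) =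
    (real (card X) - real (card S)) * hook_content (card X) (card S) ^ m +
    real (card S) * hook_content (card X) (card S - 1) ^ m"
proof (induction m)
  case 0
  have fin: "finite S" using X finite_subset by metis
  have "minor_det S (perm_columns id S) = (\<Sum>p\<in>{id :: perm}. 1)"
    unfolding minor_det_def
  proof (rule sum.mono_neutral_cong_right)
    show "\<forall>p\<in>{p. p permutes S} - {id}. of_int (sign p) * (\<Prod>i\<in>S. perm_columns id S (p i) i) = 0"
    proof (intro ballI, rule ccontr)
      fix p assume "p \<in> {p. p permutes S} - {id}"
        and nz: "of_int (sign p) * (\<Prod>i\<in>S. perm_columns id S (p i) i) \<noteq> 0"
      hence p: "p permutes S" "p \<noteq> id" by auto
      have eq: "p i = i" if "i \<in> S" for i
        using nz fin that by (auto simp: perm_columns_def prod_zero_iff)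
      have "p permutes {}"
        by (rule permutes_superset[OF p(1)]) (use eq in auto)
      thus False using p by simp
    qed
  qed (auto simp: permutes_id finite_permutations fin perm_columns_def intro!: prod.neutral)
  moreover have "words X 0 = {[]}" by (auto simp: words_def)
  ultimately show ?case by (simp add: id_def)
next
  case (Suc m)
  define U where "U = (\<Sum>ts\<in>words X m. minor_det S (perm_columns (prod_lr ts) S))"
  define c where "c = hook_content (card X) (card S)"
  define c' where "c' = hook_content (card X) (card S - 1)"
  have "(\<Sum>ts\<in>words X (Suc m). minor_det S (perm_columns (prod_lr ts) S)) =
      (\<Sum>ts\<in>words X m. \<Sum>t\<in>transps X. minor_det S (perm_columns (prod_lr ts \<circ> t) S))"
    by (rule sum_words_Suc)
  also have "\<dots> = (\<Sum>ts\<in>words X m. c * minor_det S (perm_columns (prod_lr ts) S) +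
      (\<Sum>l\<in>S. minor_det S (perm_columns (prod_lr ts) (S - {l}))))"
    unfolding c_def
    by (intro sum.cong refl sum_minor_det_transps[OF X _ prod_lr_words_permutes]) auto
  also have "\<dots> = c * U + (\<Sum>l\<in>S. \<Sum>ts\<in>words X m. minor_det S (perm_columns (prod_lr ts) (S - {l})))"
    by (simp add: sum.distrib sum_distrib_left[symmetric] U_def sum.swap[of _ S])
  also have "\<dots> = c * U + card S * c' ^ m"
    using sum_words_minor_det_ones[OF X] by (simp add: c'_def)
  finally have step: "(\<Sum>ts\<in>words X (Suc m). minor_det S (perm_columns (prod_lr ts) S)) = c * U + card S * c' ^ m" .
  have rel: "real (card S) * c' = real (card S) * (c + real (card X))"
    by (cases "card S") (auto simp: c_def c'_def hook_content_def algebra_simps)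
  have IH: "real (card X) * U = (real (card X) - real (card S)) * c ^ m + real (card S) * c' ^ m"
    using Suc.IH by (simp add: U_def c_def c'_def)
  have "real (card X) * (c * U + card S * c' ^ m) = c * (real (card X) * U) + real (card X) * card S * c' ^ m"
    by (simp add: algebra_simps)
  also have "\<dots> = (real (card X) - real (card S)) * c ^ Suc m + (real (card S) * (c + real (card X))) * c' ^ m"
    unfolding IH by (simp add: algebra_simps)
  also have "\<dots> = (real (card X) - real (card S)) * c ^ Suc m + real (card S) * c' ^ Suc m"
    unfolding rel[symmetric] by (simp add: algebra_simps)
  finally show ?case unfolding step c_def c'_def .
qed

text \<open>
  Expand every factor of the Leibniz formula; the factors from the identity matrix force the
  permutation to be supported on the chosen subset.
\<close>

lemma minor_det_one_minus_perm:
  assumes "finite R"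
  shows "minor_det R (\<lambda>r c. of_bool (r = c) - of_bool (r = \<pi> c)) =
    (\<Sum>S\<in>Pow R. (-1) ^ card S * minor_det S (perm_columns \<pi> S))"
proof -
  have "minor_det R (\<lambda>r c. of_bool (r = c) - of_bool (r = \<pi> c)) =
      (\<Sum>q | q permutes R. of_int (sign q) * (\<Prod>i\<in>R. - of_bool (q i = \<pi> i) + of_bool (q i = i)))"
    by (simp add: minor_det_def)
  also have "\<dots> = (\<Sum>q | q permutes R. \<Sum>S\<in>Pow R. of_int (sign q) *
      ((\<Prod>i\<in>S. - of_bool (q i = \<pi> i)) * (\<Prod>i\<in>R - S. of_bool (q i = i))))"
    by (simp only: prod_add[OF assms] sum_distrib_left)
  also have "\<dots> = (\<Sum>S\<in>Pow R. \<Sum>q | q permutes R. of_int (sign q) *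
      ((\<Prod>i\<in>S. - of_bool (q i = \<pi> i)) * (\<Prod>i\<in>R - S. of_bool (q i = i))))"
    by (rule sum.swap)
  also have "\<dots> = (\<Sum>S\<in>Pow R. (-1) ^ card S * minor_det S (perm_columns \<pi> S))"
  proof (rule sum.cong[OF refl])
    fix S assume "S \<in> Pow R"
    hence S: "S \<subseteq> R" by simp
    hence fin: "finite S" using assms finite_subset by metis
    have "(\<Sum>q | q permutes R. of_int (sign q) *
        ((\<Prod>i\<in>S. - of_bool (q i = \<pi> i)) * (\<Prod>i\<in>R - S. of_bool (q i = i)))) =
      (\<Sum>q | q permutes S. (-1) ^ card S * (of_int (sign q) * (\<Prod>i\<in>S. perm_columns \<pi> S (q i) i)) :: real)"
    proof (rule sum.mono_neutral_cong_right)
      show "finite {q. q permutes R}" by (rule finite_permutations[OF assms])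
      show "{q. q permutes S} \<subseteq> {q. q permutes R}" using S permutes_subset by blast
      show "\<forall>q\<in>{q. q permutes R} - {q. q permutes S}. of_int (sign q) *
        ((\<Prod>i\<in>S. - of_bool (q i = \<pi> i)) * (\<Prod>i\<in>R - S. of_bool (q i = i))) = (0 :: real)"
      proof (intro ballI)
        fix q assume "q \<in> {q. q permutes R} - {q. q permutes S}"
        hence q: "q permutes R" "\<not> q permutes S" by auto
        have "\<exists>i\<in>R - S. q i \<noteq> i"
          using q permutes_superset[OF q(1), of S] by auto
        thus "of_int (sign q) * ((\<Prod>i\<in>S. - of_bool (q i = \<pi> i)) * (\<Prod>i\<in>R - S. of_bool (q i = i))) = (0 :: real)"
          using assms by (auto simp: prod_zero_iff)
      qed
      fix q assume "q \<in> {q. q permutes S}"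
      hence "(\<Prod>i\<in>R - S. of_bool (q i = i)) = (1 :: real)"
        by (intro prod.neutral) (auto simp: permutes_def)
      moreover have "(\<Prod>i\<in>S. - of_bool (q i = \<pi> i)) = (-1) ^ card S * (\<Prod>i\<in>S. perm_columns \<pi> S (q i) i)"
        by (simp add: prod_uminus perm_columns_def)
      ultimately show "of_int (sign q) * ((\<Prod>i\<in>S. - of_bool (q i = \<pi> i)) * (\<Prod>i\<in>R - S. of_bool (q i = i))) =
         (-1) ^ card S * (of_int (sign q) * (\<Prod>i\<in>S. perm_columns \<pi> S (q i) i))"
        by simp
    qed
    thus "(\<Sum>q | q permutes R. of_int (sign q) *
        ((\<Prod>i\<in>S. - of_bool (q i = \<pi> i)) * (\<Prod>i\<in>R - S. of_bool (q i = i)))) =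
        (-1) ^ card S * minor_det S (perm_columns \<pi> S)"
      by (simp add: minor_det_def sum_distrib_left)
  qed
  finally show ?thesis .
qed

text \<open>
  By the previous lemma the left-hand side is the minor of \<open>1 - P\<close>, for the matrix \<open>P\<close> of \<open>\<pi>\<close>, obtained
  by deleting \<open>p\<close>. If \<open>\<pi>\<close> has an invariant set that avoids \<open>p\<close>, the columns in this set add up to zero.
  If \<open>\<pi>\<close> is a full cycle, no nonempty subset of \<open>X - {p}\<close> is invariant, and only the empty minor remains.
\<close>

lemma full_cycle_indicator:
  assumes X: "finite X" "p \<in> X" "\<pi> permutes X"
  shows "(\<Sum>S\<in>Pow (X - {p}). (-1) ^ card S * minor_det S (perm_columns \<pi> S)) = of_bool (full_cycle_on X \<pi>)"
proof (cases "full_cycle_on X \<pi>")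
  case True
  have "(\<Sum>S\<in>Pow (X - {p}). (-1) ^ card S * minor_det S (perm_columns \<pi> S)) =
     (\<Sum>S\<in>{{}}. (-1) ^ card S * minor_det S (perm_columns \<pi> S))"
  proof (rule sum.mono_neutral_right)
    show "\<forall>S\<in>Pow (X - {p}) - {{}}. (-1) ^ card S * minor_det S (perm_columns \<pi> S) = 0"
    proof (intro ballI)
      fix S assume "S \<in> Pow (X - {p}) - {{}}"
      hence S: "S \<subseteq> X - {p}" "S \<noteq> {}" by auto
      have fin: "finite S" using S X finite_subset by blast
      have "(\<Prod>i\<in>S. perm_columns \<pi> S (q i) i) = 0" if q: "q permutes S" for q
      proof (rule ccontr)
        assume "(\<Prod>i\<in>S. perm_columns \<pi> S (q i) i) \<noteq> 0"
        hence "\<And>i. i \<in> S \<Longrightarrow> q i = \<pi> i" using fin by (auto simp: perm_columns_def prod_zero_iff)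
        hence "\<pi> ` S \<subseteq> S" using q by (metis image_subsetI permutes_in_image)
        hence "S = X" using True S unfolding full_cycle_on_def by (metis Diff_subset subset_trans)
        thus False using S X by auto
      qed
      hence "minor_det S (perm_columns \<pi> S) = 0" by (simp add: minor_det_def)
      thus "(-1) ^ card S * minor_det S (perm_columns \<pi> S) = 0" by simp
    qed
  qed (use X in auto)
  also have "\<dots> = 1" by (simp add: minor_det_def)
  finally show ?thesis using True by simp
next
  case False
  then obtain O' where O': "O' \<subseteq> X" "O' \<noteq> {}" "\<pi> ` O' \<subseteq> O'" "O' \<noteq> X"
    using X unfolding full_cycle_on_def by blast
  have inj: "inj \<pi>" using X permutes_inj by metis
  have im: "\<pi> ` O' = O'"
    using O' X inj by (intro card_subset_eq) (auto simp: card_image inj_on_subset[OF inj] intro: finite_subset)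
  \<comment> \<open>an invariant set that contains \<open>p\<close> is replaced by its complement\<close>
  obtain Q where Q: "Q \<subseteq> X - {p}" "Q \<noteq> {}" "\<pi> ` Q = Q"
  proof (cases "p \<in> O'")
    case False
    thus ?thesis using that[of O'] O' im by auto
  next
    case True
    have "\<pi> ` (X - O') = X - O'"
      using im X permutes_image[OF X(3)] image_set_diff[OF inj] by metis
    thus ?thesis using that[of "X - O'"] O' True by auto
  qed
  define R where "R = X - {p}"
  define f where "f = (\<lambda>r c. of_bool (r = c) - of_bool (r = \<pi> c) :: real)"
  have finR: "finite R" and finQ: "finite Q" using X Q by (auto simp: R_def intro: finite_subset)
  obtain l where l: "l \<in> Q" using Q by auto
  have lR: "l \<in> R" using l Q by (auto simp: R_def)
  have col: "(\<Sum>c\<in>Q. f r c) = 0" for r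
  proof -
    have "(\<Sum>c\<in>Q. of_bool (r = \<pi> c) :: real) = (\<Sum>c\<in>\<pi> ` Q. of_bool (r = c))"
      by (subst sum.reindex) (auto intro: inj_on_subset[OF inj])
    thus ?thesis by (simp add: f_def sum_subtractf Q)
  qed
  have "0 = minor_det R (\<lambda>r c. if c = l then \<Sum>x\<in>Q. f r x else f r c)"
    unfolding col by (subst minor_det_column[OF finR lR]) simp
  also have "\<dots> = (\<Sum>x\<in>Q. minor_det R (\<lambda>r c. if c = l then f r x else f r c))"
    by (rule minor_det_column_sum[OF finR lR])
  also have "\<dots> = (\<Sum>x\<in>{l}. minor_det R (\<lambda>r c. if c = l then f r x else f r c))"
  proof (rule sum.mono_neutral_right)
    show "\<forall>x\<in>Q - {l}. minor_det R (\<lambda>r c. if c = l then f r x else f r c) = 0"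
      by (intro ballI minor_det_equal_columns[OF finR lR]) (use Q in \<open>auto simp: R_def\<close>)
  qed (use finQ l in auto)
  also have "\<dots> = minor_det R f"
    by (simp, rule minor_det_cong) auto
  finally show ?thesis
    using False minor_det_one_minus_perm[OF finR, of \<pi>] by (simp add: f_def R_def)
qed

lemma sum_Pow_card:
  fixes g :: "nat \<Rightarrow> real"
  assumes "finite R"
  shows "(\<Sum>S\<in>Pow R. g (card S)) = (\<Sum>k\<le>card R. real (card R choose k) * g k)"
proof -
  have "(\<Sum>S\<in>Pow R. g (card S)) = (\<Sum>k\<le>card R. \<Sum>S\<in>{S \<in> Pow R. card S = k}. g (card S))"
    by (rule sum.group[symmetric]) (use assms in \<open>auto intro: card_mono\<close>)
  also have "\<dots> = (\<Sum>k\<le>card R. real (card R choose k) * g k)"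
  proof (intro sum.cong refl)
    fix k
    have "(\<Sum>S\<in>{S \<in> Pow R. card S = k}. g (card S)) = (\<Sum>S\<in>{S \<in> Pow R. card S = k}. g k)"
      by (intro sum.cong) auto
    thus "(\<Sum>S\<in>{S \<in> Pow R. card S = k}. g (card S)) = real (card R choose k) * g k"
      using n_subsets[OF assms, of k] by simp
  qed
  finally show ?thesis .
qed

text \<open>
  The spectral decomposition of the number of words with a full cycle as product. The two eigenvalues
  attached to each minor telescope in the alternating sum over subsets.
\<close>

theorem card_words_full_cycle:
  assumes X: "finite X" "card X = Suc N"
  shows "real (Suc N) * real (card {ts \<in> words X m. full_cycle_on X (prod_lr ts)}) =
    (\<Sum>k\<le>N. (-1) ^ k * real (N choose k) * hook_content (Suc N) k ^ m)"
proof -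
  define c where "c = hook_content (Suc N)"
  obtain p where p: "p \<in> X" using X by (metis card.empty equals0I nat.distinct(1))
  define R where "R = X - {p}"
  have R: "finite R" "card R = N" using X p by (auto simp: R_def)
  have "real (card {ts \<in> words X m. full_cycle_on X (prod_lr ts)}) =
      (\<Sum>ts\<in>words X m. of_bool (full_cycle_on X (prod_lr ts)))"
    by (simp add: sum_of_bool_eq finite_words X Int_def)
  also have "\<dots> = (\<Sum>ts\<in>words X m. \<Sum>S\<in>Pow R. (-1) ^ card S * minor_det S (perm_columns (prod_lr ts) S))"
    unfolding R_def by (intro sum.cong refl full_cycle_indicator[symmetric] X p prod_lr_words_permutes)
  also have "\<dots> = (\<Sum>S\<in>Pow R. (-1) ^ card S * (\<Sum>ts\<in>words X m. minor_det S (perm_columns (prod_lr ts) S)))"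
    by (subst sum.swap) (simp add: sum_distrib_left)
  finally have "real (Suc N) * real (card {ts \<in> words X m. full_cycle_on X (prod_lr ts)}) =
     (\<Sum>S\<in>Pow R. (-1) ^ card S * (real (card X) * (\<Sum>ts\<in>words X m. minor_det S (perm_columns (prod_lr ts) S))))"
    by (simp add: sum_distrib_left X mult_ac del: of_nat_Suc)
  also have "\<dots> = (\<Sum>S\<in>Pow R. (-1) ^ card S * ((real (Suc N) - real (card S)) * c (card S) ^ m +
      real (card S) * c (card S - 1) ^ m))"
    using X by (intro sum.cong refl, subst sum_words_minor_det) (auto simp: R_def c_def)
  also have "\<dots> = (\<Sum>k\<le>N. real (N choose k) * ((-1) ^ k * ((real (Suc N) - real k) * c k ^ m + real k * c (k - 1) ^ m)))"
    using sum_Pow_card[OF R(1), of "\<lambda>k. (-1) ^ k * ((real (Suc N) - real k) * c k ^ m + real k * c (k - 1) ^ m)"]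
    unfolding R(2) .
  also have "\<dots> = (\<Sum>k\<le>N. (-1) ^ k * real (N choose k) * (real (Suc N) - real k) * c k ^ m) +
      (\<Sum>k\<le>N. (-1) ^ k * (real (N choose k) * real k) * c (k - 1) ^ m)"
    by (simp add: sum.distrib[symmetric] algebra_simps)
  also have "(\<Sum>k\<le>N. (-1) ^ k * (real (N choose k) * real k) * c (k - 1) ^ m) =
      (\<Sum>k<N. (-1) ^ Suc k * (real (N choose Suc k) * real (Suc k)) * c k ^ m)"
    by (simp add: lessThan_Suc_atMost[symmetric] sum.lessThan_Suc_shift del: sum.lessThan_Suc)
  also have "\<dots> = (\<Sum>k<N. - ((-1) ^ k * real (N choose k) * (real N - real k) * c k ^ m))"
  proof (intro sum.cong refl)
    fix k assume "k \<in> {..<N}"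
    hence k: "k < N" by simp
    have "Suc k * (N choose Suc k) = (N - k) * (N choose k)"
      using k by (metis binomial_absorb_comp binomial_absorption Suc_diff_Suc diff_Suc_1 less_imp_Suc_add mult.commute)
    hence "real (N choose Suc k) * real (Suc k) = real (N choose k) * (real N - real k)"
      using k by (metis less_imp_le mult.commute of_nat_diff of_nat_mult)
    thus "(-1) ^ Suc k * (real (N choose Suc k) * real (Suc k)) * c k ^ m =
        - ((-1) ^ k * real (N choose k) * (real N - real k) * c k ^ m)" by simp
  qed
  also have "\<dots> = (\<Sum>k\<le>N. - ((-1) ^ k * real (N choose k) * (real N - real k) * c k ^ m))"
    by (simp add: lessThan_Suc_atMost[symmetric])
  also have "(\<Sum>k\<le>N. (-1) ^ k * real (N choose k) * (real (Suc N) - real k) * c k ^ m) + \<dots> =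
      (\<Sum>k\<le>N. (-1) ^ k * real (N choose k) * c k ^ m)"
    by (simp add: sum.distrib[symmetric] algebra_simps)
  finally show ?thesis by (simp add: c_def)
qed

section \<open>Conjugation and full cycles\<close>

definition conj_perm :: "perm \<Rightarrow> perm \<Rightarrow> perm" where
  "conj_perm f t = f \<circ> t \<circ> inv f"

lemma conj_perm_id [simp]: "bij f \<Longrightarrow> conj_perm f id = id"
  by (simp add: conj_perm_def bij_is_surj surj_iff[symmetric])

lemma conj_perm_comp: "bij f \<Longrightarrow> conj_perm f (s \<circ> t) = conj_perm f s \<circ> conj_perm f t"
  by (auto simp: conj_perm_def fun_eq_iff bij_is_inj)

lemma conj_perm_conj: "bij f \<Longrightarrow> bij g \<Longrightarrow> conj_perm f (conj_perm g t) = conj_perm (f \<circ> g) t"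
  by (simp add: conj_perm_def o_inv_distrib comp_assoc)

lemma conj_perm_by_id [simp]: "conj_perm id t = t"
  by (simp add: conj_perm_def)

lemma conj_perm_transpose:
  assumes "bij f"
  shows "conj_perm f (swap i j) = swap (f i) (f j)"
proof
  fix x
  obtain y where x: "x = f y" using assms by (meson bij_pointE)
  have inj: "f a = f b \<longleftrightarrow> a = b" for a b using assms by (simp add: bij_is_inj inj_eq)
  show "conj_perm f (swap i j) x = swap (f i) (f j) x"
    using assms by (simp add: conj_perm_def x bij_is_inj Transposition.transpose_def inj)
qed

lemma prod_lr_conj:
  assumes "bij f"
  shows "prod_lr (map (conj_perm f) ts) = conj_perm f (prod_lr ts)"
  using assms by (induction ts) (auto simp: conj_perm_comp)

lemma conj_perm_mem_transps:
  assumes "bij f" "t \<in> transps X"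
  shows "conj_perm f t \<in> transps (f ` X)"
proof -
  obtain i j where ij: "t = swap i j" "i \<in> X" "j \<in> X" "i \<noteq> j"
    using assms by (auto simp: transps_def)
  have "f i \<noteq> f j" using assms ij by (simp add: bij_is_inj inj_eq)
  thus ?thesis using ij assms by (auto simp: conj_perm_transpose transps_def)
qed

lemma map_conj_mem_words: "bij f \<Longrightarrow> ts \<in> words X m \<Longrightarrow> map (conj_perm f) ts \<in> words (f ` X) m"
  by (auto simp: words_def intro: conj_perm_mem_transps)

lemma map_conj_inverse:
  assumes "bij f"
  shows "map (conj_perm (inv f)) (map (conj_perm f) ts) = ts" "map (conj_perm f) (map (conj_perm (inv f)) ts) = ts"
proof -
  have "bij (inv f)" using assms by (rule bij_imp_bij_inv)
  thus "map (conj_perm (inv f)) (map (conj_perm f) ts) = ts" "map (conj_perm f) (map (conj_perm (inv f)) ts) = ts"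
    using assms surj_iff[THEN iffD1, OF bij_is_surj[OF assms]]
    by (simp_all add: conj_perm_conj bij_is_inj comp_def[of "conj_perm _"] map_idI)
qed

lemma inv_fixes: "bij f \<Longrightarrow> f x = x \<Longrightarrow> inv f x = x"
  by (rule inv_f_eq) (auto simp: bij_is_inj)

definition words_to :: "nat set \<Rightarrow> nat \<Rightarrow> perm \<Rightarrow> perm list set" where
  "words_to X l \<zeta> = {ts \<in> words X l. prod_lr ts = \<zeta>}"

lemma finite_words_to: "finite X \<Longrightarrow> finite (words_to X l \<zeta>)"
  by (simp add: words_to_def finite_words)

lemma factorizations_eq_words_to: "factorizations g n = words_to {1..n} (n - 1 + 2 * g) (long_cycle n)"
  by (auto simp: factorizations_def words_to_def words_def transpositions_eq_transps)

lemma card_words_to_conj: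
  assumes "bij f"
  shows "card (words_to (f ` X) l (conj_perm f \<zeta>)) = card (words_to X l \<zeta>)"
proof -
  have bi: "bij (inv f)" using assms by (rule bij_imp_bij_inv)
  have im: "inv f ` f ` X = X" using assms by (simp add: bij_is_inj image_inv_f_f)
  have cc: "conj_perm (inv f) (conj_perm f \<zeta>) = \<zeta>"
    using map_conj_inverse(1)[OF assms, of "[\<zeta>]"] by simp
  have "bij_betw (map (conj_perm f)) (words_to X l \<zeta>) (words_to (f ` X) l (conj_perm f \<zeta>))"
  proof (rule bij_betw_byWitness[where f' = "map (conj_perm (inv f))"])
    show "map (conj_perm f) ` words_to X l \<zeta> \<subseteq> words_to (f ` X) l (conj_perm f \<zeta>)"
      using assms by (auto simp: words_to_def map_conj_mem_words prod_lr_conj)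
    show "map (conj_perm (inv f)) ` words_to (f ` X) l (conj_perm f \<zeta>) \<subseteq> words_to X l \<zeta>"
      using bi map_conj_mem_words[OF bi, of _ "f ` X" l] by (auto simp: words_to_def im prod_lr_conj cc)
  qed (use map_conj_inverse[OF assms] in auto)
  thus ?thesis by (simp add: bij_betw_same_card)
qed

lemma cycle_of_list_nth:
  assumes "distinct cs" "i < length cs"
  shows "cycle_of_list cs (cs ! i) = cs ! (Suc i mod length cs)"
proof -
  have "map (cycle_of_list cs ^^ 1) cs = rotate 1 cs" by (rule cyclic_rotation[OF assms(1)])
  hence "map (cycle_of_list cs ^^ 1) cs ! i = rotate 1 cs ! i" by simp
  thus ?thesis using assms by (simp add: nth_rotate[where m = 1, simplified])
qed

lemma long_cycle_permutes: "long_cycle n permutes {1..n}"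
  using cycle_permutes[of "[1..<Suc n]"] by (simp add: long_cycle_def atLeastLessThanSuc_atLeastAtMost del: upt_Suc)

lemma long_cycle_apply:
  assumes "1 \<le> x" "x \<le> n"
  shows "long_cycle n x = (if x = n then 1 else Suc x)"
proof -
  have "cycle_of_list [1..<Suc n] ([1..<Suc n] ! (x - 1)) = [1..<Suc n] ! (Suc (x - 1) mod length [1..<Suc n])"
    by (rule cycle_of_list_nth) (use assms in auto)
  moreover have "[1..<Suc n] ! (x - 1) = x" using assms by (subst nth_upt) auto
  moreover have "[1..<Suc n] ! (Suc (x - 1) mod length [1..<Suc n]) = (if x = n then 1 else Suc x)"
    using assms by (simp add: nth_upt del: upt_Suc)
  ultimately show ?thesis by (simp add: long_cycle_def)
qed

lemma full_cycle_on_cycle_of_list: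
  assumes "distinct cs"
  shows "full_cycle_on (set cs) (cycle_of_list cs)"
  unfolding full_cycle_on_def
proof (intro conjI allI impI)
  show "cycle_of_list cs permutes set cs" by (rule cycle_permutes)
  fix B assume B: "B \<subseteq> set cs" "B \<noteq> {}" "cycle_of_list cs ` B \<subseteq> B"
  then obtain y where "y \<in> B" "y \<in> set cs" by blast
  then obtain i where i: "i < length cs" "cs ! i \<in> B" by (auto simp: in_set_conv_nth dest!: subsetD)
  have *: "cs ! ((i + k) mod length cs) \<in> B" for k
  proof (induction k)
    case (Suc k)
    have "cycle_of_list cs (cs ! ((i + k) mod length cs)) = cs ! (Suc ((i + k) mod length cs) mod length cs)"
      by (rule cycle_of_list_nth[OF assms], rule mod_less_divisor) (use i in auto)
    also have "Suc ((i + k) mod length cs) mod length cs = (i + Suc k) mod length cs"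
      by (simp add: mod_Suc_eq)
    finally have "cs ! ((i + Suc k) mod length cs) \<in> cycle_of_list cs ` B" using Suc by (metis imageI)
    thus ?case using B(3) by blast
  qed (use i in simp)
  have "cs ! j \<in> B" if "j < length cs" for j
    using *[of "length cs - i + j"] that i by simp
  hence "set cs \<subseteq> B" by (auto simp: in_set_conv_nth)
  thus "B = set cs" using B by auto
qed

lemma full_cycle_on_obtain_list:
  assumes "finite X" "full_cycle_on X \<zeta>" "x \<in> X"
  obtains cs where "distinct cs" "set cs = X" "cs \<noteq> []" "hd cs = x" "\<zeta> = cycle_of_list cs"
proof -
  have p: "\<zeta> permutes X" using assms by (simp add: full_cycle_on_def)
  hence pe: "permutation \<zeta>" using assms permutation_permutes by blast
  define cs where "cs = support \<zeta> x"
  have d: "distinct cs" using cycle_of_permutation[OF pe] by (simp add: cs_def)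
  have lp: "0 < least_power \<zeta> x" using least_power_of_permutation[OF pe] by blast
  have ne: "cs \<noteq> []" "hd cs = x" using lp by (simp_all add: cs_def upt_conv_Cons)
  have xs: "x \<in> set cs" using ne hd_in_set by metis
  have iter: "(\<zeta> ^^ i) x \<in> X" for i
    by (induction i) (use assms(3) permutes_in_image[OF p] in auto)
  have sub: "set cs \<subseteq> X" using iter by (auto simp: cs_def)
  have st: "\<zeta> b = cycle_of_list cs b" if "b \<in> set cs" for b
    using that unfolding cs_def by (rule cycle_restrict[OF pe])
  have "\<zeta> ` set cs \<subseteq> set cs"
  proof (rule image_subsetI)
    fix b assume "b \<in> set cs"
    thus "\<zeta> b \<in> set cs" using st[of b] permutes_in_image[OF cycle_permutes[of cs], of b] by simp
  qed
  moreover have "set cs \<noteq> {}" using xs by auto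
  ultimately have eq: "set cs = X" using assms(2) sub unfolding full_cycle_on_def by metis
  have "\<zeta> = cycle_of_list cs"
  proof
    fix b
    show "\<zeta> b = cycle_of_list cs b"
    proof (cases "b \<in> X")
      case True
      thus ?thesis using st[of b] eq by simp
    next
      case False
      thus ?thesis using permutes_not_in[OF p False] eq by (simp add: id_outside_supp)
    qed
  qed
  from that[OF d eq ne this] show ?thesis .
qed

lemma is_full_cycle_iff: "is_full_cycle n \<zeta> \<longleftrightarrow> full_cycle_on {1..n} \<zeta>"
proof
  assume "is_full_cycle n \<zeta>"
  then obtain cs where "distinct cs" "set cs = {1..n}" "\<zeta> = cycle_of_list cs"
    unfolding is_full_cycle_def by blast
  thus "full_cycle_on {1..n} \<zeta>" using full_cycle_on_cycle_of_list[of cs] by simp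
next
  assume *: "full_cycle_on {1..n} \<zeta>"
  show "is_full_cycle n \<zeta>"
  proof (cases "n = 0")
    case True
    hence "\<zeta> = id" using * by (simp add: full_cycle_on_def)
    thus ?thesis unfolding is_full_cycle_def using True by (intro exI[of _ "[]"]) simp
  next
    case False
    hence "1 \<in> {1..n}" by auto
    then obtain cs where "distinct cs" "set cs = {1..n}" "cs \<noteq> []" "hd cs = 1" "\<zeta> = cycle_of_list cs"
      by (rule full_cycle_on_obtain_list[OF finite_atLeastAtMost *])
    thus ?thesis unfolding is_full_cycle_def by blast
  qed
qed

lemma full_cycle_on_long_cycle: "full_cycle_on {1..n} (long_cycle n)"
  using full_cycle_on_cycle_of_list[of "[1..<Suc n]"]
  by (simp add: long_cycle_def atLeastLessThanSuc_atLeastAtMost del: upt_Suc)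

lemma full_cycle_on_conj:
  assumes "bij f" "full_cycle_on X \<zeta>" "finite X"
  shows "full_cycle_on (f ` X) (conj_perm f \<zeta>)"
proof (cases "X = {}")
  case True
  thus ?thesis using assms by (simp add: full_cycle_on_def)
next
  case False
  then obtain x where "x \<in> X" by auto
  then obtain cs where cs: "distinct cs" "set cs = X" "\<zeta> = cycle_of_list cs"
    by (rule full_cycle_on_obtain_list[OF assms(3,2)])
  have "conj_perm f \<zeta> = cycle_of_list (map f cs)"
    unfolding conj_perm_def cs(3) by (rule conjugation_of_cycle[OF cs(1) assms(1)])
  moreover have "distinct (map f cs)"
    using cs inj_on_subset[OF bij_is_inj[OF assms(1)], of "set cs"] by (simp add: distinct_map)
  ultimately show ?thesis using full_cycle_on_cycle_of_list[of "map f cs"] cs by simp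
qed

lemma bij_extend:
  assumes "finite A" "bij_betw g A (B :: nat set)"
  obtains f :: "nat \<Rightarrow> nat" where "bij f" "\<And>x. x \<in> A \<Longrightarrow> f x = g x"
proof -
  define U where "U = A \<union> B"
  have fB: "finite B" using assms bij_betw_finite by blast
  have "card A = card B" using assms bij_betw_same_card by blast
  hence "card (U - A) = card (U - B)"
    using assms fB by (simp add: U_def card_Diff_subset)
  moreover have "finite (U - A)" "finite (U - B)" using assms fB by (auto simp: U_def)
  ultimately obtain h where h: "bij_betw h (U - A) (U - B)"
    using finite_same_card_bij by blast
  define f where "f x = (if x \<in> A then g x else if x \<in> U then h x else x)" for x
  have "bij_betw f (A \<union> (U - A) \<union> (- U)) (B \<union> (U - B) \<union> (- U))"
  proof (intro bij_betw_combine)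
    show "bij_betw f A B" using assms(2) by (rule bij_betw_cong[THEN iffD1, rotated]) (simp add: f_def)
    show "bij_betw f (U - A) (U - B)" using h by (rule bij_betw_cong[THEN iffD1, rotated]) (simp add: f_def)
    show "bij_betw f (- U) (- U)"
      by (rule bij_betw_cong[THEN iffD1, rotated, OF bij_betw_id]) (auto simp: f_def U_def)
  qed (auto simp: U_def)
  moreover have "A \<union> (U - A) \<union> (- U) = UNIV" "B \<union> (U - B) \<union> (- U) = UNIV" by (auto simp: U_def)
  ultimately have "bij f" by simp
  thus ?thesis using that[of f] by (simp add: f_def)
qed

text \<open>
  All full cycles on sets of the same size are conjugate, and conjugation by a permutation of all
  natural numbers carries words to words.
\<close>

lemma card_words_to_full_cycle:
  assumes "finite X" "full_cycle_on X \<zeta>" "card X = Suc N"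
  shows "card (words_to X l \<zeta>) = card (words_to {1..Suc N} l (long_cycle (Suc N)))"
proof -
  obtain x where "x \<in> X" using assms by (metis card.empty equals0I nat.distinct(1))
  then obtain cs where cs: "distinct cs" "set cs = X" "\<zeta> = cycle_of_list cs"
    by (rule full_cycle_on_obtain_list[OF assms(1,2)])
  have len: "length cs = Suc N" using distinct_card[OF cs(1)] cs(2) assms(3) by simp
  have b1: "bij_betw (\<lambda>k. k - 1) {1..Suc N} {..<Suc N}"
    by (rule bij_betw_byWitness[where f' = Suc]) auto
  have "bij_betw (\<lambda>i. cs ! i) {..<Suc N} X"
    using bij_betw_nth[OF cs(1), of "{..<Suc N}" X] cs len by simp
  hence "bij_betw ((\<lambda>i. cs ! i) \<circ> (\<lambda>k. k - 1)) {1..Suc N} X"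
    using b1 by (rule bij_betw_trans[rotated])
  from bij_extend[OF _ this] obtain f where f: "bij f" "\<And>k. k \<in> {1..Suc N} \<Longrightarrow> f k = cs ! (k - 1)"
    by (auto simp: comp_def)
  have m: "map f [1..<Suc (Suc N)] = cs"
    by (rule nth_equalityI) (use f len in \<open>auto simp del: upt_Suc\<close>)
  have "conj_perm f (long_cycle (Suc N)) = cycle_of_list (map f [1..<Suc (Suc N)])"
    unfolding conj_perm_def long_cycle_def by (rule conjugation_of_cycle) (use f in auto)
  hence "conj_perm f (long_cycle (Suc N)) = \<zeta>" using m cs by simp
  moreover have "f ` {1..Suc N} = X"
    using arg_cong[OF m, of set] cs by (simp add: atLeastLessThanSuc_atLeastAtMost del: upt_Suc)
  ultimately show ?thesis using card_words_to_conj[OF f(1), of "{1..Suc N}" l "long_cycle (Suc N)"] by simp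
qed

text \<open>
  The centralizer of the long cycle consists of its powers, and only the identity fixes 1. This makes
  the relabelling of Step (ii) unique.
\<close>

lemma commutes_long_cycle_eq_id:
  assumes "\<rho> permutes {1..n}" "\<rho> 1 = 1" "\<rho> \<circ> long_cycle n = long_cycle n \<circ> \<rho>"
  shows "\<rho> = id"
proof (rule ext)
  fix k
  have *: "\<rho> (Suc k) = Suc k" if "Suc k \<le> n" for k
    using that
  proof (induction k)
    case 0
    show ?case using assms(2) by simp
  next
    case (Suc k)
    have eq: "\<rho> (Suc k) = Suc k" using Suc by simp
    have lc: "long_cycle n (Suc k) = Suc (Suc k)" using Suc.prems by (subst long_cycle_apply) auto
    have "\<rho> (long_cycle n (Suc k)) = long_cycle n (\<rho> (Suc k))"
      using fun_cong[OF assms(3), of "Suc k"] by (simp only: comp_apply)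
    thus ?case by (simp only: eq lc)
  qed
  show "\<rho> k = id k"
  proof (cases "k \<in> {1..n}")
    case True
    thus ?thesis using *[of "k - 1"] by simp
  next
    case False
    thus ?thesis using permutes_not_in[OF assms(1) False] by simp
  qed
qed

text \<open>
  The condition that determines the relabelling \<open>\<sigma>\<close> in Step (ii), with composition of functions
  instead of products from left to right.
\<close>

definition relabels :: "nat \<Rightarrow> perm \<Rightarrow> perm \<Rightarrow> bool" where
  "relabels n \<sigma> \<zeta> \<longleftrightarrow> \<sigma> permutes {1..n} \<and> \<sigma> 1 = 1 \<and> conj_perm \<sigma> \<zeta> = long_cycle n"

lemma relabels_unique:
  assumes "relabels n \<sigma> \<zeta>" "relabels n \<sigma>' \<zeta>"
  shows "\<sigma> = \<sigma>'"
proof -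
  have b: "bij \<sigma>" "bij \<sigma>'" using assms permutes_bij by (auto simp: relabels_def)
  \<comment> \<open>the quotient commutes with the long cycle and fixes 1\<close>
  define \<rho> where "\<rho> = \<sigma>' \<circ> inv \<sigma>"
  have p: "\<rho> permutes {1..n}"
    unfolding \<rho>_def using assms by (auto simp: relabels_def intro!: permutes_compose permutes_inv)
  have one: "\<rho> 1 = 1" using assms b by (simp add: relabels_def \<rho>_def inv_fixes)
  have "conj_perm \<rho> (long_cycle n) = conj_perm \<sigma>' (conj_perm (inv \<sigma>) (conj_perm \<sigma> \<zeta>))"
    using assms b by (simp add: \<rho>_def conj_perm_conj relabels_def bij_imp_bij_inv)
  also have "\<dots> = long_cycle n"
    using assms b map_conj_inverse(1)[OF b(1), of "[\<zeta>]"] by (simp add: relabels_def)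
  finally have "\<rho> \<circ> long_cycle n \<circ> inv \<rho> = long_cycle n" by (simp add: conj_perm_def)
  hence "\<rho> \<circ> long_cycle n \<circ> inv \<rho> \<circ> \<rho> = long_cycle n \<circ> \<rho>" by simp
  hence "\<rho> \<circ> long_cycle n = long_cycle n \<circ> \<rho>" using p by (simp add: comp_assoc permutes_inv_o)
  hence "\<rho> = id" using commutes_long_cycle_eq_id p one by blast
  hence "\<sigma>' \<circ> inv \<sigma> \<circ> \<sigma> = \<sigma>" by (simp add: \<rho>_def)
  thus ?thesis using b by (simp add: comp_assoc bij_is_inj)
qed

lemma relabels_exists:
  assumes "full_cycle_on {1..n} \<zeta>" "1 \<le> n"
  obtains \<sigma> where "relabels n \<sigma> \<zeta>"
proof -
  have "1 \<in> {1..n}" using assms by simp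
  then obtain cs where
    cs: "distinct cs" "set cs = {1..n}" "cs \<noteq> []" "hd cs = 1" "\<zeta> = cycle_of_list cs"
    by (rule full_cycle_on_obtain_list[OF finite_atLeastAtMost assms(1)])
  have len: "length cs = n" using distinct_card[OF cs(1)] cs(2) by simp
  define \<tau> where "\<tau> k = (if k \<in> {1..n} then cs ! (k - 1) else k)" for k
  have b1: "bij_betw (\<lambda>k. k - 1) {1..n} {..<n}"
    by (rule bij_betw_byWitness[where f' = Suc]) auto
  have "bij_betw (\<lambda>i. cs ! i) {..<n} {1..n}"
    using bij_betw_nth[OF cs(1), of "{..<n}" "{1..n}"] cs len by simp
  hence "bij_betw ((\<lambda>i. cs ! i) \<circ> (\<lambda>k. k - 1)) {1..n} {1..n}"
    using b1 by (rule bij_betw_trans[rotated])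
  hence "bij_betw \<tau> {1..n} {1..n}"
    by (rule bij_betw_cong[THEN iffD1, rotated]) (simp add: \<tau>_def)
  hence \<tau>: "\<tau> permutes {1..n}" by (rule bij_imp_permutes) (auto simp: \<tau>_def)
  have b: "bij \<tau>" using \<tau> permutes_bij by blast
  have "map \<tau> [1..<Suc n] = cs"
    by (rule nth_equalityI) (use len in \<open>auto simp: \<tau>_def simp del: upt_Suc\<close>)
  hence "conj_perm \<tau> (long_cycle n) = \<zeta>"
    unfolding conj_perm_def long_cycle_def using cs conjugation_of_cycle[of "[1..<Suc n]" \<tau>] b by auto
  hence "conj_perm (inv \<tau>) \<zeta> = long_cycle n"
    using map_conj_inverse(1)[OF b, of "[long_cycle n]"] by simp
  moreover have "\<tau> 1 = 1" using cs assms len by (simp add: \<tau>_def hd_conv_nth)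
  hence "inv \<tau> 1 = 1" using b by (simp add: inv_fixes)
  ultimately show ?thesis using that[of "inv \<tau>"] \<tau> by (simp add: relabels_def permutes_inv)
qed

text \<open>
  Each full cycle is carried to the long cycle by exactly one permutation that fixes 1, so a word whose
  product is a full cycle is the same as a factorization of the long cycle together with such a
  permutation.
\<close>

lemma card_words_full_cycle_eq_words_to:
  "card {ts \<in> words {1..Suc N} m. full_cycle_on {1..Suc N} (prod_lr ts)} =
    fact N * card (words_to {1..Suc N} m (long_cycle (Suc N)))"
proof -
  let ?n = "Suc N"
  let ?P = "{\<tau>. \<tau> permutes {2..?n}}"
  let ?F = "words_to {1..?n} m (long_cycle ?n)"
  let ?W = "{ts \<in> words {1..?n} m. full_cycle_on {1..?n} (prod_lr ts)}"
  have P: "\<tau> permutes {1..?n}" "\<tau> 1 = 1" "bij \<tau>" "\<tau> ` {1..?n} = {1..?n}" if "\<tau> \<in> ?P" for \<tau>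
  proof -
    show "\<tau> permutes {1..?n}" using that by (auto intro: permutes_subset)
    thus "bij \<tau>" "\<tau> ` {1..?n} = {1..?n}" by (auto simp: permutes_bij permutes_image)
    show "\<tau> 1 = 1" using that permutes_not_in[of \<tau> "{2..?n}" 1] by simp
  qed
  have "bij_betw (\<lambda>(\<tau>, ts). map (conj_perm \<tau>) ts) (?P \<times> ?F) ?W"
    unfolding bij_betw_def
  proof (intro conjI equalityI subsetI)
    show "inj_on (\<lambda>(\<tau>, ts). map (conj_perm \<tau>) ts) (?P \<times> ?F)"
    proof (rule inj_onI)
      fix x y assume xy: "x \<in> ?P \<times> ?F" "y \<in> ?P \<times> ?F"
        and eq0: "(case x of (\<tau>, ts) \<Rightarrow> map (conj_perm \<tau>) ts) = (case y of (\<tau>, ts) \<Rightarrow> map (conj_perm \<tau>) ts)"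
      obtain \<tau> ts \<tau>' ts' where x: "x = (\<tau>, ts)" and y: "y = (\<tau>', ts')" by (metis surj_pair)
      have t: "\<tau> \<in> ?P" "\<tau>' \<in> ?P" "ts \<in> ?F" "ts' \<in> ?F" using xy unfolding x y by blast+
      have eq: "map (conj_perm \<tau>) ts = map (conj_perm \<tau>') ts'" using eq0 unfolding x y by simp
      note p = P[OF t(1)] P[OF t(2)]
      have "prod_lr (map (conj_perm \<tau>) ts) = prod_lr (map (conj_perm \<tau>') ts')" using eq by (rule arg_cong)
      hence "conj_perm \<tau> (long_cycle ?n) = conj_perm \<tau>' (long_cycle ?n)"
        using t(3,4) unfolding prod_lr_conj[OF p(3)] prod_lr_conj[OF p(7)] by (simp add: words_to_def)
      moreover have "relabels ?n (inv \<tau>) (conj_perm \<tau> (long_cycle ?n))"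
        using permutes_inv[OF p(1)] inv_fixes[OF p(3,2)] map_conj_inverse(1)[OF p(3), of "[long_cycle ?n]"]
        by (simp add: relabels_def)
      moreover have "relabels ?n (inv \<tau>') (conj_perm \<tau>' (long_cycle ?n))"
        using permutes_inv[OF p(5)] inv_fixes[OF p(7,6)] map_conj_inverse(1)[OF p(7), of "[long_cycle ?n]"]
        by (simp add: relabels_def)
      ultimately have "inv \<tau> = inv \<tau>'" using relabels_unique by simp
      hence "inv (inv \<tau>) = inv (inv \<tau>')" by (rule arg_cong)
      hence tt: "\<tau> = \<tau>'" by (simp only: inv_inv_eq[OF p(3)] inv_inv_eq[OF p(7)])
      have "map (conj_perm (inv \<tau>)) (map (conj_perm \<tau>) ts) = map (conj_perm (inv \<tau>)) (map (conj_perm \<tau>) ts')"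
        unfolding eq unfolding tt by (rule refl)
      hence "ts = ts'" unfolding map_conj_inverse(1)[OF p(3)] .
      thus "x = y" unfolding x y tt by (rule arg_cong)
    qed
  next
    fix us assume "us \<in> (\<lambda>(\<tau>, ts). map (conj_perm \<tau>) ts) ` (?P \<times> ?F)"
    then obtain \<tau> ts where *: "\<tau> \<in> ?P" "ts \<in> ?F" "us = map (conj_perm \<tau>) ts" by auto
    have "full_cycle_on (\<tau> ` {1..?n}) (conj_perm \<tau> (long_cycle ?n))"
      by (rule full_cycle_on_conj[OF P(3)[OF *(1)] full_cycle_on_long_cycle]) simp
    thus "us \<in> ?W"
      using * P[OF *(1)] map_conj_mem_words[OF P(3)[OF *(1)], of ts "{1..?n}" m]
      by (auto simp: words_to_def prod_lr_conj)
  next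
    fix us assume us: "us \<in> ?W"
    hence fc: "full_cycle_on {1..?n} (prod_lr us)" by simp
    obtain \<sigma> where s: "relabels ?n \<sigma> (prod_lr us)" by (rule relabels_exists[OF fc]) simp
    hence s1: "\<sigma> permutes {1..?n}" by (simp only: relabels_def)
    have b: "bij \<sigma>" "\<sigma> ` {1..?n} = {1..?n}" using permutes_bij[OF s1] permutes_image[OF s1] .
    have "inv \<sigma> permutes {1..?n}" "inv \<sigma> 1 = 1"
      using permutes_inv[OF s1] inv_fixes[OF b(1), of 1] s by (simp_all only: relabels_def)
    note fixes_1 = this(2)
    have "inv \<sigma> permutes {2..?n}"
    proof (rule permutes_superset[OF \<open>inv \<sigma> permutes {1..?n}\<close>])
      fix x assume "x \<in> {1..?n} - {2..?n}"
      hence "x = 1" by auto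
      thus "inv \<sigma> x = x" using fixes_1 by simp
    qed
    moreover have "map (conj_perm \<sigma>) us \<in> ?F"
      using us s b map_conj_mem_words[OF b(1), of us "{1..?n}" m] by (auto simp: words_to_def prod_lr_conj relabels_def)
    moreover have "us = map (conj_perm (inv \<sigma>)) (map (conj_perm \<sigma>) us)" using map_conj_inverse(1)[OF b(1)] by simp
    ultimately show "us \<in> (\<lambda>(\<tau>, ts). map (conj_perm \<tau>) ts) ` (?P \<times> ?F)"
      by (intro image_eqI[of _ _ "(inv \<sigma>, map (conj_perm \<sigma>) us)"]) simp_all
  qed
  hence "card ?W = card (?P \<times> ?F)" by (simp add: bij_betw_same_card)
  also have "\<dots> = fact N * card ?F"
    by (simp add: card_cartesian_product card_permutations[of "{2..?n}" N])
  finally show ?thesis .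
qed

theorem card_words_to_long_cycle:
  "fact (Suc N) * real (card (words_to {1..Suc N} m (long_cycle (Suc N)))) =
    (\<Sum>k\<le>N. (-1) ^ k * real (N choose k) * hook_content (Suc N) k ^ m)"
  using card_words_full_cycle[of "{1..Suc N}" N m] unfolding card_words_full_cycle_eq_words_to by (simp add: mult_ac)

section \<open>The number of factorizations of the long cycle\<close>

text \<open>
  The power series \<open>sinh (z/2) / (z/2)\<close>.
\<close>

definition sinh_fps :: "real fps" where
  "sinh_fps = fps_shift 1 (fps_exp (1/2) - fps_exp (-1/2))"

lemma X_sinh_fps: "fps_X * sinh_fps = fps_exp (1/2) - fps_exp (-1/2)"
proof (rule fps_ext)
  fix n
  show "(fps_X * sinh_fps) $ n = (fps_exp (1/2) - fps_exp (-1/2)) $ n"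
    by (cases n) (simp_all add: sinh_fps_def)
qed

lemma sinh_fps_coeffs: "sinh_fps $ 0 = 1" "sinh_fps $ 1 = 0" "sinh_fps $ 2 = 1 / 24"
  by (simp_all add: sinh_fps_def fact_numeral eval_nat_numeral)

text \<open>
  The sum on the right is an \<open>N\<close>-th central difference at 0 of the \<open>m\<close>-th power, whence the
  exponential generating function.
\<close>

lemma exp_difference_power_nth:
  "((fps_exp (1/2) - fps_exp (-1/2 :: real)) ^ N) $ m =
    (\<Sum>k\<le>N. (-1) ^ k * real (N choose k) * (real N / 2 - real k) ^ m) / fact m"
proof -
  have "(fps_exp (1/2) - fps_exp (-1/2 :: real)) ^ N = (- fps_exp (-1/2) + fps_exp (1/2)) ^ N"
    by simp
  also have "\<dots> = (\<Sum>k\<le>N. of_nat (N choose k) * (- fps_exp (-1/2)) ^ k * fps_exp (1/2) ^ (N - k))"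
    by (rule binomial_ring)
  also have "\<dots> = (\<Sum>k\<le>N. fps_const ((-1) ^ k * real (N choose k)) * fps_exp (real N / 2 - real k))"
  proof (intro sum.cong refl)
    fix k assume k: "k \<in> {..N}"
    have "(- fps_exp (-1/2 :: real)) ^ k = fps_const ((-1) ^ k) * fps_exp (- real k / 2)"
      by (subst power_minus) (simp add: fps_exp_power_mult fps_const_power[symmetric] del: fps_const_power)
    moreover have "fps_exp (1/2 :: real) ^ (N - k) = fps_exp ((real N - real k) / 2)"
      using k by (simp add: fps_exp_power_mult of_nat_diff)
    moreover have "fps_exp (- real k / 2) * fps_exp ((real N - real k) / 2) = fps_exp (real N / 2 - real k)"
      by (subst fps_exp_add_mult[symmetric]) (simp add: field_simps)
    ultimately show "of_nat (N choose k) * (- fps_exp (-1/2)) ^ k * fps_exp (1/2) ^ (N - k) =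
        fps_const ((-1) ^ k * real (N choose k)) * fps_exp (real N / 2 - real k)"
      by (simp add: fps_of_nat[symmetric] mult_ac fps_const_mult[symmetric] del: fps_const_mult)
  qed
  finally show ?thesis by (simp add: fps_sum_nth sum_divide_distrib)
qed

text \<open>
  The eigenvalue \<open>hook_content n k\<close> is \<open>n (N/2 - k)\<close> for \<open>n = N + 1\<close>, so that the spectral formula is a
  power of \<open>n\<close> times a central difference.
\<close>

theorem card_factorizations:
  "fact (Suc N) * real (card (factorizations g (Suc N))) =
    fact (N + 2 * g) * real (Suc N) ^ (N + 2 * g) * (sinh_fps ^ N) $ (2 * g)"
proof -
  let ?m = "N + 2 * g"
  have "(\<Sum>k\<le>N. (-1) ^ k * real (N choose k) * hook_content (Suc N) k ^ ?m) =
      real (Suc N) ^ ?m * (\<Sum>k\<le>N. (-1) ^ k * real (N choose k) * (real N / 2 - real k) ^ ?m)"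
    unfolding sum_distrib_left
  proof (intro sum.cong refl)
    fix k
    have "hook_content (Suc N) k = real (Suc N) * (real N / 2 - real k)"
      by (simp add: hook_content_def algebra_simps)
    thus "(-1) ^ k * real (N choose k) * hook_content (Suc N) k ^ ?m =
       real (Suc N) ^ ?m * ((-1) ^ k * real (N choose k) * (real N / 2 - real k) ^ ?m)"
      by (simp add: power_mult_distrib mult_ac)
  qed
  also have "(\<Sum>k\<le>N. (-1) ^ k * real (N choose k) * (real N / 2 - real k) ^ ?m) =
      fact ?m * (((fps_X * sinh_fps) ^ N) $ ?m)"
    unfolding X_sinh_fps exp_difference_power_nth by simp
  also have "((fps_X * sinh_fps) ^ N) $ ?m = (sinh_fps ^ N) $ (2 * g)"
    by (simp add: power_mult_distrib fps_X_power_mult_nth)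
  finally show ?thesis
    using card_words_to_long_cycle[of N ?m] by (simp add: factorizations_eq_words_to mult_ac)
qed

lemma tendsto_choose_over_power:
  "(\<lambda>N. real (N choose j) / real N ^ j) \<longlonglongrightarrow> 1 / fact j"
proof (induction j)
  case (Suc j)
  have "(\<lambda>N. (real (N choose j) / real N ^ j) * ((real N - real j) / real N) * (1 / real (Suc j)))
      \<longlonglongrightarrow> 1 / fact j * 1 * (1 / real (Suc j))"
    by (intro tendsto_mult Suc.IH tendsto_const) real_asymp
  moreover have "(real (N choose j) / real N ^ j) * ((real N - real j) / real N) * (1 / real (Suc j)) =
      real (N choose Suc j) / real N ^ Suc j" for N
  proof -
    have "real (Suc j) * real (N choose Suc j) = real (N choose j) * (real N - real j)"
    proof (cases "j \<le> N")
      case True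
      have "Suc j * (N choose Suc j) = (N choose j) * (N - j)"
        unfolding binomial_absorption using binomial_absorb_comp[of N j] by (simp add: mult.commute)
      thus ?thesis using True by (metis of_nat_diff of_nat_mult)
    qed (simp add: binomial_eq_0)
    hence "real (N choose Suc j) = real (N choose j) * (real N - real j) / real (Suc j)"
      by (simp add: field_simps del: of_nat_Suc)
    thus ?thesis by simp
  qed
  ultimately show ?case by (simp add: field_simps)
qed simp

text \<open>
  Expand \<open>f\<^sup>N\<close> around \<open>f = 1\<close>: since \<open>f - 1\<close> is divisible by \<open>z\<^sup>2\<close>, only the powers \<open>(f - 1)\<^sup>j\<close> with \<open>j \<le> g\<close>
  contribute, and the binomial coefficient of the last one dominates.
\<close>

lemma fps_power_nth_asymptotics:
  fixes f :: "real fps"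
  assumes "f $ 0 = 1" "f $ 1 = 0"
  shows "(\<lambda>N. (f ^ N) $ (2 * g) / real N ^ g) \<longlonglongrightarrow> (f $ 2) ^ g / fact g"
proof -
  define h where "h = fps_shift 2 (f - 1)"
  have f: "f = 1 + fps_X ^ 2 * h"
  proof (rule fps_ext)
    fix n
    show "f $ n = (1 + fps_X ^ 2 * h) $ n"
    proof (cases "n < 2")
      case True
      hence "n = 0 \<or> n = 1" by auto
      thus ?thesis using assms by (auto simp: fps_X_power_mult_nth)
    next
      case False
      hence "n - 2 + 2 = n" by simp
      thus ?thesis using False by (simp add: h_def fps_X_power_mult_nth)
    qed
  qed
  have expand: "(f ^ N) $ (2 * g) = (\<Sum>j\<le>g. real (N choose j) * (h ^ j) $ (2 * g - 2 * j))" for N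
  proof -
    have "f ^ N = (fps_X ^ 2 * h + 1) ^ N" by (simp add: f add.commute)
    also have "\<dots> = (\<Sum>j\<le>N. of_nat (N choose j) * (fps_X ^ 2 * h) ^ j * 1 ^ (N - j))"
      by (rule binomial_ring)
    also have "\<dots> = (\<Sum>j\<le>N. fps_const (real (N choose j)) * (fps_X ^ (2 * j) * h ^ j))"
      by (simp add: power_mult_distrib power_mult fps_of_nat)
    also have "\<dots> $ (2 * g) = (\<Sum>j\<le>N. if j \<le> g then real (N choose j) * (h ^ j) $ (2 * g - 2 * j) else 0)"
      by (auto simp: fps_sum_nth fps_X_power_mult_nth intro!: sum.cong)
    also have "\<dots> = (\<Sum>j\<le>g. real (N choose j) * (h ^ j) $ (2 * g - 2 * j))"
      by (rule sum.mono_neutral_cong) (auto simp: binomial_eq_0)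
    finally show ?thesis .
  qed
  have "(\<lambda>N. \<Sum>j\<le>g. (real (N choose j) / real N ^ j) * (inverse (real N)) ^ (g - j) * (h ^ j) $ (2 * g - 2 * j))
      \<longlonglongrightarrow> (\<Sum>j\<le>g. (1 / fact j) * 0 ^ (g - j) * (h ^ j) $ (2 * g - 2 * j))"
    by (intro tendsto_sum tendsto_mult tendsto_choose_over_power tendsto_power tendsto_const lim_inverse_n)
  moreover have "(\<Sum>j\<le>g. (1 / fact j) * 0 ^ (g - j) * (h ^ j) $ (2 * g - 2 * j)) =
      (\<Sum>j\<in>{g}. (1 / fact j) * 0 ^ (g - j) * (h ^ j) $ (2 * g - 2 * j))"
    by (rule sum.mono_neutral_right) auto
  moreover have "\<forall>\<^sub>F N in sequentially. (\<Sum>j\<le>g. (real (N choose j) / real N ^ j) * (inverse (real N)) ^ (g - j) * (h ^ j) $ (2 * g - 2 * j))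
     = (f ^ N) $ (2 * g) / real N ^ g"
    using eventually_gt_at_top[of 0]
  proof eventually_elim
    fix N :: nat assume N: "N > 0"
    show "(\<Sum>j\<le>g. (real (N choose j) / real N ^ j) * (inverse (real N)) ^ (g - j) * (h ^ j) $ (2 * g - 2 * j))
     = (f ^ N) $ (2 * g) / real N ^ g"
      unfolding expand sum_divide_distrib
    proof (intro sum.cong refl)
      fix j assume "j \<in> {..g}"
      hence "real N ^ g = real N ^ j * real N ^ (g - j)" by (simp flip: power_add)
      thus "(real (N choose j) / real N ^ j) * (inverse (real N)) ^ (g - j) * (h ^ j) $ (2 * g - 2 * j) =
          real (N choose j) * (h ^ j) $ (2 * g - 2 * j) / real N ^ g"
        using N by (simp add: field_simps power_inverse)
    qed
  qed
  moreover have "(h ^ g) $ 0 = (f $ 2) ^ g" using assms by (simp add: h_def fps_nth_power_0 numeral_2_eq_2)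
  ultimately show ?thesis
    by (simp add: tendsto_cong)
qed

section \<open>The Borel distribution\<close>

text \<open>
  The coefficients of the generating function of rooted labelled trees. For \<open>s = 0\<close> the formula
  \<open>s\<^sup>s\<^sup>-\<^sup>1\<close> would give 1 with truncated subtraction.
\<close>

definition borel_coeff :: "nat \<Rightarrow> real" where
  "borel_coeff s = (if s = 0 then 0 else real s ^ (s - 1) / fact s)"

definition tree_fps :: "complex fps" where
  "tree_fps = Abs_fps (\<lambda>s. of_real (borel_coeff s))"

lemma borel_coeff_nonneg: "borel_coeff s \<ge> 0"
  by (simp add: borel_coeff_def)

lemma borel_coeff_le: "borel_coeff s \<le> exp 1 ^ s"
proof (cases "s = 0")
  case False
  have "real s ^ s / fact s \<le> exp (real s)"
  proof -
    have "(\<lambda>k. real s ^ k /\<^sub>R fact k) sums exp (real s)" by (rule exp_converges)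
    hence "sum (\<lambda>k. real s ^ k /\<^sub>R fact k) {s} \<le> exp (real s)"
      by (intro sum_le_suminf[where f = "\<lambda>k. real s ^ k /\<^sub>R fact k", THEN order_trans])
        (auto simp: sums_iff)
    thus ?thesis by (simp add: field_simps)
  qed
  moreover have "real s ^ (s - 1) \<le> real s ^ s" using False by (intro power_increasing) auto
  hence "borel_coeff s \<le> real s ^ s / fact s" using False by (simp add: borel_coeff_def divide_right_mono)
  moreover have "exp (real s) = exp 1 ^ s" by (simp flip: exp_of_nat_mult)
  ultimately show ?thesis by linarith
qed (simp add: borel_coeff_def)

text \<open>
  The \<open>N\<close>-th difference of a polynomial of degree less than \<open>N\<close> vanishes, because \<open>(exp z - 1)\<^sup>N\<close>
  is divisible by \<open>z\<^sup>N\<close>.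
\<close>

lemma sum_choose_power_eq_0:
  assumes "j < N"
  shows "(\<Sum>i\<le>N. (-1) ^ (N - i) * of_nat (N choose i) * of_nat i ^ j) = (0 :: complex)"
proof -
  have "(fps_exp 1 + (- 1 :: complex fps)) ^ N = (\<Sum>i\<le>N. of_nat (N choose i) * fps_exp 1 ^ i * (- 1) ^ (N - i))"
    by (rule binomial_ring)
  also have "\<dots> = (\<Sum>i\<le>N. fps_const ((-1) ^ (N - i) * of_nat (N choose i)) * fps_exp (of_nat i))"
  proof (intro sum.cong refl)
    fix i
    have "(- 1 :: complex fps) ^ (N - i) = fps_const ((-1) ^ (N - i))"
      by (simp add: fps_const_power[symmetric] fps_const_neg[symmetric] del: fps_const_power fps_const_neg)
    thus "of_nat (N choose i) * fps_exp 1 ^ i * (- 1 :: complex fps) ^ (N - i) =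
       fps_const ((-1) ^ (N - i) * of_nat (N choose i)) * fps_exp (of_nat i)"
      by (simp add: fps_exp_power_mult fps_of_nat[symmetric] mult_ac fps_const_mult[symmetric] del: fps_const_mult)
  qed
  also have "\<dots> $ j = (\<Sum>i\<le>N. (-1) ^ (N - i) * of_nat (N choose i) * of_nat i ^ j) / fact j"
    by (simp add: fps_sum_nth sum_divide_distrib)
  finally have "((fps_exp 1 + (- 1 :: complex fps)) ^ N) $ j =
     (\<Sum>i\<le>N. (-1) ^ (N - i) * of_nat (N choose i) * of_nat i ^ j) / fact j" .
  moreover have "((fps_exp 1 + (- 1 :: complex fps)) ^ N) $ j = 0"
    by (rule startsby_zero_power_prefix[rule_format]) (use assms in auto)
  ultimately show ?thesis by simp
qed

text \<open>
  The tree function is the inverse of \<open>\<lambda> exp (-\<lambda>)\<close>. Each coefficient of the composition is a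
  finite difference as in \<open>sum_choose_power_eq_0\<close>.
\<close>

lemma tree_fps_compose: "fps_compose tree_fps (fps_X * fps_exp (-1)) = fps_X"
proof (rule fps_ext)
  fix N
  have "fps_compose tree_fps (fps_X * fps_exp (-1)) $ N =
      (\<Sum>i\<le>N. of_real (borel_coeff i) * (of_nat i * (- 1)) ^ (N - i) / fact (N - i))"
    unfolding fps_compose_nth atLeast0AtMost
    by (intro sum.cong refl)
      (auto simp: tree_fps_def power_mult_distrib fps_exp_power_mult fps_X_power_mult_nth)
  also have "\<dots> = fps_X $ N"
  proof (cases "N < 2")
    case True
    hence "N = 0 \<or> N = 1" by auto
    thus ?thesis by (auto simp: borel_coeff_def)
  next
    case False
    have "of_real (borel_coeff i) * (of_nat i * (- 1)) ^ (N - i) / fact (N - i) =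
        (-1) ^ (N - i) * of_nat (N choose i) * of_nat i ^ (N - 1) / (fact N :: complex)" if "i \<le> N" for i
    proof (cases "i = 0")
      case False
      have "of_nat i ^ (N - 1) = (of_nat i ^ (i - 1) * of_nat i ^ (N - i) :: complex)"
        using False that by (simp flip: power_add)
      moreover have "(of_nat (N choose i) :: complex) = fact N / (fact i * fact (N - i))"
        by (rule binomial_fact[OF that])
      moreover have "(of_nat i * (- 1) :: complex) ^ (N - i) = of_nat i ^ (N - i) * (- 1) ^ (N - i)"
        by (rule power_mult_distrib)
      ultimately show ?thesis using False
        by (simp add: borel_coeff_def mult_ac del: mult_minus_right mult_minus1_right)
    qed (use \<open>\<not> N < 2\<close> in \<open>simp add: borel_coeff_def power_0_left\<close>)
    hence "(\<Sum>i\<le>N. of_real (borel_coeff i) * (of_nat i * (- 1)) ^ (N - i) / fact (N - i)) =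
        (\<Sum>i\<le>N. (-1) ^ (N - i) * of_nat (N choose i) * of_nat i ^ (N - 1)) / (fact N :: complex)"
      by (simp add: sum_divide_distrib)
    also have "\<dots> = 0" using False by (subst sum_choose_power_eq_0) auto
    finally show ?thesis using False by simp
  qed
  finally show "fps_compose tree_fps (fps_X * fps_exp (-1)) $ N = fps_X $ N" .
qed

lemma tree_fps_conv_radius: "fps_conv_radius tree_fps \<ge> ereal (exp (-1))"
  unfolding fps_conv_radius_def
proof (rule conv_radius_geI_ex)
  fix r :: real assume r: "0 < r" "ereal r < ereal (exp (-1))"
  have "exp 1 * r < exp 1 * exp (-1)" using r by (intro mult_strict_left_mono) auto
  hence "exp 1 * r < 1" by (simp flip: exp_add)
  hence g: "summable (\<lambda>s. (exp 1 * r) ^ s)" using r by (intro summable_geometric) auto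
  have "summable (\<lambda>s. tree_fps $ s * of_real r ^ s)"
  proof (rule summable_comparison_test'[OF g, of 0])
    fix s
    have "norm (tree_fps $ s * of_real r ^ s) = borel_coeff s * r ^ s"
      using r borel_coeff_nonneg[of s] by (simp add: tree_fps_def norm_mult norm_power)
    also have "\<dots> \<le> exp 1 ^ s * r ^ s" using r by (intro mult_right_mono borel_coeff_le) auto
    finally show "norm (tree_fps $ s * of_real r ^ s) \<le> (exp 1 * r) ^ s" by (simp add: power_mult_distrib)
  qed
  thus "\<exists>z. norm z = r \<and> summable (\<lambda>s. tree_fps $ s * z ^ s)"
    using r by (intro exI[of _ "of_real r"]) auto
qed

lemma mult_exp_minus_less:
  fixes l :: real
  assumes "0 < l" "l < 1"
  shows "l * exp (- l) < exp (-1)"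
proof -
  \<comment> \<open>squaring the estimate at half the argument makes it strict\<close>
  have "1 + (l - 1) / 2 \<le> exp ((l - 1) / 2)" by (rule exp_ge_add_one_self)
  hence "(1 + (l - 1) / 2) ^ 2 \<le> exp ((l - 1) / 2) ^ 2" using assms by (intro power_mono) (auto simp: field_simps)
  also have "\<dots> = exp (l - 1)" by (simp flip: exp_of_nat_mult)
  also have "(1 + (l - 1) / 2) ^ 2 = l + ((l - 1) / 2) ^ 2" by (simp add: power2_eq_square field_simps)
  finally have "l + ((l - 1) / 2) ^ 2 \<le> exp (l - 1)" .
  moreover have "((l - 1) / 2) ^ 2 > 0" using assms by simp
  ultimately have "l < exp (l - 1)" by linarith
  hence "l * exp (- l) < exp (l - 1) * exp (- l)" by (intro mult_strict_right_mono) auto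
  thus ?thesis by (simp flip: exp_add)
qed

text \<open>
  The formal identity gives the equation near 0. It extends to the whole interval \<open>(0, 1)\<close> by analytic
  continuation in a domain where \<open>\<lambda> exp (-\<lambda>)\<close> stays inside the disc of convergence; this
  domain is connected since it is starlike with centre 0.
\<close>

lemma tree_fps_eval:
  fixes l :: real
  assumes "0 < l" "l < 1"
  shows "eval_fps tree_fps (of_real (l * exp (- l))) = of_real l"
proof -
  define D where "D = {z :: complex. norm z < 1} \<inter> {z. norm z * exp (- Re z) < exp (-1)}"
  define f where "f = (\<lambda>z :: complex. z * exp (- z))"
  have nf: "norm (f z) = norm z * exp (- Re z)" for z by (simp add: f_def norm_mult)
  have openD: "open D"
    unfolding D_def by (intro open_Int open_Collect_less continuous_intros)
  have star: "of_real t * z \<in> D" if z: "z \<in> D" and t: "0 \<le> t" "t \<le> 1" for t z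
  proof -
    have n: "norm z < 1" "norm z * exp (- Re z) < exp (-1)" using z by (auto simp: D_def)
    have "norm (of_real t * z) \<le> norm z" using t by (simp add: norm_mult mult_left_le_one_le)
    moreover have "t * exp (- t * Re z) \<le> exp (- Re z)"
    proof -
      have re: "Re z < 1" using n complex_Re_le_cmod[of z] by linarith
      have "t \<le> exp (t - 1)" using exp_ge_add_one_self[of "t - 1"] by simp
      also have "\<dots> \<le> exp (- (1 - t) * Re z)"
        using mult_left_mono[of "Re z" 1 "1 - t"] re t by (simp add: algebra_simps)
      finally have "t * exp (- t * Re z) \<le> exp (- (1 - t) * Re z) * exp (- t * Re z)"
        by (intro mult_right_mono) auto
      also have "\<dots> = exp (- Re z)" by (simp add: exp_add[symmetric] algebra_simps)
      finally show ?thesis .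
    qed
    hence "norm z * (t * exp (- t * Re z)) \<le> norm z * exp (- Re z)" by (intro mult_left_mono) auto
    hence "norm (of_real t * z) * exp (- Re (of_real t * z)) \<le> norm z * exp (- Re z)"
      using t by (simp add: norm_mult mult_ac)
    ultimately show ?thesis using n by (auto simp: D_def)
  qed
  have "starlike D"
    unfolding starlike_def
  proof (intro bexI[of _ 0] ballI)
    fix x assume x: "x \<in> D"
    show "closed_segment 0 x \<subseteq> D"
      using star[OF x] by (auto simp: closed_segment_def scaleR_conv_of_real)
  qed (simp add: D_def)
  hence conn: "connected D" by (rule starlike_imp_connected)
  have fD: "ereal (norm (f z)) < fps_conv_radius tree_fps" if "z \<in> D" for z
    using that tree_fps_conv_radius unfolding nf D_def
    by (auto intro: less_le_trans[of _ "ereal (exp (-1))"])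
  have hol: "(\<lambda>z. eval_fps tree_fps (f z)) holomorphic_on D"
  proof -
    have "eval_fps tree_fps \<circ> f holomorphic_on D"
    proof (rule holomorphic_on_compose)
      show "f holomorphic_on D" by (auto simp: f_def intro!: holomorphic_intros)
      show "eval_fps tree_fps holomorphic_on f ` D"
        by (rule holomorphic_on_eval_fps) (use fD in \<open>auto simp: in_eball_iff\<close>)
    qed
    thus ?thesis by (simp add: comp_def)
  qed
  have R0: "fps_conv_radius tree_fps > 0"
    using tree_fps_conv_radius by (rule less_le_trans[rotated]) simp
  have "f has_fps_expansion (fps_X * fps_exp (-1))"
    unfolding f_def using has_fps_expansion_exp[of "-1 :: complex"]
    by (intro has_fps_expansion_mult has_fps_expansion_fps_X) simp
  hence "(eval_fps tree_fps \<circ> f) has_fps_expansion (fps_compose tree_fps (fps_X * fps_exp (-1)))"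
    by (intro has_fps_expansion_compose eval_fps_has_fps_expansion R0) auto
  hence "(eval_fps tree_fps \<circ> f) has_fps_expansion fps_X" by (simp only: tree_fps_compose)
  hence ev: "\<forall>\<^sub>F z in nhds 0. eval_fps tree_fps (f z) = z"
    unfolding has_fps_expansion_def by (auto elim: eventually_mono)
  then obtain V where V: "open V" "0 \<in> V" "\<And>z. z \<in> V \<Longrightarrow> eval_fps tree_fps (f z) = z"
    unfolding eventually_nhds by blast
  have "l * exp (- l) < exp (-1)" using assms by (rule mult_exp_minus_less)
  hence lD: "of_real l \<in> D" using assms by (simp add: D_def)
  have "eval_fps tree_fps (f (of_real l)) = of_real l"
  proof (rule analytic_continuation_open[of "V \<inter> D" D "\<lambda>z. eval_fps tree_fps (f z)" "\<lambda>z. z"])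
    show "V \<inter> D \<noteq> {}" using V by (auto simp: D_def)
  qed (use V openD conn hol lD in auto)
  thus ?thesis by (simp add: f_def exp_of_real[symmetric])
qed

text \<open>
  For \<open>l < 1\<close> the series at \<open>l exp (-l)\<close> has the value \<open>l\<close>, and \<open>l exp (-l)\<close> is at most
  \<open>exp (-1)\<close>; so the partial sums at \<open>exp (-1)\<close> come arbitrarily close to 1.
\<close>

lemma borel_sum:
  assumes "\<epsilon> > 0"
  obtains K where "(\<Sum>s\<le>K. borel_coeff s * exp (- real s)) > 1 - \<epsilon>"
proof -
  \<comment> \<open>the maximum keeps \<open>l\<close> positive when \<open>\<epsilon>\<close> is large\<close>
  define l where "l = max (1/2) (1 - \<epsilon> / 2)"
  have l: "0 < l" "l < 1" "l > 1 - \<epsilon>" using assms by (auto simp: l_def)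
  define x where "x = l * exp (- l)"
  have x: "0 < x" "x < exp (-1)" using mult_exp_minus_less[OF l(1,2)] l by (auto simp: x_def)
  hence "ereal (norm (complex_of_real x)) < ereal (exp (-1))" by simp
  also note tree_fps_conv_radius
  finally have "(\<lambda>s. tree_fps $ s * of_real x ^ s) sums eval_fps tree_fps (of_real x)"
    by (rule sums_eval_fps)
  hence "(\<lambda>s. complex_of_real (borel_coeff s * x ^ s)) sums of_real l"
    using tree_fps_eval[OF l(1,2)] by (simp add: tree_fps_def x_def)
  hence "(\<lambda>s. borel_coeff s * x ^ s) sums l" by (simp only: sums_of_real_iff)
  hence "(\<lambda>K. \<Sum>s\<le>K. borel_coeff s * x ^ s) \<longlonglongrightarrow> l" by (simp add: sums_def_le)
  from order_tendstoD(1)[OF this l(3)] obtain K where K: "(\<Sum>s\<le>K. borel_coeff s * x ^ s) > 1 - \<epsilon>"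
    by (auto simp: eventually_at_top_linorder)
  have "(\<Sum>s\<le>K. borel_coeff s * x ^ s) \<le> (\<Sum>s\<le>K. borel_coeff s * exp (-1) ^ s)"
    using x by (intro sum_mono mult_left_mono power_mono borel_coeff_nonneg) auto
  also have "\<dots> = (\<Sum>s\<le>K. borel_coeff s * exp (- real s))"
    by (simp flip: exp_of_nat_mult)
  finally show ?thesis using K by (intro that[of K]) linarith
qed

section \<open>Ratios of numbers of factorizations\<close>

definition hurwitz :: "nat \<Rightarrow> nat \<Rightarrow> real" where
  "hurwitz g n = real (card (factorizations g n))"

text \<open>
  The part of the number of factorizations that is not a product of powers and factorials,
  normalized so that it converges to a positive constant.
\<close>

definition norm_coeff :: "nat \<Rightarrow> nat \<Rightarrow> real" where
  "norm_coeff g N = (sinh_fps ^ N) $ (2 * g) / real N ^ g"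

lemma norm_coeff_tendsto: "norm_coeff g \<longlonglongrightarrow> (1 / 24) ^ g / fact g"
  unfolding norm_coeff_def using fps_power_nth_asymptotics[OF sinh_fps_coeffs(1,2), of g]
  by (simp add: sinh_fps_coeffs)

lemma hurwitz_Suc:
  assumes "N > 0"
  shows "hurwitz g (Suc N) = fact (N + 2 * g) * real (Suc N) ^ (N + 2 * g) * (norm_coeff g N * real N ^ g) / fact (Suc N)"
  using card_factorizations[of N g] assms by (simp add: hurwitz_def norm_coeff_def field_simps del: fact_Suc)

lemma hurwitz_0: 
  assumes "s > 0"
  shows "hurwitz 0 s = real s ^ (s - 1) / real s"
proof -
  obtain N where s: "s = Suc N" using assms gr0_conv_Suc by auto
  have "fact (Suc N) * hurwitz 0 s = fact N * real (Suc N) ^ N"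
    using card_factorizations[of N 0] by (simp add: hurwitz_def s sinh_fps_coeffs fps_nth_power_0 del: fact_Suc)
  hence "fact N * (real (Suc N) * hurwitz 0 (Suc N)) = fact N * real (Suc N) ^ N"
    unfolding s fact_Suc of_nat_mult by (simp only: mult_ac)
  hence "real (Suc N) * hurwitz 0 (Suc N) = real (Suc N) ^ N" by (subst (asm) mult_left_cancel) auto
  thus ?thesis by (simp add: s field_simps)
qed

lemma eventually_hurwitz_pos: "\<forall>\<^sub>F n in sequentially. hurwitz g n > 0"
proof -
  have "\<forall>\<^sub>F N in sequentially. norm_coeff g N > 0"
    by (rule order_tendstoD(1)[OF norm_coeff_tendsto]) simp
  hence "\<forall>\<^sub>F N in sequentially. hurwitz g (Suc N) > 0"
    using eventually_gt_at_top[of 0] by eventually_elim (simp add: hurwitz_Suc)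
  thus ?thesis by (rule eventually_sequentially_Suc[of "\<lambda>n. hurwitz g n > 0", THEN iffD1])
qed

text \<open>
  The denominator is the number of samples. The number of factorizations is multiplied
  asymptotically by \<open>n\<^sup>5 / (24 g)\<close> when the genus increases from \<open>g - 1\<close> to \<open>g\<close>, while there are
  asymptotically \<open>n\<^sup>5 / 12\<close> choices of positions and labels for each factorization of genus \<open>g - 1\<close>.
\<close>

lemma ratio_genus_tendsto:
  assumes "g \<ge> 1"
  shows "(\<lambda>n. 2 * real g * hurwitz g n / (hurwitz (g - 1) n * real ((n - 1 + 2 * g) choose 2) * real (n choose 3))) \<longlonglongrightarrow> 1"
proof -
  let ?f = "\<lambda>n. 2 * real g * hurwitz g n / (hurwitz (g - 1) n * real ((n - 1 + 2 * g) choose 2) * real (n choose 3))"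
  obtain h where g: "g = Suc h" using assms by (cases g) auto
  have "(\<lambda>N. 24 * real g * (norm_coeff g N / norm_coeff h N) * ((real N + 1) / (real N - 1))) \<longlonglongrightarrow>
    24 * real g * (((1 / 24) ^ g / fact g) / ((1 / 24) ^ h / fact h)) * 1"
    by (intro tendsto_mult tendsto_divide norm_coeff_tendsto tendsto_const) (simp, real_asymp)
  also have "24 * real g * (((1 / 24) ^ g / fact g) / ((1 / 24) ^ h / fact h)) * 1 = (1 :: real)"
  proof -
    have "real g > 0" using assms by simp
    moreover have "(1 / 24) ^ g / fact g = ((1 / 24) ^ h / fact h) * (1 / (24 * real g))"
      by (simp add: g)
    ultimately show ?thesis by simp
  qed
  finally have lim: "(\<lambda>N. 24 * real g * (norm_coeff g N / norm_coeff h N) * ((real N + 1) / (real N - 1))) \<longlonglongrightarrow> 1" .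
  have "\<forall>\<^sub>F N in sequentially. norm_coeff h N > 0"
    by (rule order_tendstoD(1)[OF norm_coeff_tendsto]) simp
  hence "\<forall>\<^sub>F N in sequentially. 24 * real g * (norm_coeff g N / norm_coeff h N) * ((real N + 1) / (real N - 1)) = ?f (Suc N)"
    using eventually_gt_at_top[of 1]
  proof eventually_elim
    case (elim N)
    have c2: "real ((N + 2 * g) choose 2) = (real N + 2 * g) * (real N + 2 * g - 1) / 2"
      by (simp add: choose_two real_of_nat_div algebra_simps g)
    have c3: "real (Suc N choose 3) = (real N + 1) * real N * (real N - 1) / 6"
    proof -
      have "6 * real (Suc N choose 3) = (real N + 1) * real N * (real N - 1)"
      proof (induction N)
        case (Suc N)
        have "real (Suc (Suc N) choose 3) = real (Suc N choose 3) + real (Suc N choose 2)"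
          by (simp add: numeral_3_eq_3 numeral_2_eq_2)
        moreover have "real (Suc N choose 2) = (real N + 1) * real N / 2"
          by (simp add: choose_two real_of_nat_div algebra_simps)
        ultimately show ?case using Suc.IH by (simp add: field_simps)
      qed simp
      thus ?thesis by simp
    qed
    have fg: "fact (N + 2 * g) = (real N + 2 * g) * (real N + 2 * g - 1) * fact (N + 2 * h)"
      by (simp add: g algebra_simps)
    have pg: "real (Suc N) ^ (N + 2 * g) = real (Suc N) ^ 2 * real (Suc N) ^ (N + 2 * h)"
      by (simp add: g power_add[symmetric] algebra_simps)
    have ng: "hurwitz g (Suc N) = (real N + 2 * g) * (real N + 2 * g - 1) * real (Suc N) ^ 2 * real N * (norm_coeff g N / norm_coeff h N) * hurwitz h (Suc N)"
      using elim unfolding hurwitz_Suc[of N, OF less_trans[OF zero_less_one elim(2)]] fg pg by (simp add: g field_simps del: of_nat_Suc fact_Suc)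
    have np: "hurwitz h (Suc N) > 0" using elim by (simp add: hurwitz_Suc)
    have gen: "24 * G * q * ((n + 1) / (n - 1)) =
        2 * G * (A * B * (n + 1) ^ 2 * n * q * z) / (z * (A * B / 2) * ((n + 1) * n * (n - 1) / 6))"
      if "A > 0" "B > 0" "n > 1" "z > 0" for G q n A B z :: real
    proof -
      define W where "W = A * B * z * n * (n + 1) / 12"
      have W: "W \<noteq> 0" using that by (simp add: W_def)
      have "2 * G * (A * B * (n + 1) ^ 2 * n * q * z) = (24 * G * q * (n + 1)) * W"
        by (simp add: W_def power2_eq_square)
      moreover have "z * (A * B / 2) * ((n + 1) * n * (n - 1) / 6) = (n - 1) * W"
        by (simp add: W_def)
      ultimately have "2 * G * (A * B * (n + 1) ^ 2 * n * q * z) / (z * (A * B / 2) * ((n + 1) * n * (n - 1) / 6)) =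
          ((24 * G * q * (n + 1)) * W) / ((n - 1) * W)" by (simp only:)
      also have "\<dots> = 24 * G * q * ((n + 1) / (n - 1))"
        unfolding mult_divide_mult_cancel_right[OF W] by simp
      finally show ?thesis by (rule sym)
    qed
    have e: "Suc N - 1 + 2 * g = N + 2 * g" "g - 1 = h" "real (Suc N) = real N + 1" using g by auto
    show ?case unfolding e(1,2) ng c2 c3 unfolding e(3)
      by (rule gen) (use elim np in auto)
  qed
  hence "(\<lambda>N. ?f (Suc N)) \<longlonglongrightarrow> 1" by (rule Lim_transform_eventually[OF lim])
  thus ?thesis by (rule LIMSEQ_imp_Suc)
qed

text \<open>
  The numerator counts the factorizations of genus \<open>h\<close> obtained by cutting off an arc of length \<open>s\<close>
  with the first transposition (\<open>n\<close> positions of the arc), factoring this arc with genus 0 and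
  the other one with genus \<open>h\<close>, and shuffling the two words.
\<close>

lemma ratio_split_tendsto:
  assumes s: "s \<ge> 1"
  shows "(\<lambda>n. real n * real ((n - 2 + 2 * h) choose (s - 1)) * hurwitz 0 s * hurwitz h (n - s) / hurwitz h n)
    \<longlonglongrightarrow> borel_coeff s * exp (- real s)"
proof -
  let ?f = "\<lambda>n. real n * real ((n - 2 + 2 * h) choose (s - 1)) * hurwitz 0 s * hurwitz h (n - s) / hurwitz h n"
  let ?u = "\<lambda>M. (real (M + s + 1) / real (M + s + 2 * h)) * (fact s * (real ((M + s + 1) choose s) / real (M + s + 1) ^ s)) *
     ((real (M + 1) / real (M + s + 1)) ^ (M + 2 * h)) * (norm_coeff h M / norm_coeff h (M + s)) * (real M / real (M + s)) ^ h *
     (hurwitz 0 s / fact (s - 1))"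
  have sh: "filterlim (\<lambda>M. M + s) sequentially sequentially" "filterlim (\<lambda>M. M + s + 1) sequentially sequentially"
    by (auto intro: filterlim_subseq simp: strict_mono_def)
  have 1: "(\<lambda>M. real (M + s + 1) / real (M + s + 2 * h)) \<longlonglongrightarrow> 1"
  proof -
    define x where "x = real s" define k where "k = real h"
    have "(\<lambda>M. (real M + x + 1) / (real M + x + 2 * k)) \<longlonglongrightarrow> 1" by real_asymp
    thus ?thesis by (simp add: x_def k_def add_ac)
  qed
  have 2: "(\<lambda>M. real ((M + s + 1) choose s) / real (M + s + 1) ^ s) \<longlonglongrightarrow> 1 / fact s"
    by (rule filterlim_compose[OF tendsto_choose_over_power sh(2)])
  have 3: "(\<lambda>M. (real (M + 1) / real (M + s + 1)) ^ (M + 2 * h)) \<longlonglongrightarrow> exp (- real s)"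
  proof -
    define x where "x = real s"
    have x: "x > 0" using s by (simp add: x_def)
    define k where "k = real h"
    have "(\<lambda>M. ((real M + 1) / (real M + x + 1)) powr (real M + 2 * k)) \<longlonglongrightarrow> exp (- x)"
      using x by real_asymp
    moreover have "((real M + 1) / (real M + x + 1)) powr (real M + 2 * k) = (real (M + 1) / real (M + s + 1)) ^ (M + 2 * h)" for M
    proof -
      have "(real (M + 1) / real (M + s + 1)) > 0" by simp
      hence "(real (M + 1) / real (M + s + 1)) ^ (M + 2 * h) = (real (M + 1) / real (M + s + 1)) powr real (M + 2 * h)"
        by (simp only: powr_realpow)
      thus ?thesis by (simp add: x_def k_def add_ac)
    qed
    ultimately show ?thesis by (simp add: x_def)
  qed
  have 4: "(\<lambda>M. norm_coeff h (M + s)) \<longlonglongrightarrow> (1 / 24) ^ h / fact h"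
    by (rule filterlim_compose[OF norm_coeff_tendsto sh(1)])
  have 5: "(\<lambda>M. real M / real (M + s)) \<longlonglongrightarrow> 1"
  proof -
    define x where "x = real s"
    have "(\<lambda>M. real M / (real M + x)) \<longlonglongrightarrow> 1" by real_asymp
    thus ?thesis by (simp add: x_def)
  qed
  have nz: "(1 / 24) ^ h / fact h \<noteq> (0 :: real)" by simp
  have "?u \<longlonglongrightarrow> 1 * (fact s * (1 / fact s)) * exp (- real s) * (((1 / 24) ^ h / fact h) / ((1 / 24) ^ h / fact h)) * 1 ^ h *
      (hurwitz 0 s / fact (s - 1))"
    by (rule tendsto_mult[OF tendsto_mult[OF tendsto_mult[OF tendsto_mult[OF tendsto_mult[OF 1
      tendsto_mult[OF tendsto_const 2]] 3] tendsto_divide[OF norm_coeff_tendsto 4 nz]] tendsto_power[OF 5]] tendsto_const])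
  also have "1 * (fact s * (1 / fact s)) * exp (- real s) * (((1 / 24) ^ h / fact h) / ((1 / 24) ^ h / fact h)) * 1 ^ h *
      (hurwitz 0 s / fact (s - 1)) = borel_coeff s * exp (- real s)"
  proof -
    have "fact s = real s * fact (s - 1)" using s by (simp add: fact_reduce)
    thus ?thesis using s by (simp add: hurwitz_0 borel_coeff_def)
  qed
  finally have lim: "?u \<longlonglongrightarrow> borel_coeff s * exp (- real s)" .
  have "\<forall>\<^sub>F M in sequentially. norm_coeff h (M + s) > 0"
    by (rule eventually_compose_filterlim[OF order_tendstoD(1)[OF norm_coeff_tendsto, of 0 h] sh(1)]) simp
  hence "\<forall>\<^sub>F M in sequentially. ?u M = ?f (M + (s + 1))"
    using eventually_gt_at_top[of 0]
  proof eventually_elim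
    case (elim M)
    have n1: "M + (s + 1) = Suc (M + s)" "M + (s + 1) - s = Suc M" by auto
    have b: "real ((M + s + 1 - 2 + 2 * h) choose (s - 1)) * fact (s - 1) * fact (M + 2 * h) * real (M + s + 2 * h) = fact (M + s + 2 * h)"
    proof -
      have "real ((M + s + 1 - 2 + 2 * h) choose (s - 1)) = fact (M + s + 1 - 2 + 2 * h) / (fact (s - 1) * fact (M + s + 1 - 2 + 2 * h - (s - 1)))"
        using s by (intro binomial_fact) auto
      moreover have "M + s + 1 - 2 + 2 * h - (s - 1) = M + 2 * h" using s by auto
      moreover have "fact (M + s + 2 * h) = real (M + s + 2 * h) * fact (M + s + 1 - 2 + 2 * h)"
      proof -
        have "M + s + 2 * h = Suc (M + s + 1 - 2 + 2 * h)" using s by simp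
        thus ?thesis by (metis fact_Suc)
      qed
      ultimately show ?thesis by (simp add: field_simps)
    qed
    have c: "real ((M + s + 1) choose s) * fact s * fact (Suc M) = fact (Suc (M + s))"
      using binomial_fact[of s "M + s + 1", where 'a = real] by (simp add: field_simps del: fact_Suc)
    have p: "real (Suc (M + s)) ^ (M + s + 2 * h) = real (Suc (M + s)) ^ s * real (Suc (M + s)) ^ (M + 2 * h)"
      by (simp add: power_add[symmetric] add_ac)
    have gen: "(n / D) * (fs * (Ch / Q)) * (S / R) * (x / y) * (Mh / Msh) * (z / A) =
        n * C * z * (B * S * (x * Mh) / F1) / ((C * A * B * D) * (Q * R) * (y * Msh) / (Ch * fs * F1))"
      if "D > 0" "Q > 0" "R > 0" "y > 0" "Msh > 0" "A > 0" "C > 0" "B > 0" "F1 > 0" "Ch > 0" "fs > 0"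
      for n D fs Ch Q S R x y Mh Msh z A C B F1 :: real
      using that by (simp add: field_simps)
    have Cpos: "real ((M + s + 1 - 2 + 2 * h) choose (s - 1)) > 0" using s by (simp add: zero_less_binomial)
    have Chpos: "real ((M + s + 1) choose s) > 0" by (simp add: zero_less_binomial)
    have num1: "hurwitz h (M + (s + 1) - s) = fact (M + 2 * h) * real (M + 1) ^ (M + 2 * h) * (norm_coeff h M * real M ^ h) / fact (Suc M)"
      unfolding n1(2) hurwitz_Suc[OF elim(2)] by simp
    have num2: "hurwitz h (M + (s + 1)) = (real ((M + s + 1 - 2 + 2 * h) choose (s - 1)) * fact (s - 1) * fact (M + 2 * h) * real (M + s + 2 * h)) *
       (real (M + s + 1) ^ s * real (M + s + 1) ^ (M + 2 * h)) * (norm_coeff h (M + s) * real (M + s) ^ h) /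
       (real ((M + s + 1) choose s) * fact s * fact (Suc M))"
      unfolding b c unfolding n1 using elim hurwitz_Suc[of "M + s" h] p by (simp only: Suc_eq_plus1 add_pos_pos zero_less_numeral)
    have "M + (s + 1) - 2 + 2 * h = M + s + 1 - 2 + 2 * h" "real (M + (s + 1)) = real (M + s + 1)" by auto
    thus ?case
      unfolding num1 num2 power_divide using elim s Cpos Chpos
      by (simp only:, intro gen) (auto simp del: of_nat_Suc intro!: zero_less_power)
  qed
  hence "(\<lambda>M. ?f (M + (s + 1))) \<longlonglongrightarrow> borel_coeff s * exp (- real s)" by (rule Lim_transform_eventually[OF lim])
  thus ?thesis by (rule LIMSEQ_offset)
qed

section \<open>Cutting the long cycle along a chord\<close>

lemma permutes_commute:
  assumes "p permutes X" "q permutes Y" "X \<inter> Y = {}"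
  shows "p \<circ> q = q \<circ> p"
proof
  fix x
  consider "x \<in> X" | "x \<in> Y" | "x \<notin> X" "x \<notin> Y" by blast
  thus "(p \<circ> q) x = (q \<circ> p) x"
  proof cases
    case 1
    hence "p x \<in> X" using permutes_in_image[OF assms(1)] by simp
    hence "x \<notin> Y" "p x \<notin> Y" using 1 assms(3) by blast+
    thus ?thesis using permutes_not_in[OF assms(2), of x] permutes_not_in[OF assms(2), of "p x"] by simp
  next
    case 2
    hence "q x \<in> Y" using permutes_in_image[OF assms(2)] by simp
    hence "x \<notin> X" "q x \<notin> X" using 2 assms(3) by blast+
    thus ?thesis using permutes_not_in[OF assms(1), of x] permutes_not_in[OF assms(1), of "q x"] by simp
  next
    case 3
    thus ?thesis using permutes_not_in[OF assms(1), of x] permutes_not_in[OF assms(2), of x] by simp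
  qed
qed

lemma transps_disjoint:
  assumes "X \<inter> Y = {}"
  shows "transps X \<inter> transps Y = {}"
proof -
  have False if t: "t \<in> transps X" "t \<in> transps Y" for t
  proof -
    obtain i j where ij: "t = swap i j" "i \<in> X" "j \<in> X" "i \<noteq> j" using t by (auto simp: transps_def)
    have "i \<notin> Y" using ij assms by auto
    hence "t i = i" using permutes_not_in[OF transps_permutes[OF t(2)]] by simp
    thus False using ij by simp
  qed
  thus ?thesis by blast
qed

lemma prod_lr_commute:
  assumes "\<And>y. y \<in> set ys \<Longrightarrow> x \<circ> y = y \<circ> x"
  shows "x \<circ> prod_lr ys = prod_lr ys \<circ> x"
  using assms
proof (induction ys)
  case (Cons y ys)
  have xy: "x \<circ> y = y \<circ> x" by (rule Cons.prems) simp
  have ih: "x \<circ> prod_lr ys = prod_lr ys \<circ> x" by (rule Cons.IH, rule Cons.prems) simp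
  have "x \<circ> prod_lr (y # ys) = (x \<circ> prod_lr ys) \<circ> y" by (simp only: prod_lr.simps comp_assoc)
  also have "\<dots> = prod_lr ys \<circ> (x \<circ> y)" by (simp only: ih comp_assoc)
  also have "\<dots> = prod_lr (y # ys) \<circ> x" by (simp only: xy prod_lr.simps comp_assoc)
  finally show ?case .
qed simp

text \<open>
  Letters of the two words commute, so their order does not matter for the product.
\<close>

lemma prod_lr_shuffles:
  assumes "zs \<in> shuffles xs ys" "\<And>x y. x \<in> set xs \<Longrightarrow> y \<in> set ys \<Longrightarrow> x \<circ> y = y \<circ> x"
  shows "prod_lr zs = prod_lr xs \<circ> prod_lr ys"
  using assms
proof (induction xs ys arbitrary: zs rule: shuffles.induct)
  case (3 x xs y ys)
  from "3.prems"(1) consider zs' where "zs = x # zs'" "zs' \<in> shuffles xs (y # ys)"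
    | zs' where "zs = y # zs'" "zs' \<in> shuffles (x # xs) ys" by auto
  thus ?case
  proof cases
    case (1 zs')
    have "prod_lr zs' = prod_lr xs \<circ> prod_lr (y # ys)" by (rule "3.IH"(1)[OF 1(2)], rule "3.prems"(2)) simp_all
    hence "prod_lr zs = prod_lr xs \<circ> (prod_lr (y # ys) \<circ> x)" by (simp add: 1 comp_assoc)
    also have "prod_lr (y # ys) \<circ> x = x \<circ> prod_lr (y # ys)"
      by (rule prod_lr_commute[symmetric], rule "3.prems"(2)) simp_all
    finally show ?thesis by (simp add: comp_assoc)
  next
    case (2 zs')
    have "prod_lr zs' = prod_lr (x # xs) \<circ> prod_lr ys" by (rule "3.IH"(2)[OF 2(2)], rule "3.prems"(2)) simp_all
    thus ?thesis by (simp add: 2 comp_assoc)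
  qed
qed auto

text \<open>
  The two words can be recovered from a shuffle because no transposition belongs to both sets, so
  shuffles of different pairs are different.
\<close>

lemma card_words_to_shuffle:
  assumes fin: "finite X" "finite Y" and disj: "X \<inter> Y = {}"
  shows "((k + l) choose k) * card (words_to X k \<zeta>) * card (words_to Y l \<eta>) \<le> card (words_to (X \<union> Y) (k + l) (\<zeta> \<circ> \<eta>))"
proof -
  let ?A = "words_to X k \<zeta>" and ?B = "words_to Y l \<eta>"
  let ?S = "\<lambda>(xs, ys). shuffles xs ys"
  note tdisj = transps_disjoint[OF disj]
  have sub: "set xs \<subseteq> transps X" "length xs = k" "prod_lr xs = \<zeta>" if "xs \<in> ?A" for xs
    using that by (auto simp: words_to_def words_def)
  have sub': "set ys \<subseteq> transps Y" "length ys = l" "prod_lr ys = \<eta>" if "ys \<in> ?B" for ys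
    using that by (auto simp: words_to_def words_def)
  have rec: "filter (\<lambda>t. t \<in> transps X) zs = xs" "filter (\<lambda>t. t \<in> transps Y) zs = ys"
    if "xs \<in> ?A" "ys \<in> ?B" "zs \<in> shuffles xs ys" for xs ys zs
  proof -
    have "filter P zs \<in> shuffles (filter P xs) (filter P ys)" for P
      using that(3) filter_shuffles[of P xs ys] by blast
    moreover have "filter (\<lambda>t. t \<in> transps X) xs = xs" "filter (\<lambda>t. t \<in> transps Y) xs = []"
      using sub[OF that(1)] tdisj by (auto simp: filter_id_conv filter_empty_conv)
    moreover have "filter (\<lambda>t. t \<in> transps Y) ys = ys" "filter (\<lambda>t. t \<in> transps X) ys = []"
      using sub'[OF that(2)] tdisj by (auto simp: filter_id_conv filter_empty_conv)
    ultimately show "filter (\<lambda>t. t \<in> transps X) zs = xs" "filter (\<lambda>t. t \<in> transps Y) zs = ys"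
      by (metis shuffles.simps(1,2) singletonD)+
  qed
  have "card (\<Union>z\<in>?A \<times> ?B. ?S z) = (\<Sum>z\<in>?A \<times> ?B. card (?S z))"
  proof (rule card_UN_disjoint)
    show "finite (?A \<times> ?B)" using fin by (simp add: finite_words_to)
    show "\<forall>i\<in>?A \<times> ?B. finite (?S i)" by auto
    show "\<forall>i\<in>?A \<times> ?B. \<forall>j\<in>?A \<times> ?B. i \<noteq> j \<longrightarrow> ?S i \<inter> ?S j = {}"
      using rec by (clarsimp simp: disjoint_iff) metis
  qed
  also have "\<dots> = (\<Sum>z\<in>?A \<times> ?B. (k + l) choose k)"
  proof (intro sum.cong refl)
    fix z assume "z \<in> ?A \<times> ?B"
    then obtain xs ys where z: "z = (xs, ys)" "xs \<in> ?A" "ys \<in> ?B" by auto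
    have "set xs \<inter> set ys = {}" using sub(1)[OF z(2)] sub'(1)[OF z(3)] tdisj by blast
    thus "card (?S z) = (k + l) choose k"
      using sub[OF z(2)] sub'[OF z(3)] by (simp add: z(1) card_disjoint_shuffles)
  qed
  also have "\<dots> = ((k + l) choose k) * card ?A * card ?B" by (simp add: card_cartesian_product)
  finally have "((k + l) choose k) * card ?A * card ?B = card (\<Union>z\<in>?A \<times> ?B. ?S z)" by simp
  also have "\<dots> \<le> card (words_to (X \<union> Y) (k + l) (\<zeta> \<circ> \<eta>))"
  proof (rule card_mono)
    show "finite (words_to (X \<union> Y) (k + l) (\<zeta> \<circ> \<eta>))" using fin by (simp add: finite_words_to)
    show "(\<Union>z\<in>?A \<times> ?B. ?S z) \<subseteq> words_to (X \<union> Y) (k + l) (\<zeta> \<circ> \<eta>)"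
    proof clarify
      fix xs ys zs assume z: "xs \<in> ?A" "ys \<in> ?B" "zs \<in> shuffles xs ys"
      have comm: "x \<circ> y = y \<circ> x" if "x \<in> set xs" "y \<in> set ys" for x y
        using that sub(1)[OF z(1)] sub'(1)[OF z(2)] disj by (intro permutes_commute) (auto intro: transps_permutes)
      have "prod_lr zs = \<zeta> \<circ> \<eta>" using prod_lr_shuffles[OF z(3) comm] sub(3)[OF z(1)] sub'(3)[OF z(2)] by simp
      moreover have "length zs = k + l" using length_shuffles[OF z(3)] sub(2)[OF z(1)] sub'(2)[OF z(2)] by simp
      moreover have "set zs \<subseteq> transps X \<union> transps Y"
        using set_shuffles[OF z(3)] sub(1)[OF z(1)] sub'(1)[OF z(2)] by blast
      moreover have "transps X \<union> transps Y \<subseteq> transps (X \<union> Y)" by (auto simp: transps_def)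
      ultimately show "zs \<in> words_to (X \<union> Y) (k + l) (\<zeta> \<circ> \<eta>)" by (auto simp: words_to_def words_def)
    qed
  qed
  finally show ?thesis .
qed

definition restr :: "nat set \<Rightarrow> perm \<Rightarrow> perm" where
  "restr X \<pi> x = (if x \<in> X then \<pi> x else x)"

lemma restr_permutes:
  assumes "finite X" "\<pi> ` X \<subseteq> X" "inj \<pi>"
  shows "restr X \<pi> permutes X"
proof (rule bij_imp_permutes)
  have "inj_on \<pi> X" using assms(3) by (rule inj_on_subset) simp
  hence "bij_betw \<pi> X X" using endo_inj_surj[OF assms(1,2)] by (auto simp: bij_betw_def)
  thus "bij_betw (restr X \<pi>) X X" by (rule bij_betw_cong[THEN iffD1, rotated]) (simp add: restr_def)
qed (simp add: restr_def)

text \<open>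
  A set inside \<open>X\<close> that is closed under \<open>\<pi>\<close> becomes closed under the full cycle \<open>c\<close>
  after \<open>Y\<close> has been added if it contains \<open>q\<close>, and is already closed under \<open>c\<close> if it does not.
\<close>

lemma full_cycle_on_restr:
  assumes c: "full_cycle_on Z c" "finite Z" and Z: "Z = X \<union> Y" "X \<inter> Y = {}" and pq: "p \<in> Y" "q \<in> X"
    and \<pi>: "\<pi> = c \<circ> swap p q" and inv: "\<pi> ` X \<subseteq> X" "\<pi> ` Y \<subseteq> Y"
  shows "full_cycle_on X (restr X \<pi>)"
  unfolding full_cycle_on_def
proof (intro conjI allI impI)
  have cZ: "c permutes Z" using c by (simp add: full_cycle_on_def)
  have "inj \<pi>" unfolding \<pi> using cZ by (intro inj_compose permutes_inj[of c]) auto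
  thus "restr X \<pi> permutes X" using inv c Z by (intro restr_permutes) auto
  fix B assume B: "B \<subseteq> X" "B \<noteq> {}" "restr X \<pi> ` B \<subseteq> B"
  have cl: "B' = Z" if "B' \<subseteq> Z" "B' \<noteq> {}" "c ` B' \<subseteq> B'" for B'
    using c that by (simp add: full_cycle_on_def)
  have piB: "\<pi> x \<in> B" if "x \<in> B" for x
    using B that by (auto simp: restr_def image_subset_iff)
  have c1: "c x = \<pi> x" if "x \<noteq> p" "x \<noteq> q" for x using that by (simp add: \<pi>)
  have c2: "c p = \<pi> q" "c q = \<pi> p" by (simp_all add: \<pi>)
  show "B = X"
  proof (cases "q \<in> B")
    case True
    have "c ` (B \<union> Y) \<subseteq> B \<union> Y"
    proof (rule image_subsetI)
      fix x assume x: "x \<in> B \<union> Y"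
      show "c x \<in> B \<union> Y"
      proof (cases "x = p \<or> x = q")
        case True
        have "\<pi> p \<in> Y" using inv pq by auto
        thus ?thesis using True c2 piB[OF \<open>q \<in> B\<close>] by auto
      next
        case False
        thus ?thesis using c1[of x] x piB[of x] inv by auto
      qed
    qed
    hence "B \<union> Y = Z" using B Z by (intro cl) auto
    thus ?thesis using B Z by auto
  next
    case False
    have "c ` B \<subseteq> B"
    proof (rule image_subsetI)
      fix x assume x: "x \<in> B"
      hence "x \<noteq> p" "x \<noteq> q" using B Z pq False by auto
      thus "c x \<in> B" using c1[of x] piB[OF x] by simp
    qed
    hence "B = Z" using B Z by (intro cl) auto
    thus ?thesis using B Z pq by auto
  qed
qed

text \<open>
  A lower bound for the number of factorizations of genus \<open>h\<close> with a given first transposition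
  that cuts the long cycle into arcs of lengths \<open>s\<close> and \<open>n - s\<close>.
\<close>

definition split_bound :: "nat \<Rightarrow> nat \<Rightarrow> nat \<Rightarrow> real" where
  "split_bound h n s = real ((n - 2 + 2 * h) choose (s - 1)) * hurwitz 0 s * hurwitz h (n - s)"

lemma card_words_to_chord_ge:
  assumes pq: "1 \<le> p" "p < q" "q \<le> n" and s: "s = q - p \<or> s = n - (q - p)"
  shows "split_bound h n s \<le> real (card (words_to {1..n} (n - 2 + 2 * h) (long_cycle n \<circ> swap p q)))"
proof -
  define X where "X = {p + 1..q}"
  define Y where "Y = {1..n} - X"
  define \<pi> where "\<pi> = long_cycle n \<circ> swap p q"
  have lc: "long_cycle n x = (if x = n then 1 else Suc x)" if "1 \<le> x" "x \<le> n" for x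
    using that by (rule long_cycle_apply)
  have inX: "\<pi> x \<in> X" if "x \<in> X" for x
    using that pq by (cases "x = q") (auto simp: \<pi>_def X_def lc)
  have inY: "\<pi> x \<in> Y" if "x \<in> Y" for x
  proof (cases "x = p")
    case True
    thus ?thesis using pq lc[of q] by (auto simp: \<pi>_def X_def Y_def)
  next
    case False
    hence "x \<noteq> q" "1 \<le> x" "x \<le> n" using that pq by (auto simp: X_def Y_def)
    thus ?thesis using False that pq lc[of x] by (auto simp: \<pi>_def X_def Y_def)
  qed
  have im: "\<pi> ` X \<subseteq> X" "\<pi> ` Y \<subseteq> Y" using inX inY by auto
  have Z: "{1..n} = X \<union> Y" "X \<inter> Y = {}" "finite X" "finite Y" using pq by (auto simp: X_def Y_def)
  have mem: "p \<in> Y" "q \<in> X" using pq by (auto simp: X_def Y_def)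
  have fX: "full_cycle_on X (restr X \<pi>)"
    by (rule full_cycle_on_restr[OF full_cycle_on_long_cycle _ Z(1,2) mem \<pi>_def im]) simp
  have fY: "full_cycle_on Y (restr Y \<pi>)"
  proof (rule full_cycle_on_restr[OF full_cycle_on_long_cycle _ _ _ mem(2,1) _ im(2,1)])
    show "\<pi> = long_cycle n \<circ> swap q p" by (simp add: \<pi>_def transpose_commute)
  qed (use Z in auto)
  have "\<pi> x = (restr X \<pi> \<circ> restr Y \<pi>) x" for x
  proof -
    consider "x \<in> X" | "x \<in> Y" | "x \<notin> {1..n}" using Z by blast
    thus ?thesis
    proof cases
      case 3
      hence "x \<noteq> p" "x \<noteq> q" using pq by auto
      moreover have "long_cycle n x = x" by (rule permutes_not_in[OF long_cycle_permutes 3])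
      ultimately show ?thesis using 3 Z by (auto simp: restr_def \<pi>_def)
    next
      case 1
      hence "x \<notin> Y" using Z by auto
      thus ?thesis using 1 by (simp add: restr_def)
    next
      case 2
      hence "\<pi> x \<notin> X" using inY[OF 2] Z by auto
      thus ?thesis using 2 by (simp add: restr_def)
    qed
  qed
  hence dec: "\<pi> = restr X \<pi> \<circ> restr Y \<pi>" by (rule ext)
  have dec': "\<pi> = restr Y \<pi> \<circ> restr X \<pi>"
    using dec permutes_commute[of "restr X \<pi>" X "restr Y \<pi>" Y] fX fY Z by (simp add: full_cycle_on_def)
  have cX: "card X = q - p" and cY: "card Y = n - (q - p)"
    using pq by (auto simp: X_def Y_def card_Diff_subset)
  have gen: "split_bound h n (card A) \<le> real (card (words_to {1..n} (n - 2 + 2 * h) \<pi>))"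
    if AB: "full_cycle_on A \<zeta>" "full_cycle_on B \<eta>" "A \<inter> B = {}" "A \<union> B = {1..n}" "A \<noteq> {}" "B \<noteq> {}" "\<pi> = \<zeta> \<circ> \<eta>" for A B \<zeta> \<eta>
  proof -
    have fin: "finite A" "finite B" using AB(4) by (metis finite_Un finite_atLeastAtMost)+
    obtain a b where ab: "card A = Suc a" "card B = Suc b"
      using fin AB(5,6) by (metis card_0_eq not0_implies_Suc)
    have n: "n = Suc a + Suc b" using card_Un_disjoint[OF fin AB(3)] AB(4) ab by simp
    have "((a + (b + 2 * h)) choose a) * card (words_to A a \<zeta>) * card (words_to B (b + 2 * h) \<eta>) \<le>
        card (words_to (A \<union> B) (a + (b + 2 * h)) (\<zeta> \<circ> \<eta>))"
      by (rule card_words_to_shuffle[OF fin AB(3)])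
    hence "real (((a + (b + 2 * h)) choose a) * card (words_to A a \<zeta>) * card (words_to B (b + 2 * h) \<eta>)) \<le>
        real (card (words_to (A \<union> B) (a + (b + 2 * h)) (\<zeta> \<circ> \<eta>)))"
      by (rule of_nat_mono)
    moreover have "real (card (words_to A a \<zeta>)) = hurwitz 0 (Suc a)"
      using card_words_to_full_cycle[OF fin(1) AB(1) ab(1), of a] by (simp add: hurwitz_def factorizations_eq_words_to)
    moreover have "real (card (words_to B (b + 2 * h) \<eta>)) = hurwitz h (Suc b)"
      using card_words_to_full_cycle[OF fin(2) AB(2) ab(2)] by (simp add: hurwitz_def factorizations_eq_words_to)
    moreover have "n - 2 + 2 * h = a + (b + 2 * h)" "n - card A = Suc b" using n ab by auto
    ultimately show ?thesis using AB(4,7) ab by (simp add: split_bound_def)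
  qed
  have ne: "X \<noteq> {}" "Y \<noteq> {}" using mem by auto
  have "split_bound h n (card X) \<le> real (card (words_to {1..n} (n - 2 + 2 * h) \<pi>))"
    by (rule gen[OF fX fY]) (use Z ne dec in auto)
  moreover have "split_bound h n (card Y) \<le> real (card (words_to {1..n} (n - 2 + 2 * h) \<pi>))"
    by (rule gen[OF fY fX]) (use Z ne dec' in auto)
  ultimately show ?thesis using s unfolding cX cY \<pi>_def by auto
qed

text \<open>
  The chord from \<open>p\<close> to \<open>q\<close> leaves more than \<open>K\<close> labels on both sides of the circle.
\<close>

definition wide :: "nat \<Rightarrow> nat \<Rightarrow> perm \<Rightarrow> bool" where
  "wide K n t \<longleftrightarrow> (\<exists>p q. t = swap p q \<and> p + K < q \<and> q + K < p + n)"

lemma card_factorizations_hd: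
  assumes "n \<ge> 2"
  shows "card {ts \<in> factorizations h n. hd ts = t} = (if t \<in> transps {1..n} then card (words_to {1..n} (n - 2 + 2 * h) (long_cycle n \<circ> t)) else 0)"
proof (cases "t \<in> transps {1..n}")
  case False
  have "{ts \<in> factorizations h n. hd ts = t} = {}"
  proof -
    have False if ts: "ts \<in> factorizations h n" "hd ts = t" for ts
    proof -
      have "ts \<noteq> []" using ts assms by (auto simp: factorizations_def)
      thus False using ts False hd_in_set[of ts] by (auto simp: factorizations_eq_words_to words_to_def words_def)
    qed
    thus ?thesis by blast
  qed
  thus ?thesis using False by (simp only: card.empty if_False)
next
  case True
  then obtain i j where t: "t = swap i j" by (auto simp: transps_def)
  have tt: "t \<circ> t = id" by (simp add: t)
  have len: "n - 1 + 2 * h = Suc (n - 2 + 2 * h)" using assms by simp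
  have eq: "prod_lr us = long_cycle n \<circ> t \<longleftrightarrow> prod_lr us \<circ> t = long_cycle n" for us
    using tt by (metis comp_assoc comp_id)
  have "bij_betw ((#) t) (words_to {1..n} (n - 2 + 2 * h) (long_cycle n \<circ> t)) {ts \<in> factorizations h n. hd ts = t}"
  proof (rule bij_betw_byWitness[where f' = tl])
    show "(#) t ` words_to {1..n} (n - 2 + 2 * h) (long_cycle n \<circ> t) \<subseteq> {ts \<in> factorizations h n. hd ts = t}"
      using True len by (auto simp: factorizations_eq_words_to words_to_def words_def eq)
    show "\<forall>a'\<in>{ts \<in> factorizations h n. hd ts = t}. t # tl a' = a'"
      using len by (auto simp: factorizations_def length_Suc_conv)
    show "tl ` {ts \<in> factorizations h n. hd ts = t} \<subseteq> words_to {1..n} (n - 2 + 2 * h) (long_cycle n \<circ> t)"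
      unfolding factorizations_eq_words_to words_to_def words_def len by (auto simp: length_Suc_conv eq)
  qed simp
  thus ?thesis using True by (simp add: bij_betw_same_card)
qed

text \<open>
  Each of the \<open>n\<close> chords with an arc of length \<open>s \<le> K\<close> is the first transposition of at least
  \<open>split_bound h n s\<close> factorizations, and these first transpositions are not wide. Since \<open>2 K < n\<close>, a chord
  has at most one such arc, so no factorization is counted twice.
\<close>

lemma card_wide_hd:
  assumes n: "n > 2 * K" "n \<ge> 2"
  shows "real (card {ts \<in> factorizations h n. wide K n (hd ts)}) \<le> hurwitz h n - (\<Sum>s\<in>{1..K}. real n * split_bound h n s)"
proof -
  let ?F = "factorizations h n"
  let ?a = "\<lambda>t. real (card (words_to {1..n} (n - 2 + 2 * h) (long_cycle n \<circ> t)))"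
  define chord where "chord = (\<lambda>(s, i). if i + s \<le> n then swap i (i + s) else swap (i + s - n) i)"
  let ?D = "{1..K} \<times> {1..n}"
  have finF: "finite ?F" by (simp add: factorizations_eq_words_to finite_words_to)
  have chord: "\<exists>p q. 1 \<le> p \<and> p < q \<and> q \<le> n \<and> (s = q - p \<or> s = n - (q - p)) \<and> chord (s, i) = swap p q \<and> (q - p \<le> K \<or> n - (q - p) \<le> K)"
    if "(s, i) \<in> ?D" for s i
  proof (cases "i + s \<le> n")
    case True
    thus ?thesis using that by (intro exI[of _ i] exI[of _ "i + s"]) (auto simp: chord_def)
  next
    case False
    thus ?thesis using that n by (intro exI[of _ "i + s - n"] exI[of _ i]) (auto simp: chord_def)
  qed
  have inj: "inj_on chord ?D"
  proof (rule inj_onI, clarify)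
    fix s i s' i' assume *: "s \<in> {1..K}" "i \<in> {1..n}" "s' \<in> {1..K}" "i' \<in> {1..n}" "chord (s, i) = chord (s', i')"
    consider "i + s \<le> n" "i' + s' \<le> n" | "i + s \<le> n" "\<not> i' + s' \<le> n" | "\<not> i + s \<le> n" "i' + s' \<le> n" | "\<not> i + s \<le> n" "\<not> i' + s' \<le> n"
      by blast
    thus "s = s' \<and> i = i'"
    proof cases
      case 1
      thus ?thesis using * transpose_eq_iff_ordered[of i "i + s" i' "i' + s'"] by (auto simp: chord_def)
    next
      case 2
      have lt: "i < i + s" "i' + s' - n < i'" using * n 2 by auto
      have "swap i (i + s) = swap (i' + s' - n) i'"
        using *(5) 2 by (simp add: chord_def)
      hence "i = i' + s' - n \<and> i + s = i'"
        using lt by (subst (asm) transpose_eq_iff_ordered) auto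
      hence False using * 2 n by auto
      thus ?thesis ..
    next
      case 3
      have lt: "i' < i' + s'" "i + s - n < i" using * n 3 by auto
      have "swap (i + s - n) i = swap i' (i' + s')"
        using *(5) 3 by (simp add: chord_def)
      hence "i + s - n = i' \<and> i = i' + s'"
        using lt by (subst (asm) transpose_eq_iff_ordered) auto
      hence False using * 3 n by auto
      thus ?thesis ..
    next
      case 4
      have lt: "i' + s' - n < i'" "i + s - n < i" using * n 4 by auto
      have "swap (i + s - n) i = swap (i' + s' - n) i'"
        using *(5) 4 by (simp add: chord_def)
      hence "i + s - n = i' + s' - n \<and> i = i'"
        using lt by (subst (asm) transpose_eq_iff_ordered) auto
      thus ?thesis using 4 by auto
    qed
  qed
  have tr: "chord z \<in> transps {1..n}" "\<not> wide K n (chord z)" "split_bound h n (fst z) \<le> ?a (chord z)" if z: "z \<in> ?D" for z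
  proof -
    obtain s i where si: "z = (s, i)" by (cases z)
    then obtain p q where pq: "1 \<le> p" "p < q" "q \<le> n" "s = q - p \<or> s = n - (q - p)" "chord z = swap p q"
        "q - p \<le> K \<or> n - (q - p) \<le> K"
      using chord z by blast
    show "chord z \<in> transps {1..n}" unfolding pq(5) transps_def mem_Collect_eq
      using pq by (intro exI[of _ p] exI[of _ q]) auto
    show "\<not> wide K n (chord z)"
    proof
      assume "wide K n (chord z)"
      then obtain p' q' where pq': "swap p q = swap p' q'" "p' + K < q'" "q' + K < p' + n"
        by (auto simp: wide_def pq)
      hence "p = p' \<and> q = q'" using transpose_eq_iff_ordered[of p q p' q'] pq by simp
      thus False using pq pq' by auto
    qed
    show "split_bound h n (fst z) \<le> ?a (chord z)"
      using card_words_to_chord_ge[OF pq(1-4), of h] unfolding pq(5) unfolding si fst_conv .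
  qed
  have "(\<Sum>s\<in>{1..K}. real n * split_bound h n s) = (\<Sum>z\<in>?D. split_bound h n (fst z))"
    unfolding sum.cartesian_product' by simp
  also have "\<dots> \<le> (\<Sum>z\<in>?D. ?a (chord z))" by (rule sum_mono) (rule tr(3))
  also have "\<dots> = (\<Sum>t\<in>chord ` ?D. ?a t)" unfolding sum.reindex[OF inj] comp_def ..
  also have "\<dots> = (\<Sum>t\<in>chord ` ?D. real (card {ts \<in> ?F. hd ts = t}))"
  proof (intro sum.cong refl)
    fix t assume "t \<in> chord ` ?D"
    then obtain z where "z \<in> ?D" "t = chord z" by (rule imageE)
    hence "t \<in> transps {1..n}" using tr(1)[of z] by simp
    thus "?a t = real (card {ts \<in> ?F. hd ts = t})" unfolding card_factorizations_hd[OF n(2)] by simp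
  qed
  also have "\<dots> = real (card (\<Union>t\<in>chord ` ?D. {ts \<in> ?F. hd ts = t}))"
  proof (subst card_UN_disjoint)
    show "finite (chord ` ?D)" by simp
    show "\<forall>t\<in>chord ` ?D. finite {ts \<in> ?F. hd ts = t}" using finF by simp
    show "\<forall>t\<in>chord ` ?D. \<forall>u\<in>chord ` ?D. t \<noteq> u \<longrightarrow> {ts \<in> ?F. hd ts = t} \<inter> {ts \<in> ?F. hd ts = u} = {}" by auto
  qed (simp only: of_nat_sum)
  also have "\<dots> \<le> real (card (?F - {ts \<in> ?F. wide K n (hd ts)}))"
  proof (intro of_nat_mono card_mono)
    show "(\<Union>t\<in>chord ` ?D. {ts \<in> ?F. hd ts = t}) \<subseteq> ?F - {ts \<in> ?F. wide K n (hd ts)}"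
    proof
      fix ts assume "ts \<in> (\<Union>t\<in>chord ` ?D. {ts \<in> ?F. hd ts = t})"
      then obtain z where "z \<in> ?D" "ts \<in> ?F" "hd ts = chord z" by auto
      thus "ts \<in> ?F - {ts \<in> ?F. wide K n (hd ts)}" using tr(2)[of z] by simp
    qed
    show "finite (?F - {ts \<in> ?F. wide K n (hd ts)})" using finF by simp
  qed
  also have "\<dots> = hurwitz h n - real (card {ts \<in> ?F. wide K n (hd ts)})"
  proof -
    have "card {ts \<in> ?F. wide K n (hd ts)} \<le> card ?F" using finF by (intro card_mono) auto
    moreover have "card (?F - {ts \<in> ?F. wide K n (hd ts)}) = card ?F - card {ts \<in> ?F. wide K n (hd ts)}"
      using finF by (intro card_Diff_subset) auto
    ultimately show ?thesis by (simp add: hurwitz_def of_nat_diff)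
  qed
  finally show ?thesis by simp
qed

text \<open>
  The lower bounds for short arcs exhaust all factorizations in the limit, because the Borel
  distribution has total mass 1. In particular, the factorizations that remain connected when the
  first transposition is deleted are negligible.
\<close>

lemma few_wide_first_steps:
  assumes "\<epsilon> > 0"
  obtains K where "\<forall>\<^sub>F n in sequentially. real (card {ts \<in> factorizations h n. wide K n (hd ts)}) \<le> \<epsilon> * hurwitz h n"
proof -
  obtain K where K: "(\<Sum>s\<le>K. borel_coeff s * exp (- real s)) > 1 - \<epsilon>" using borel_sum[OF assms] .
  have "(\<Sum>s\<le>K. borel_coeff s * exp (- real s)) = (\<Sum>s\<in>{1..K}. borel_coeff s * exp (- real s))"
    by (rule sum.mono_neutral_right) (auto simp: borel_coeff_def)
  hence K': "(\<Sum>s\<in>{1..K}. borel_coeff s * exp (- real s)) > 1 - \<epsilon>" using K by simp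
  have "(\<lambda>n. \<Sum>s\<in>{1..K}. real n * split_bound h n s / hurwitz h n) \<longlonglongrightarrow> (\<Sum>s\<in>{1..K}. borel_coeff s * exp (- real s))"
    using ratio_split_tendsto[where h = h] by (intro tendsto_sum) (simp add: split_bound_def mult_ac)
  from order_tendstoD(1)[OF this K'] have "\<forall>\<^sub>F n in sequentially. 1 - \<epsilon> < (\<Sum>s\<in>{1..K}. real n * split_bound h n s / hurwitz h n)" .
  hence "\<forall>\<^sub>F n in sequentially. real (card {ts \<in> factorizations h n. wide K n (hd ts)}) \<le> \<epsilon> * hurwitz h n"
    using eventually_hurwitz_pos[of h] eventually_gt_at_top[of "2 * K"] eventually_ge_at_top[of 2]
  proof eventually_elim
    case (elim n)
    have "(1 - \<epsilon>) * hurwitz h n < (\<Sum>s\<in>{1..K}. real n * split_bound h n s)"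
      using elim(1,2) by (simp add: sum_divide_distrib[symmetric] pos_less_divide_eq)
    thus ?case using card_wide_hd[OF elim(3,4), of h] by (simp add: algebra_simps)
  qed
  thus ?thesis by (rule that)
qed

section \<open>Rounds\<close>

text \<open>
  \<open>rounds ts k x\<close> is the label which the first \<open>k\<close> transpositions move to \<open>x\<close>.
\<close>

definition rounds :: "perm list \<Rightarrow> nat \<Rightarrow> perm" where
  "rounds ts k = inv (prod_lr (take k ts))"

lemma factorizations_permutes:
  assumes "ts \<in> factorizations h n"
  shows "prod_lr (take k ts) permutes {1..n}"
  by (rule prod_lr_permutes)
    (use assms in \<open>auto simp: factorizations_def transpositions_eq_transps dest!: in_set_takeD intro: transps_permutes\<close>)

text \<open>
  Conjugation moves the transposition in position \<open>k\<close> to the front without changing the product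
  or the other transpositions. It then exchanges the rounds of the two labels.
\<close>

lemma card_wide_nth:
  assumes k: "k < n - 1 + 2 * h"
  shows "card {ts \<in> factorizations h n. wide K n (conj_perm (rounds ts k) (ts ! k))} \<le> card {ts \<in> factorizations h n. wide K n (hd ts)}"
proof -
  let ?F = "factorizations h n"
  define \<phi> where "\<phi> ts = conj_perm (rounds ts k) (ts ! k) # take k ts @ drop (Suc k) ts" for ts
  have finF: "finite ?F" by (simp add: factorizations_eq_words_to finite_words_to)
  have len: "length ts = n - 1 + 2 * h" "k < length ts" if "ts \<in> ?F" for ts
    using that k by (auto simp: factorizations_def)
  have bij: "bij (rounds ts k)" "rounds ts k ` {1..n} = {1..n}" if "ts \<in> ?F" for ts
    using permutes_bij[OF permutes_inv[OF factorizations_permutes[OF that]]]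
      permutes_image[OF permutes_inv[OF factorizations_permutes[OF that]]] unfolding rounds_def .
  have prod: "prod_lr (\<phi> ts) = prod_lr ts" if "ts \<in> ?F" for ts
  proof -
    define A where "A = prod_lr (take k ts)"
    have A: "bij A" unfolding A_def by (rule permutes_bij[OF factorizations_permutes[OF that]])
    have Ai: "A \<circ> inv A = id" by (rule surj_iff[THEN iffD1, OF bij_is_surj[OF A]])
    have ii: "inv (inv A) = A" by (rule inv_inv_eq[OF A])
    have "prod_lr (\<phi> ts) = prod_lr (drop (Suc k) ts) \<circ> A \<circ> conj_perm (inv A) (ts ! k)"
      by (simp only: \<phi>_def prod_lr.simps prod_lr_append rounds_def A_def)
    also have "\<dots> = prod_lr (drop (Suc k) ts) \<circ> A \<circ> (inv A \<circ> ts ! k \<circ> A)" by (simp only: conj_perm_def ii)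
    also have "\<dots> = prod_lr (drop (Suc k) ts) \<circ> (A \<circ> inv A) \<circ> ts ! k \<circ> A" by (simp only: comp_assoc)
    also have "\<dots> = prod_lr (drop (Suc k) ts) \<circ> ts ! k \<circ> A" by (simp only: Ai comp_id)
    also have "\<dots> = prod_lr (take k ts @ ts ! k # drop (Suc k) ts)"
      by (simp only: prod_lr_append prod_lr.simps A_def)
    also have "take k ts @ ts ! k # drop (Suc k) ts = ts" by (rule id_take_nth_drop[OF len(2)[OF that], symmetric])
    finally show ?thesis .
  qed
  have mem: "\<phi> ts \<in> ?F" if ts: "ts \<in> ?F" for ts
  proof -
    have sub: "set ts \<subseteq> transps {1..n}" using ts by (simp add: factorizations_def transpositions_eq_transps)
    have "conj_perm (rounds ts k) (ts ! k) \<in> transps (rounds ts k ` {1..n})"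
      by (rule conj_perm_mem_transps[OF bij(1)[OF ts]]) (use sub len[OF ts] nth_mem[of k ts] in blast)
    hence "set (\<phi> ts) \<subseteq> transps {1..n}"
      unfolding bij(2)[OF ts] \<phi>_def using sub set_take_subset[of k ts] set_drop_subset[of "Suc k" ts] by auto
    moreover have "length (\<phi> ts) = length ts" using len[OF ts] by (simp add: \<phi>_def)
    ultimately show ?thesis using prod[OF ts] ts by (simp add: factorizations_def transpositions_eq_transps)
  qed
  have inj: "inj_on \<phi> ?F"
  proof (rule inj_onI)
    fix ts us assume ts: "ts \<in> ?F" and us: "us \<in> ?F" and eq: "\<phi> ts = \<phi> us"
    have t: "take k (tl (\<phi> ts)) = take k ts" "drop k (tl (\<phi> ts)) = drop (Suc k) ts"
      using len[OF ts] by (simp_all add: \<phi>_def)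
    have u: "take k (tl (\<phi> us)) = take k us" "drop k (tl (\<phi> us)) = drop (Suc k) us"
      using len[OF us] by (simp_all add: \<phi>_def)
    have "take k (tl (\<phi> ts)) = take k (tl (\<phi> us))" "drop k (tl (\<phi> ts)) = drop k (tl (\<phi> us))"
      by (simp_all only: eq)
    hence e: "take k ts = take k us" "drop (Suc k) ts = drop (Suc k) us" unfolding t u .
    hence r: "rounds ts k = rounds us k" by (simp add: rounds_def)
    have "conj_perm (rounds ts k) (ts ! k) = conj_perm (rounds ts k) (us ! k)"
      using eq r by (simp add: \<phi>_def)
    hence "map (conj_perm (inv (rounds ts k))) (map (conj_perm (rounds ts k)) [ts ! k]) =
        map (conj_perm (inv (rounds ts k))) (map (conj_perm (rounds ts k)) [us ! k])" by simp
    hence "[ts ! k] = [us ! k]" unfolding map_conj_inverse(1)[OF bij(1)[OF ts]] .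
    hence nth: "ts ! k = us ! k" by simp
    have "ts = take k ts @ ts ! k # drop (Suc k) ts" by (rule id_take_nth_drop[OF len(2)[OF ts]])
    also have "\<dots> = us" unfolding e nth by (rule id_take_nth_drop[OF len(2)[OF us], symmetric])
    finally show "ts = us" .
  qed
  have "card {ts \<in> ?F. wide K n (conj_perm (rounds ts k) (ts ! k))} = card (\<phi> ` {ts \<in> ?F. wide K n (conj_perm (rounds ts k) (ts ! k))})"
    by (rule card_image[symmetric], rule inj_on_subset[OF inj]) auto
  also have "\<dots> \<le> card {ts \<in> ?F. wide K n (hd ts)}"
  proof (rule card_mono)
    show "\<phi> ` {ts \<in> ?F. wide K n (conj_perm (rounds ts k) (ts ! k))} \<subseteq> {ts \<in> ?F. wide K n (hd ts)}"
    proof (rule image_subsetI)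
      fix ts assume "ts \<in> {ts \<in> ?F. wide K n (conj_perm (rounds ts k) (ts ! k))}"
      thus "\<phi> ts \<in> {ts \<in> ?F. wide K n (hd ts)}" using mem[of ts] by (simp add: \<phi>_def)
    qed
  qed (use finF in simp)
  finally show ?thesis .
qed

section \<open>Descents and tame labels\<close>

lemma rounds_0 [simp]: "rounds ts 0 = id"
  by (simp add: rounds_def)

lemma transps_inv: "t \<in> transps X \<Longrightarrow> inv t = t"
  by (auto simp: transps_def)

lemma rounds_permutes:
  assumes "set ts \<subseteq> transps X"
  shows "rounds ts k permutes X"
  unfolding rounds_def
proof (intro permutes_inv prod_lr_permutes)
  fix t assume "t \<in> set (take k ts)"
  hence "t \<in> transps X" using assms in_set_takeD by fastforce
  thus "t permutes X" by (rule transps_permutes)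
qed

lemma rounds_Suc:
  assumes "set ts \<subseteq> transps X" "k < length ts"
  shows "rounds ts (Suc k) = rounds ts k \<circ> ts ! k"
proof -
  have t: "ts ! k \<in> transps X" using assms nth_mem by blast
  have b: "bij (ts ! k)" by (rule permutes_bij[OF transps_permutes[OF t]])
  have p: "prod_lr (take k ts) permutes X"
  proof (rule prod_lr_permutes)
    fix t assume "t \<in> set (take k ts)"
    hence "t \<in> transps X" using assms(1) in_set_takeD by fastforce
    thus "t permutes X" by (rule transps_permutes)
  qed
  have "prod_lr (take (Suc k) ts) = ts ! k \<circ> prod_lr (take k ts)"
    using assms(2) by (simp add: take_Suc_conv_app_nth prod_lr_append)
  hence "rounds ts (Suc k) = inv (ts ! k \<circ> prod_lr (take k ts))" by (simp only: rounds_def)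
  also have "\<dots> = inv (prod_lr (take k ts)) \<circ> inv (ts ! k)"
    by (rule o_inv_distrib[OF b permutes_bij[OF p]])
  finally show ?thesis by (simp only: rounds_def transps_inv[OF t])
qed

lemma factorizations_D:
  assumes "ts \<in> factorizations h n"
  shows "length ts = n - 1 + 2 * h" "set ts \<subseteq> transps {1..n}" "prod_lr ts = long_cycle n"
  using assms by (auto simp: factorizations_def transpositions_eq_transps)

lemma finite_factorizations: "finite (factorizations h n)"
  by (simp add: factorizations_eq_words_to finite_words_to)

lemma rounds_last:
  assumes "ts \<in> factorizations h n"
  shows "rounds ts (length ts) = inv (long_cycle n)"
  using factorizations_D[OF assms] by (simp add: rounds_def)

lemma inv_long_cycle:
  assumes "2 \<le> x" "x \<le> n"
  shows "inv (long_cycle n) x = x - 1"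
proof (rule inv_f_eq)
  show "inj (long_cycle n)" by (rule permutes_inj[OF long_cycle_permutes])
  show "long_cycle n (x - 1) = x" using assms by (subst long_cycle_apply) auto
qed

lemma transps_cases:
  assumes "t \<in> transps X"
  obtains x y where "t = swap x y" "x \<in> X" "y \<in> X" "x \<noteq> y"
  using assms by (auto simp: transps_def)

definition descents :: "perm list \<Rightarrow> nat \<Rightarrow> nat set" where
  "descents ts x = {k. k < length ts \<and> rounds ts (Suc k) x < rounds ts k x}"

lemma finite_descents [simp]: "finite (descents ts x)"
  by (rule finite_subset[of _ "{..<length ts}"]) (auto simp: descents_def)

text \<open>
  A step exchanges the rounds of two labels: one of them goes up, the other one goes down.
\<close>

lemma card_descending_labels:
  assumes ts: "set ts \<subseteq> transps X" and k: "k < length ts"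
  shows "card {x \<in> X. rounds ts (Suc k) x < rounds ts k x} = 1"
proof -
  have "ts ! k \<in> transps X" using ts nth_mem[OF k] by blast
  then obtain x y where t: "ts ! k = swap x y" "x \<in> X" "y \<in> X" "x \<noteq> y" by (rule transps_cases)
  have inj: "inj (rounds ts k)" by (rule permutes_inj[OF rounds_permutes[OF ts]])
  have ne: "rounds ts k x \<noteq> rounds ts k y" using inj t(4) by (simp add: inj_eq)
  have R: "rounds ts (Suc k) z = rounds ts k (swap x y z)" for z
    by (simp add: rounds_Suc[OF ts k] t(1))
  have "{z \<in> X. rounds ts (Suc k) z < rounds ts k z} = (if rounds ts k x < rounds ts k y then {y} else {x})"
    unfolding R using t ne by (auto simp: Transposition.transpose_def)
  thus ?thesis by simp
qed

lemma sum_card_descents: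
  assumes "set ts \<subseteq> transps X" "finite X"
  shows "(\<Sum>x\<in>X. card (descents ts x)) = length ts"
proof -
  have "(\<Sum>x\<in>X. card (descents ts x)) = (\<Sum>x\<in>X. \<Sum>k<length ts. of_bool (rounds ts (Suc k) x < rounds ts k x))"
    by (intro sum.cong refl) (simp add: descents_def sum_of_bool_eq Int_def lessThan_def conj_commute)
  also have "\<dots> = (\<Sum>k<length ts. \<Sum>x\<in>X. of_bool (rounds ts (Suc k) x < rounds ts k x))"
    by (rule sum.swap)
  also have "\<dots> = (\<Sum>k<length ts. card {x \<in> X. rounds ts (Suc k) x < rounds ts k x})"
    using assms(2) by (intro sum.cong refl) (simp add: sum_of_bool_eq Int_def)
  also have "\<dots> = (\<Sum>k<length ts. 1)"
    by (intro sum.cong refl card_descending_labels[OF assms(1)]) simp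
  finally show ?thesis by simp
qed

text \<open>
  The round of \<open>x\<close> begins at \<open>x\<close> and ends at \<open>x - 1\<close>.
\<close>

lemma descents_nonempty:
  assumes ts: "ts \<in> factorizations h n" and x: "2 \<le> x" "x \<le> n"
  shows "descents ts x \<noteq> {}"
proof
  assume "descents ts x = {}"
  hence up: "rounds ts k x \<le> rounds ts (Suc k) x" if "k < length ts" for k
    using that by (force simp: descents_def)
  have "k \<le> length ts \<longrightarrow> x \<le> rounds ts k x" for k
  proof (induction k)
    case (Suc k)
    show ?case using Suc up[of k] by auto
  qed simp
  hence "x \<le> rounds ts (length ts) x" by simp
  thus False using x by (simp add: rounds_last[OF ts] inv_long_cycle)
qed

text \<open>
  Of the \<open>n - 1 + 2 h\<close> descents, \<open>n - 1\<close> are the unavoidable ones of the labels other than 1.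
\<close>

lemma card_multiple_descents:
  assumes ts: "ts \<in> factorizations h n" and n: "n \<ge> 1"
  shows "card {x \<in> {1..n}. card (descents ts x) \<ge> 2} \<le> 2 * h"
proof -
  have "(\<Sum>x\<in>{1..n}. of_bool (x \<ge> 2) + of_bool (card (descents ts x) \<ge> 2)) \<le> (\<Sum>x\<in>{1..n}. card (descents ts x))"
  proof (rule sum_mono)
    fix x assume x: "x \<in> {1..n}"
    have "card (descents ts x) \<ge> 1" if "x \<ge> 2"
      using descents_nonempty[OF ts that] x by (simp add: Suc_le_eq card_gt_0_iff)
    thus "of_bool (x \<ge> 2) + of_bool (card (descents ts x) \<ge> 2) \<le> card (descents ts x)"
      by (cases "x \<ge> 2"; cases "card (descents ts x) \<ge> 2") auto
  qed
  also have "\<dots> = n - 1 + 2 * h"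
    using sum_card_descents[OF factorizations_D(2)[OF ts]] factorizations_D(1)[OF ts] by simp
  also have "(\<Sum>x\<in>{1..n}. of_bool (x \<ge> 2) + of_bool (card (descents ts x) \<ge> 2)) =
      card {x \<in> {1..n}. x \<ge> 2} + card {x \<in> {1..n}. card (descents ts x) \<ge> 2}"
    by (simp add: sum.distrib sum_of_bool_eq Int_def)
  also have "{x \<in> {1..n}. x \<ge> 2} = {2..n}" by auto
  finally show ?thesis using n by simp
qed

text \<open>
  The second condition says that the rounds of \<open>x\<close> go around the circle in increasing order,
  starting at \<open>x\<close>: rounds below \<open>x\<close> are raised by \<open>n\<close> because they come after the passage from \<open>n\<close> to 1.
\<close>

definition tame :: "nat \<Rightarrow> nat \<Rightarrow> perm list \<Rightarrow> nat \<Rightarrow> bool" where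
  "tame n M ts x \<longleftrightarrow>
    (\<forall>k\<le>length ts. rounds ts k x \<le> x + M \<and> x \<le> rounds ts k x + M) \<and>
    (\<forall>j k. j \<le> k \<longrightarrow> k \<le> length ts \<longrightarrow>
      (if rounds ts j x < x then rounds ts j x + n else rounds ts j x) \<le>
      (if rounds ts k x < x then rounds ts k x + n else rounds ts k x))"

lemma wide_transpose_iff:
  assumes "p < q"
  shows "wide K n (swap p q) \<longleftrightarrow> p + K < q \<and> q + K < p + n"
proof
  assume "wide K n (swap p q)"
  then obtain p' q' where *: "swap p q = swap p' q'" "p' + K < q'" "q' + K < p' + n"
    unfolding wide_def by blast
  hence "p = p' \<and> q = q'" using transpose_eq_iff_ordered[of p q p' q'] assms by simp
  thus "p + K < q \<and> q + K < p + n" using * by simp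
qed (auto simp: wide_def)

definition moves :: "perm list \<Rightarrow> nat \<Rightarrow> nat set" where
  "moves ts x = {k. k < length ts \<and> (ts ! k) x \<noteq> x}"

definition wide_steps :: "nat \<Rightarrow> nat \<Rightarrow> perm list \<Rightarrow> nat set" where
  "wide_steps K n ts = {k. k < length ts \<and> wide K n (conj_perm (rounds ts k) (ts ! k))}"

lemma finite_moves [simp]: "finite (moves ts x)" "finite (wide_steps K n ts)"
  by (rule finite_subset[of _ "{..<length ts}"], auto simp: moves_def wide_steps_def)+

text \<open>
  Before the only descent the rounds increase from \<open>x\<close>, after it they increase to \<open>x - 1\<close>. If no step at
  \<open>x\<close> is wide, each increase is at most \<open>K\<close>, as an increase by nearly \<open>n\<close> is impossible when
  \<open>x\<close> is neither among the first nor among the last labels.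
\<close>

lemma tameI:
  assumes ts: "ts \<in> factorizations h n" and x: "2 \<le> x" "K < x" "x + K \<le> n"
    and d: "card (descents ts x) \<le> 1" and D: "card (moves ts x) \<le> D"
    and nowide: "moves ts x \<inter> wide_steps K n ts = {}"
  shows "tame n (K * D + 1) ts x"
proof -
  note F = factorizations_D[OF ts]
  define m where "m = length ts"
  define l where "l k = rounds ts k x" for k
  have perm: "rounds ts k permutes {1..n}" for k by (rule rounds_permutes[OF F(2)])
  have lr: "1 \<le> l k" "l k \<le> n" for k
    using permutes_in_image[OF perm[of k], of x] x by (auto simp: l_def)
  have l0: "l 0 = x" by (simp add: l_def)
  have lm: "l m = x - 1" using x by (simp add: l_def m_def rounds_last[OF ts] inv_long_cycle)
  obtain d0 where "d0 \<in> descents ts x" using descents_nonempty[OF ts x(1)] x(3) by auto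
  moreover have "descents ts x = {d0}" if "d0 \<in> descents ts x" for d0
    using d that by (metis card_le_Suc0_iff_eq finite_descents One_nat_def insertI1 subsetI subset_singletonD singletonD equalityI empty_iff singletonI)
  ultimately have dd: "descents ts x = {d0}" by blast
  have up: "l k \<le> l (Suc k)" if "k < m" "k \<noteq> d0" for k
  proof -
    have "k \<notin> descents ts x" using dd that by simp
    thus ?thesis using that by (simp add: descents_def l_def m_def)
  qed
  have d0: "d0 < m" using dd by (auto simp: descents_def m_def)
  have mono1: "l j \<le> l k" if "j \<le> k" "k \<le> d0" for j k
    using that
  proof (induction k)
    case (Suc k)
    show ?case
    proof (cases "j = Suc k")
      case False
      hence "l j \<le> l k" using Suc by simp
      also have "\<dots> \<le> l (Suc k)" using Suc.prems d0 by (intro up) auto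
      finally show ?thesis .
    qed simp
  qed simp
  have mono2: "l j \<le> l k" if "j \<le> k" "d0 < j" "k \<le> m" for j k
    using that
  proof (induction k)
    case (Suc k)
    show ?case
    proof (cases "j = Suc k")
      case False
      hence "l j \<le> l k" using Suc by simp
      also have "\<dots> \<le> l (Suc k)" using Suc.prems False by (intro up) auto
      finally show ?thesis .
    qed simp
  qed simp
  have low: "x \<le> l k" if "k \<le> d0" for k using mono1[of 0 k] that l0 by simp
  have high: "l k \<le> x - 1" if "d0 < k" "k \<le> m" for k using mono2[of k m] that lm by simp
  have step: "l (Suc k) \<le> l k + K" if k: "k < m" "k \<in> moves ts x" "l k \<le> l (Suc k)" and b: "l (Suc k) + K < l k + n" for k
  proof -
    have "ts ! k \<in> transps {1..n}" using F(2) nth_mem[of k ts] k by (auto simp: m_def)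
    then obtain u w where t: "ts ! k = swap u w" "u \<noteq> w" by (rule transps_cases)
    have "(ts ! k) x \<noteq> x" using k by (simp add: moves_def)
    then obtain y where y: "ts ! k = swap x y"
      using t by (auto simp: Transposition.transpose_def transpose_commute split: if_splits)
    have "l (Suc k) = rounds ts k y" using k by (simp add: l_def rounds_Suc[OF F(2)] y m_def)
    hence c: "conj_perm (rounds ts k) (ts ! k) = swap (l k) (l (Suc k))"
      unfolding y by (simp add: conj_perm_transpose[OF permutes_bij[OF perm]] l_def)
    have "\<not> wide K n (conj_perm (rounds ts k) (ts ! k))"
      using nowide k by (auto simp: wide_steps_def m_def)
    hence "\<not> (l k + K < l (Suc k) \<and> l (Suc k) + K < l k + n)"
      unfolding c using wide_transpose_iff[of "l k" "l (Suc k)"] by (cases "l k < l (Suc k)") auto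
    thus ?thesis using b by auto
  qed
  have stay: "l (Suc k) = l k" if "k < m" "k \<notin> moves ts x" for k
    using that by (simp add: l_def rounds_Suc[OF F(2)] moves_def m_def)
  have A: "l k \<le> x + K * card (moves ts x \<inter> {..<k})" if "k \<le> d0" for k
    using that
  proof (induction k)
    case (Suc k)
    hence km: "k < m" using d0 by simp
    show ?case
    proof (cases "k \<in> moves ts x")
      case True
      have "moves ts x \<inter> {..<Suc k} = insert k (moves ts x \<inter> {..<k})" using True by auto
      hence c: "card (moves ts x \<inter> {..<Suc k}) = Suc (card (moves ts x \<inter> {..<k}))" by simp
      have "l (Suc k) \<le> l k + K"
        by (rule step[OF km True up]) (use km Suc.prems low[of k] lr(2)[of "Suc k"] x in auto)
      thus ?thesis using Suc c by simp
    next
      case False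
      hence "moves ts x \<inter> {..<Suc k} = moves ts x \<inter> {..<k}" by (auto simp: less_Suc_eq)
      thus ?thesis using Suc stay[OF km False] by simp
    qed
  qed (simp add: l0)
  have B: "x - 1 \<le> l (m - k) + K * card (moves ts x \<inter> {m - k..<m})" if "d0 < m - k" "k \<le> m" for k
    using that
  proof (induction k)
    case (Suc k)
    \<comment> \<open>the induction runs backwards in time, from the last round \<open>x - 1\<close>\<close>
    define j where "j = m - Suc k"
    have j: "m - k = Suc j" "j < m" "d0 < j" using Suc.prems by (auto simp: j_def)
    have IH: "x - 1 \<le> l (Suc j) + K * card (moves ts x \<inter> {Suc j..<m})" using Suc j by simp
    have "x - 1 \<le> l j + K * card (moves ts x \<inter> {j..<m})"
    proof (cases "j \<in> moves ts x")
      case True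
      have "moves ts x \<inter> {j..<m} = insert j (moves ts x \<inter> {Suc j..<m})" using True j by auto
      hence c: "card (moves ts x \<inter> {j..<m}) = Suc (card (moves ts x \<inter> {Suc j..<m}))" by simp
      have "l (Suc j) \<le> l j + K"
        by (rule step[OF j(2) True up]) (use j high[of "Suc j"] lr(1)[of j] x in auto)
      thus ?thesis using IH c by simp
    next
      case False
      hence "moves ts x \<inter> {j..<m} = moves ts x \<inter> {Suc j..<m}"
        by (auto simp: Suc_le_eq) (metis le_neq_implies_less)
      thus ?thesis using IH stay[OF j(2) False] by simp
    qed
    thus ?case by (simp add: j_def)
  qed (simp add: lm)
  have cD: "K * card (moves ts x \<inter> S) \<le> K * D" for S
    using D card_mono[of "moves ts x" "moves ts x \<inter> S"] by (intro mult_left_mono) auto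
  have near: "l k \<le> x + (K * D + 1) \<and> x \<le> l k + (K * D + 1)" if k: "k \<le> m" for k
  proof (cases "k \<le> d0")
    case True
    thus ?thesis using A[OF True] low[OF True] cD[of "{..<k}"] by linarith
  next
    case False
    have "m - (m - k) = k" using k by simp
    hence "x - 1 \<le> l k + K * card (moves ts x \<inter> {k..<m})" using B[of "m - k"] False k by simp
    thus ?thesis using high[of k] False cD[of "{k..<m}"] k by linarith
  qed
  have key: "(if l j < x then l j + n else l j) \<le> (if l k < x then l k + n else l k)"
    if jk: "j \<le> k" "k \<le> m" for j k
  proof -
    consider "k \<le> d0" | "j \<le> d0" "d0 < k" | "d0 < j" using jk by linarith
    thus ?thesis
    proof cases
      case 1
      thus ?thesis using mono1[of j k] low[of j] low[of k] jk by auto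
    next
      case 2
      thus ?thesis using low[of j] high[of k] jk lr[of j] lr[of k] x by auto
    next
      case 3
      thus ?thesis using mono2[of j k] high[of j] high[of k] jk x by auto
    qed
  qed
  have "(\<forall>k\<le>m. l k \<le> x + (K * D + 1) \<and> x \<le> l k + (K * D + 1)) \<and>
    (\<forall>j k. j \<le> k \<longrightarrow> k \<le> m \<longrightarrow> (if l j < x then l j + n else l j) \<le> (if l k < x then l k + n else l k))"
    using near key by (intro conjI allI impI) simp_all
  thus ?thesis unfolding tame_def l_def m_def .
qed

lemma card_moved_labels:
  assumes "t \<in> transps X"
  shows "card {x \<in> X. t x \<noteq> x} = 2"
proof -
  obtain x y where t: "t = swap x y" "x \<in> X" "y \<in> X" "x \<noteq> y" using assms by (rule transps_cases)
  have "{z \<in> X. t z \<noteq> z} = {x, y}" using t by (auto simp: Transposition.transpose_def)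
  thus ?thesis using t by simp
qed

lemma sum_card_moves:
  assumes "set ts \<subseteq> transps X" "finite X"
  shows "(\<Sum>x\<in>X. card (moves ts x \<inter> S)) = 2 * card ({..<length ts} \<inter> S)"
proof -
  have "(\<Sum>x\<in>X. card (moves ts x \<inter> S)) = (\<Sum>x\<in>X. \<Sum>k\<in>{..<length ts} \<inter> S. of_bool ((ts ! k) x \<noteq> x))"
  proof (intro sum.cong refl)
    fix x
    have "moves ts x \<inter> S = ({..<length ts} \<inter> S) \<inter> {k. (ts ! k) x \<noteq> x}" by (auto simp: moves_def)
    thus "card (moves ts x \<inter> S) = (\<Sum>k\<in>{..<length ts} \<inter> S. of_bool ((ts ! k) x \<noteq> x))"
      by (subst sum_of_bool_eq) auto
  qed
  also have "\<dots> = (\<Sum>k\<in>{..<length ts} \<inter> S. \<Sum>x\<in>X. of_bool ((ts ! k) x \<noteq> x))"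
    by (rule sum.swap)
  also have "\<dots> = (\<Sum>k\<in>{..<length ts} \<inter> S. card {x \<in> X. (ts ! k) x \<noteq> x})"
    using assms(2) by (intro sum.cong refl) (simp add: sum_of_bool_eq Int_def)
  also have "\<dots> = (\<Sum>k\<in>{..<length ts} \<inter> S. 2)"
    by (intro sum.cong refl card_moved_labels) (use assms(1) nth_mem in force)
  finally show ?thesis by simp
qed

lemma card_filter_le_sum:
  fixes f :: "nat \<Rightarrow> nat"
  assumes "finite X"
  shows "c * card {x \<in> X. c \<le> f x} \<le> sum f X"
proof -
  have "c * card {x \<in> X. c \<le> f x} = (\<Sum>x\<in>{x \<in> X. c \<le> f x}. c)" by simp
  also have "\<dots> \<le> (\<Sum>x\<in>{x \<in> X. c \<le> f x}. f x)" by (rule sum_mono) simp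
  also have "\<dots> \<le> sum f X" using assms by (intro sum_mono2) auto
  finally show ?thesis .
qed

text \<open>
  A label that is not tame is close to 1 or to \<open>n\<close>, has two descents, is moved by many
  steps, or is moved by a wide one. The number of labels of each kind is bounded separately;
  the average number of steps that move a label is bounded.
\<close>

lemma card_not_tame:
  assumes ts: "ts \<in> factorizations h n" and n: "n \<ge> 1"
  shows "real (card {x \<in> {1..n}. \<not> tame n (K * D + 1) ts x}) \<le>
    2 * real K + 1 + 2 * real h + 2 * real (n - 1 + 2 * h) / real (Suc D) + 2 * real (card (wide_steps K n ts))"
proof -
  note F = factorizations_D[OF ts]
  define S1 where "S1 = {x \<in> {1..n}. x \<le> Suc K}"
  define S2 where "S2 = {x \<in> {1..n}. n < x + K}"
  define S3 where "S3 = {x \<in> {1..n}. card (descents ts x) \<ge> 2}"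
  define S4 where "S4 = {x \<in> {1..n}. Suc D \<le> card (moves ts x)}"
  define S5 where "S5 = {x \<in> {1..n}. 1 \<le> card (moves ts x \<inter> wide_steps K n ts)}"
  have "{x \<in> {1..n}. \<not> tame n (K * D + 1) ts x} \<subseteq> S1 \<union> S2 \<union> S3 \<union> S4 \<union> S5"
  proof (rule subsetI, rule ccontr)
    fix x assume "x \<in> {x \<in> {1..n}. \<not> tame n (K * D + 1) ts x}" and not: "x \<notin> S1 \<union> S2 \<union> S3 \<union> S4 \<union> S5"
    hence x: "x \<in> {1..n}" "\<not> tame n (K * D + 1) ts x" by auto
    have "\<not> 1 \<le> card (moves ts x \<inter> wide_steps K n ts)" using not x unfolding S5_def by blast
    hence "card (moves ts x \<inter> wide_steps K n ts) = 0" by linarith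
    hence "moves ts x \<inter> wide_steps K n ts = {}" by (subst (asm) card_0_eq) simp_all
    hence "tame n (K * D + 1) ts x"
      by (intro tameI[OF ts]) (use not x in \<open>simp_all add: S1_def S2_def S3_def S4_def\<close>)
    thus False using x by simp
  qed
  hence "card {x \<in> {1..n}. \<not> tame n (K * D + 1) ts x} \<le> card (S1 \<union> S2 \<union> S3 \<union> S4 \<union> S5)"
    by (intro card_mono) (auto simp: S1_def S2_def S3_def S4_def S5_def)
  also have "\<dots> \<le> card S1 + card S2 + card S3 + card S4 + card S5"
    by (meson card_Un_le add_mono order_refl order_trans)
  finally have *: "card {x \<in> {1..n}. \<not> tame n (K * D + 1) ts x} \<le> card S1 + card S2 + card S3 + card S4 + card S5" .
  have "card S1 \<le> card {1..Suc K}" by (rule card_mono) (auto simp: S1_def)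
  hence 1: "card S1 \<le> Suc K" by simp
  have "card S2 \<le> card {Suc n - K..n}" by (rule card_mono) (auto simp: S2_def)
  hence 2: "card S2 \<le> K" by simp
  have 3: "card S3 \<le> 2 * h" unfolding S3_def by (rule card_multiple_descents[OF ts n])
  have "Suc D * card S4 \<le> (\<Sum>x\<in>{1..n}. card (moves ts x))"
    unfolding S4_def by (rule card_filter_le_sum) simp
  also have "\<dots> = 2 * (n - 1 + 2 * h)"
    using sum_card_moves[OF F(2), of UNIV] F(1) by simp
  finally have "real (Suc D * card S4) \<le> real (2 * (n - 1 + 2 * h))" by (rule of_nat_mono)
  hence "real (card S4) * real (Suc D) \<le> 2 * real (n - 1 + 2 * h)"
    by (simp only: of_nat_mult mult_ac of_nat_numeral)
  hence 4: "real (card S4) \<le> 2 * real (n - 1 + 2 * h) / real (Suc D)"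
    by (subst pos_le_divide_eq) simp_all
  have "1 * card S5 \<le> (\<Sum>x\<in>{1..n}. card (moves ts x \<inter> wide_steps K n ts))"
    unfolding S5_def by (rule card_filter_le_sum) simp
  also have "\<dots> = 2 * card ({..<length ts} \<inter> wide_steps K n ts)" by (rule sum_card_moves[OF F(2)]) simp
  also have "{..<length ts} \<inter> wide_steps K n ts = wide_steps K n ts" by (auto simp: wide_steps_def)
  finally have 5: "card S5 \<le> 2 * card (wide_steps K n ts)" by simp
  have "real (card {x \<in> {1..n}. \<not> tame n (K * D + 1) ts x}) \<le>
      real (card S1) + real (card S2) + real (card S3) + real (card S4) + real (card S5)"
    using of_nat_mono[OF *, where 'a = real] by simp
  also have "\<dots> \<le> (real K + 1) + real K + 2 * real h + 2 * real (n - 1 + 2 * h) / real (Suc D) + 2 * real (card (wide_steps K n ts))"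
    using of_nat_mono[OF 1, where 'a = real] of_nat_mono[OF 2, where 'a = real]
      of_nat_mono[OF 3, where 'a = real] 4 of_nat_mono[OF 5, where 'a = real]
    by (intro add_mono) auto
  finally show ?thesis by simp
qed

lemma sum_card_wide_steps:
  "(\<Sum>ts\<in>factorizations h n. real (card (wide_steps K n ts))) \<le>
    real (n - 1 + 2 * h) * real (card {ts \<in> factorizations h n. wide K n (hd ts)})"
proof -
  let ?F = "factorizations h n"
  have "(\<Sum>ts\<in>?F. card (wide_steps K n ts)) =
      (\<Sum>ts\<in>?F. \<Sum>k<n - 1 + 2 * h. of_bool (wide K n (conj_perm (rounds ts k) (ts ! k))))"
  proof (intro sum.cong refl)
    fix ts assume "ts \<in> ?F"
    hence "wide_steps K n ts = {..<n - 1 + 2 * h} \<inter> {k. wide K n (conj_perm (rounds ts k) (ts ! k))}"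
      using factorizations_D(1)[of ts h n] by (auto simp: wide_steps_def)
    thus "card (wide_steps K n ts) = (\<Sum>k<n - 1 + 2 * h. of_bool (wide K n (conj_perm (rounds ts k) (ts ! k))))"
      by (subst sum_of_bool_eq) auto
  qed
  also have "\<dots> = (\<Sum>k<n - 1 + 2 * h. \<Sum>ts\<in>?F. of_bool (wide K n (conj_perm (rounds ts k) (ts ! k))))"
    by (rule sum.swap)
  also have "\<dots> = (\<Sum>k<n - 1 + 2 * h. card {ts \<in> ?F. wide K n (conj_perm (rounds ts k) (ts ! k))})"
    by (intro sum.cong refl) (simp add: sum_of_bool_eq finite_factorizations Int_def)
  also have "\<dots> \<le> (\<Sum>k<n - 1 + 2 * h. card {ts \<in> ?F. wide K n (hd ts)})"
    by (rule sum_mono, rule card_wide_nth) simp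
  finally have "(\<Sum>ts\<in>?F. card (wide_steps K n ts)) \<le> (n - 1 + 2 * h) * card {ts \<in> ?F. wide K n (hd ts)}" by simp
  hence "real (\<Sum>ts\<in>?F. card (wide_steps K n ts)) \<le> real ((n - 1 + 2 * h) * card {ts \<in> ?F. wide K n (hd ts)})"
    by (rule of_nat_mono)
  thus ?thesis by simp
qed

lemma few_not_tame:
  assumes "\<epsilon> > 0"
  obtains M where "\<forall>\<^sub>F n in sequentially.
    (\<Sum>ts\<in>factorizations h n. real (card {x \<in> {1..n}. \<not> tame n M ts x})) \<le> \<epsilon> * real n * hurwitz h n"
proof -
  have "\<epsilon> / 12 > 0" using assms by simp
  then obtain K where K: "\<forall>\<^sub>F n in sequentially. real (card {ts \<in> factorizations h n. wide K n (hd ts)}) \<le> \<epsilon> / 12 * hurwitz h n"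
    by (rule few_wide_first_steps)
  \<comment> \<open>each of the three sources of error accounts for \<open>\<epsilon> / 3\<close>; a word has at most \<open>2 n\<close> letters\<close>
  obtain D :: nat where D: "real D > 12 / \<epsilon>" using reals_Archimedean2 by blast
  have D': "4 / real (Suc D) \<le> \<epsilon> / 3"
  proof -
    have "12 < \<epsilon> * real (Suc D)" using D assms by (simp add: field_simps)
    thus ?thesis by (simp add: field_simps)
  qed
  define C where "C = 2 * real K + 1 + 2 * real h"
  obtain n0 :: nat where n0: "real n0 > 3 * C / \<epsilon>" using reals_Archimedean2 by blast
  have "\<forall>\<^sub>F n in sequentially. (\<Sum>ts\<in>factorizations h n. real (card {x \<in> {1..n}. \<not> tame n (K * D + 1) ts x})) \<le> \<epsilon> * real n * hurwitz h n"
    using K eventually_ge_at_top[of n0] eventually_ge_at_top[of "2 * h + 1"]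
  proof eventually_elim
    case (elim n)
    let ?F = "factorizations h n" and ?m = "n - 1 + 2 * h"
    let ?N = "real (card {ts \<in> ?F. wide K n (hd ts)})"
    have m: "real ?m \<le> 2 * real n" using elim(3) by linarith
    have Cn: "C \<le> \<epsilon> / 3 * real n"
    proof -
      have "3 * C / \<epsilon> \<le> real n" using n0 elim(2) by linarith
      thus ?thesis using assms by (simp add: field_simps)
    qed
    have np: "hurwitz h n \<ge> 0" by (simp add: hurwitz_def)
    have "(\<Sum>ts\<in>?F. real (card {x \<in> {1..n}. \<not> tame n (K * D + 1) ts x})) \<le>
        (\<Sum>ts\<in>?F. C + 2 * real ?m / real (Suc D) + 2 * real (card (wide_steps K n ts)))"
      unfolding C_def by (intro sum_mono card_not_tame) (use elim in auto)
    also have "\<dots> = hurwitz h n * (C + 2 * real ?m / real (Suc D)) + 2 * (\<Sum>ts\<in>?F. real (card (wide_steps K n ts)))"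
      by (simp add: sum.distrib sum_distrib_left hurwitz_def algebra_simps)
    also have "\<dots> \<le> hurwitz h n * (\<epsilon> / 3 * real n + \<epsilon> / 3 * real n) + 2 * (\<epsilon> / 6 * real n * hurwitz h n)"
    proof (intro add_mono mult_left_mono np Cn)
      have "2 * real ?m / real (Suc D) \<le> 2 * (2 * real n) / real (Suc D)"
        using m by (intro divide_right_mono mult_left_mono) auto
      also have "\<dots> = (4 / real (Suc D)) * real n" by simp
      also have "\<dots> \<le> \<epsilon> / 3 * real n" using D' by (intro mult_right_mono) auto
      finally show "2 * real ?m / real (Suc D) \<le> \<epsilon> / 3 * real n" .
      have "(\<Sum>ts\<in>?F. real (card (wide_steps K n ts))) \<le> real ?m * ?N" by (rule sum_card_wide_steps)
      also have "\<dots> \<le> (2 * real n) * (\<epsilon> / 12 * hurwitz h n)" using m elim(1) by (intro mult_mono) auto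
      finally show "(\<Sum>ts\<in>?F. real (card (wide_steps K n ts))) \<le> \<epsilon> / 6 * real n * hurwitz h n" by simp
    qed simp
    also have "\<dots> = \<epsilon> * real n * hurwitz h n" by (simp add: algebra_simps)
    finally show ?case .
  qed
  thus ?thesis by (rule that)
qed

section \<open>The sequence of rounds after an insertion\<close>

text \<open>
  The trace that an insertion leaves in the sequence \<open>p\<close> of rounds of the label \<open>a\<close>: \<open>D\<close> is the
  highest descent, \<open>J\<close> is the only step that jumps upwards over the round reached by this descent, and there is
  a second descent.
\<close>

definition peak_pair :: "(nat \<Rightarrow> nat) \<Rightarrow> nat \<Rightarrow> nat \<Rightarrow> nat \<Rightarrow> bool" where
  "peak_pair p N D J \<longleftrightarrow> D < N \<and> J < N \<and> p (Suc D) < p D \<and>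
     (\<forall>k<N. k \<noteq> D \<longrightarrow> p (Suc k) < p k \<longrightarrow> p k < p D) \<and>
     (\<forall>k<N. p k < p (Suc D) \<and> p (Suc D) < p (Suc k) \<longleftrightarrow> k = J) \<and>
     (\<exists>k<N. k \<noteq> D \<and> p (Suc k) < p k)"

lemma peak_pair_unique:
  assumes "peak_pair p N D J" "peak_pair p N D' J'"
  shows "D = D' \<and> J = J'"
proof -
  have D: "D = D'"
  proof (rule ccontr)
    assume "D \<noteq> D'"
    hence "p D' < p D" "p D < p D'" using assms unfolding peak_pair_def by blast+
    thus False by simp
  qed
  have "J < N" using assms(1) by (simp add: peak_pair_def)
  have "p J < p (Suc D) \<and> p (Suc D) < p (Suc J)" using assms(1) \<open>J < N\<close> unfolding peak_pair_def by blast
  hence "J = J'" using assms(2) \<open>J < N\<close> unfolding peak_pair_def D by blast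
  thus ?thesis using D by simp
qed

text \<open>
  The relabelling after an insertion: the positions of the labels on the new long cycle, on which the
  blocks follow each other in the order
  \<open>1..\<alpha>\<close>, \<open>b+1..c\<close>, \<open>\<beta>+1..b\<close>, \<open>\<alpha>+1..\<beta>\<close>, \<open>c+1..n\<close>.
\<close>

definition block_swap :: "nat \<Rightarrow> nat \<Rightarrow> nat \<Rightarrow> nat \<Rightarrow> perm" where
  "block_swap \<alpha> \<beta> b c r =
    (if r \<le> \<alpha> then r
     else if r \<le> \<beta> then c - \<beta> + r
     else if r \<le> b then \<alpha> + (c - b) + (r - \<beta>)
     else if r \<le> c then \<alpha> + (r - b)
     else r)"

lemma block_swap_permutes:
  assumes "\<alpha> \<le> \<beta>" "\<beta> < b" "b < c" "c \<le> n" "1 \<le> \<alpha>"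
  shows "block_swap \<alpha> \<beta> b c permutes {1..n}"
proof (rule bij_imp_permutes)
  have inj: "inj_on (block_swap \<alpha> \<beta> b c) {1..n}"
  proof (rule inj_onI)
    fix r r' assume "block_swap \<alpha> \<beta> b c r = block_swap \<alpha> \<beta> b c r'"
    thus "r = r'" using assms unfolding block_swap_def by (simp split: if_splits)
  qed
  have "block_swap \<alpha> \<beta> b c r \<in> {1..n}" if "r \<in> {1..n}" for r
  proof -
    consider "r \<le> \<alpha>" | "\<alpha> < r" "r \<le> \<beta>" | "\<beta> < r" "r \<le> b" | "b < r" "r \<le> c" | "c < r" by linarith
    thus ?thesis using that assms by cases (auto simp: block_swap_def)
  qed
  hence "block_swap \<alpha> \<beta> b c ` {1..n} \<subseteq> {1..n}" by (rule image_subsetI)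
  thus "bij_betw (block_swap \<alpha> \<beta> b c) {1..n} {1..n}"
    using inj endo_inj_surj[of "{1..n}" "block_swap \<alpha> \<beta> b c"] by (simp add: bij_betw_def)
  fix r assume "r \<notin> {1..n}"
  thus "block_swap \<alpha> \<beta> b c r = r" using assms by (auto simp: block_swap_def)
qed

text \<open>
  Of two chords that cross, or that share their first endpoint in the right order, the first cuts
  the long cycle into two cycles and the second joins them again, with the blocks in another order.
\<close>

lemma block_swap_relabels:
  assumes o: "\<alpha> \<le> \<beta>" "\<beta> < b" "b < c" "c \<le> n" "1 \<le> \<alpha>"
  defines "\<zeta> \<equiv> long_cycle n \<circ> swap \<beta> c \<circ> swap \<alpha> b"
  shows "relabels n (block_swap \<alpha> \<beta> b c) \<zeta>"
proof -
  let ?\<sigma> = "block_swap \<alpha> \<beta> b c"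
  have perm: "?\<sigma> permutes {1..n}" by (rule block_swap_permutes[OF o])
  have lc: "long_cycle n r = (if r = n then 1 else Suc r)" if "1 \<le> r" "r \<le> n" for r
    by (rule long_cycle_apply[OF that])
  have z\<alpha>: "\<zeta> \<alpha> = Suc b" using o lc[of b] by (simp add: \<zeta>_def)
  have zb: "\<zeta> b = (if \<alpha> = \<beta> then (if c = n then 1 else Suc c) else Suc \<alpha>)"
    using o lc[of c] lc[of \<alpha>] by (simp add: \<zeta>_def)
  have z\<beta>: "\<zeta> \<beta> = (if c = n then 1 else Suc c)" if "\<alpha> \<noteq> \<beta>"
    using o that lc[of c] by (simp add: \<zeta>_def)
  have zc: "\<zeta> c = Suc \<beta>" using o lc[of \<beta>] by (simp add: \<zeta>_def)
  have zo: "\<zeta> r = (if r = n then 1 else Suc r)" if "1 \<le> r" "r \<le> n" "r \<notin> {\<alpha>, \<beta>, b, c}" for r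
    using that lc[of r] by (simp add: \<zeta>_def)
  have s1: "?\<sigma> 1 = 1" using o by (simp add: block_swap_def)
  have eq: "?\<sigma> (\<zeta> r) = long_cycle n (?\<sigma> r)" for r
  proof (cases "r \<in> {1..n}")
    case False
    hence r: "long_cycle n r = r" "?\<sigma> r = r" "r \<noteq> \<alpha>" "r \<noteq> \<beta>" "r \<noteq> b" "r \<noteq> c"
      using permutes_not_in[OF perm False] permutes_not_in[OF long_cycle_permutes False] False o by auto
    thus ?thesis by (simp add: \<zeta>_def)
  next
    case True
    have "?\<sigma> r \<in> {1..n}" using permutes_in_image[OF perm] True by simp
    hence L: "long_cycle n (?\<sigma> r) = (if ?\<sigma> r = n then 1 else Suc (?\<sigma> r))" by (intro lc) auto
    consider "r = \<alpha>" | "r = \<beta>" "\<alpha> \<noteq> \<beta>" | "r = b" | "r = c" | "r \<notin> {\<alpha>, \<beta>, b, c}" by blast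
    thus ?thesis
    proof cases
      case 1
      thus ?thesis unfolding L unfolding 1 z\<alpha> using o by (simp add: block_swap_def)
    next
      case 2
      thus ?thesis unfolding L unfolding 2(1) z\<beta>[OF 2(2)] using o by (simp add: block_swap_def)
    next
      case 3
      thus ?thesis unfolding L unfolding 3 zb
        using o by (cases "\<alpha> = \<beta>"; cases "c = n") (auto simp: block_swap_def)
    next
      case 4
      thus ?thesis unfolding L unfolding 4 zc using o by (simp add: block_swap_def)
    next
      case 5
      have z: "\<zeta> r = (if r = n then 1 else Suc r)" using zo[of r] True 5 by simp
      have ne: "r \<noteq> \<alpha>" "r \<noteq> \<beta>" "r \<noteq> b" "r \<noteq> c" "1 \<le> r" "r \<le> n" using 5 True by auto
      consider "r < \<alpha>" | "\<alpha> < r" "r < \<beta>" | "\<beta> < r" "r < b" | "b < r" "r < c" | "c < r" using ne by linarith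
      thus ?thesis unfolding L unfolding z using o ne by cases (auto simp: block_swap_def)
    qed
  qed
  have "?\<sigma> \<circ> \<zeta> = long_cycle n \<circ> ?\<sigma>"
    by (rule ext) (simp only: comp_apply eq)
  hence "conj_perm ?\<sigma> \<zeta> = long_cycle n \<circ> (?\<sigma> \<circ> inv ?\<sigma>)"
    by (simp only: conj_perm_def comp_assoc[symmetric])
  also have "?\<sigma> \<circ> inv ?\<sigma> = id" by (rule permutes_inv_o(1)[OF perm])
  finally show ?thesis using perm s1 by (simp add: relabels_def)
qed

text \<open>
  For nested chords the labels outside the outer chord form an invariant set. This is why the other
  order of the two transpositions is chosen.
\<close>

lemma not_full_cycle:
  assumes o: "\<alpha> \<le> \<beta>" "\<beta> < b" "b < c" "c \<le> n" "1 \<le> \<alpha>"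
  shows "\<not> full_cycle_on {1..n} (long_cycle n \<circ> swap \<beta> b \<circ> swap \<alpha> c)"
proof
  let ?\<zeta> = "long_cycle n \<circ> swap \<beta> b \<circ> swap \<alpha> c"
  let ?B = "{r. 1 \<le> r \<and> r \<le> \<alpha>} \<union> {r. c < r \<and> r \<le> n}"
  assume full: "full_cycle_on {1..n} ?\<zeta>"
  have "?\<zeta> ` ?B \<subseteq> ?B"
  proof (rule image_subsetI)
    fix r assume r: "r \<in> ?B"
    show "?\<zeta> r \<in> ?B"
    proof (cases "r = \<alpha>")
      case True
      thus ?thesis using o long_cycle_apply[of c n] by auto
    next
      case False
      hence "r \<noteq> c" "r \<noteq> \<beta>" "r \<noteq> b" "1 \<le> r" "r \<le> n" using r o by auto
      thus ?thesis using False r o long_cycle_apply[of r n] by auto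
    qed
  qed
  moreover have "?B \<subseteq> {1..n}" "?B \<noteq> {}" using o by auto
  ultimately have "?B = {1..n}" using full unfolding full_cycle_on_def by blast
  moreover have "b \<in> {1..n}" "b \<notin> ?B" using o by auto
  ultimately show False by blast
qed

lemma relabels_imp_full_cycle:
  assumes "relabels n \<sigma> \<zeta>"
  shows "full_cycle_on {1..n} \<zeta>"
proof -
  have \<sigma>: "\<sigma> permutes {1..n}" "conj_perm \<sigma> \<zeta> = long_cycle n" using assms by (simp_all add: relabels_def)
  have b: "bij \<sigma>" by (rule permutes_bij[OF \<sigma>(1)])
  have "conj_perm (inv \<sigma>) (conj_perm \<sigma> \<zeta>) = \<zeta>" using map_conj_inverse(1)[OF b, of "[\<zeta>]"] by simp
  moreover have "full_cycle_on (inv \<sigma> ` {1..n}) (conj_perm (inv \<sigma>) (long_cycle n))"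
    by (rule full_cycle_on_conj[OF bij_imp_bij_inv[OF b] full_cycle_on_long_cycle]) simp
  ultimately show ?thesis using \<sigma>(2) permutes_image[OF permutes_inv[OF \<sigma>(1)]] by simp
qed

lemma relabelling_eq:
  assumes "relabels n \<sigma> \<zeta>"
  shows "relabelling n \<zeta> = \<sigma>"
proof -
  have *: "\<tau> permutes {1..n} \<and> \<tau> 1 = 1 \<and> prod_lr [inv \<tau>, \<zeta>, \<tau>] = long_cycle n \<longleftrightarrow> relabels n \<tau> \<zeta>" for \<tau>
    by (simp add: relabels_def conj_perm_def comp_assoc)
  show ?thesis unfolding relabelling_def *
  proof (rule the_equality)
    show "relabels n \<sigma> \<zeta>" by (rule assms)
    fix \<tau> assume "relabels n \<tau> \<zeta>"
    thus "\<tau> = \<sigma>" using assms by (rule relabels_unique)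
  qed
qed

lemma step_ii_eq:
  assumes "relabels n \<sigma> (prod_lr us)"
  shows "step_ii n us = map (conj_perm \<sigma>) us"
  by (simp add: step_ii_def relabelling_eq[OF assms] conj_perm_def comp_assoc)

text \<open>
  The increasing order of the rounds around the circle, as a case distinction on whether the passage
  from \<open>n\<close> to 1 happens in between.
\<close>

lemma label_order:
  fixes l :: "nat \<Rightarrow> nat"
  assumes key: "\<And>j k. j \<le> k \<Longrightarrow> k \<le> m \<Longrightarrow> (if l j < a then l j + n else l j) \<le> (if l k < a then l k + n else l k)"
    and range: "\<And>k. k \<le> m \<Longrightarrow> 1 \<le> l k \<and> l k \<le> n"
    and jk: "j \<le> k" "k \<le> m"
  shows "a \<le> l j \<and> l k < a \<or> l j \<le> l k \<and> (a \<le> l j \<longleftrightarrow> a \<le> l k)"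
  using key[OF jk] range[of j] range[of k] jk by (auto split: if_splits)

lemma wrap_step:
  fixes l :: "nat \<Rightarrow> nat"
  assumes "a \<le> l 0" "l m < a"
  obtains q where "q < m" "a \<le> l q" "l (Suc q) < a"
proof -
  have "\<exists>q<m. a \<le> l q \<and> l (Suc q) < a"
    using assms(2)
  proof (induction m)
    case 0
    thus ?case using assms(1) by simp
  next
    case (Suc m)
    show ?case
    proof (cases "l m < a")
      case True
      then obtain q where "q < m" "a \<le> l q" "l (Suc q) < a" using Suc.IH by blast
      thus ?thesis by (intro exI[of _ q]) simp
    next
      case False
      thus ?thesis using Suc.prems by (intro exI[of _ m]) simp
    qed
  qed
  thus ?thesis using that by blast
qed

text \<open>
  The case in which the rounds of \<open>a\<close> do not pass from \<open>n\<close> to 1 between the two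
  insertions. In the new order, the first insertion lifts the label \<open>a\<close> from the first block to the
  end of the third, over the end \<open>\<alpha> + (c - b)\<close> of the second block; the second insertion lets it fall from
  position \<open>c\<close> to exactly this end. No other step goes down, except for the one that passes from \<open>n\<close> to 1,
  which leads back into the first block.
\<close>

lemma peak_pair_ascending:
  fixes l p :: "nat \<Rightarrow> nat"
  assumes ij: "i \<le> j" "j \<le> m"
    and key: "\<And>j k. j \<le> k \<Longrightarrow> k \<le> m \<Longrightarrow> (if l j < a then l j + n else l j) \<le> (if l k < a then l k + n else l k)"
    and range: "\<And>k. k \<le> m \<Longrightarrow> 1 \<le> l k \<and> l k \<le> n"
    and ends: "a \<le> l 0" "l m < a"
    and b: "\<And>k. k \<le> m \<Longrightarrow> l k < b" and bc: "b < c" and asc: "l i \<le> l j"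
    and p1: "\<And>k. k \<le> i \<Longrightarrow> p k = block_swap (l i) (l j) b c (l k)"
    and p2: "\<And>k. i \<le> k \<Longrightarrow> k \<le> j \<Longrightarrow> p (Suc k) = block_swap (l i) (l j) b c (swap (l i) b (l k))"
    and p3: "\<And>k. j \<le> k \<Longrightarrow> k \<le> m \<Longrightarrow> p (Suc (Suc k)) =
      block_swap (l i) (l j) b c (swap (l i) b (swap (l j) c (l k)))"
  shows "peak_pair p (m + 2) (Suc j) i"
proof -
  define \<alpha> where "\<alpha> = l i"
  define \<beta> where "\<beta> = l j"
  have ord: "a \<le> l j' \<and> l k < a \<or> l j' \<le> l k \<and> (a \<le> l j' \<longleftrightarrow> a \<le> l k)" if "j' \<le> k" "k \<le> m" for j' k
    using label_order[of m l a n, OF key range that] .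
  have o: "1 \<le> \<alpha>" "\<alpha> \<le> \<beta>" "\<beta> < b" "b < c" "\<beta> < c" "\<alpha> < b" "\<alpha> < c"
    using asc b[of j] bc range[of i] ij by (auto simp: \<alpha>_def \<beta>_def)
  have side: "a \<le> \<alpha> \<longleftrightarrow> a \<le> \<beta>" using ord[of i j] ij o by (auto simp: \<alpha>_def \<beta>_def)
  have v1: "p k = (if l k \<le> \<alpha> then l k else if l k \<le> \<beta> then c - \<beta> + l k else \<alpha> + (c - b) + (l k - \<beta>))"
    "a \<le> l k \<and> \<alpha> < a \<or> l k \<le> \<alpha>" if "k \<le> i" for k
    using p1[OF that] b[of k] ord[of k i] that ij by (auto simp: block_swap_def \<alpha>_def \<beta>_def)
  have v2: "\<alpha> \<le> l k \<and> l k \<le> \<beta>" "p (Suc k) = c - \<beta> + l k" if k: "i \<le> k" "k \<le> j" for k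
  proof -
    show r: "\<alpha> \<le> l k \<and> l k \<le> \<beta>"
      using ord[of i k] ord[of k j] k ij side by (auto simp: \<alpha>_def \<beta>_def)
    have "l k < b" using b[of k] k ij by simp
    thus "p (Suc k) = c - \<beta> + l k"
      using p2[OF k] r o unfolding \<alpha>_def[symmetric] \<beta>_def[symmetric]
      by (cases "l k = \<alpha>") (auto simp: block_swap_def)
  qed
  have v3: "\<beta> \<le> l k \<or> l k < \<alpha> \<and> l k < a \<and> a \<le> \<alpha>"
    "p (Suc (Suc k)) = (if \<beta> \<le> l k then \<alpha> + (c - b) + (l k - \<beta>) else l k)" if k: "j \<le> k" "k \<le> m" for k
  proof -
    show r: "\<beta> \<le> l k \<or> l k < \<alpha> \<and> l k < a \<and> a \<le> \<alpha>"
      using ord[of j k] k side by (auto simp: \<beta>_def)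
    have lb: "l k < b" "l k \<noteq> b" "l k \<noteq> c" using b[of k] k o by auto
    have p3': "p (Suc (Suc k)) = block_swap \<alpha> \<beta> b c (swap \<alpha> b (swap \<beta> c (l k)))"
      using p3[OF k] by (simp add: \<alpha>_def \<beta>_def)
    show "p (Suc (Suc k)) = (if \<beta> \<le> l k then \<alpha> + (c - b) + (l k - \<beta>) else l k)"
    proof (cases "l k = \<beta>")
      case True
      have "swap \<alpha> b c = c" using o by (intro transpose_apply_other) auto
      thus ?thesis unfolding p3' using True o by (simp add: block_swap_def)
    next
      case False
      have t2: "swap \<beta> c (l k) = l k" using False lb by simp
      have "l k \<noteq> \<alpha>" using r False o by auto
      hence "swap \<alpha> b (l k) = l k" using lb by simp
      thus ?thesis unfolding p3' t2 using r False lb o by (auto simp: block_swap_def)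
    qed
  qed
  have pD: "p (Suc j) = c" using v2(2)[of j] ij o by (simp add: \<beta>_def)
  have pS: "p (Suc (Suc j)) = \<alpha> + (c - b)" using v3(2)[of j] ij by (simp add: \<beta>_def)
  have pi: "p i = \<alpha>" "p (Suc i) = c - \<beta> + \<alpha>" using v1(1)[of i] v2(2)[of i] ij by (simp_all add: \<alpha>_def)
  have main: "(p (Suc k) < p k \<longrightarrow> p k < c) \<and> \<not> (p k < \<alpha> + (c - b) \<and> \<alpha> + (c - b) < p (Suc k))"
    if k: "k < m + 2" "k \<noteq> i" "k \<noteq> Suc j" for k
  proof -
    consider "k < i" | q where "k = Suc q" "i \<le> q" "q < j" | q where "k = Suc (Suc q)" "j \<le> q" "q < m"
    proof -
      have "k < i \<or> (i < k \<and> k \<le> j) \<or> Suc (Suc j) \<le> k" using k by linarith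
      thus ?thesis using that(1) that(2)[of "k - 1"] that(3)[of "k - 2"] k by fastforce
    qed
    thus ?thesis
    proof cases
      case 1
      have k1: "k \<le> i" "Suc k \<le> i" "Suc k \<le> m" "k \<le> m" using 1 ij by auto
      show ?thesis using v1[OF k1(1)] v1[OF k1(2)] ord[of k "Suc k"] b[OF k1(4)] b[OF k1(3)] k1 o side
        by (auto split: if_splits)
    next
      case 2
      show ?thesis using v2[of q] v2[of "Suc q"] ord[of q "Suc q"] 2 ij o side by auto
    next
      case 3
      show ?thesis using v3[of q] v3[of "Suc q"] ord[of q "Suc q"] b[of q] b[of "Suc q"] 3 ij o
        by (auto split: if_splits)
    qed
  qed
  have "\<exists>k<m + 2. k \<noteq> Suc j \<and> p (Suc k) < p k"
  proof -
    obtain q where q: "q < m" "a \<le> l q" "l (Suc q) < a" using wrap_step[of a l m, OF ends] .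
    consider "q < i" | "i \<le> q" "q < j" | "j \<le> q" by linarith
    thus ?thesis
    proof cases
      case 1
      have "p (Suc q) < p q" using v1[of q] v1[of "Suc q"] 1 q o side by (auto split: if_splits)
      thus ?thesis using 1 q ij by (intro exI[of _ q]) auto
    next
      case 2
      hence False using v2(1)[of q] v2(1)[of "Suc q"] q side by auto
      thus ?thesis ..
    next
      case 3
      have "p (Suc (Suc (Suc q))) < p (Suc (Suc q))"
        using v3[of q] v3[of "Suc q"] 3 q o side by (auto split: if_splits)
      thus ?thesis using 3 q by (intro exI[of _ "Suc (Suc q)"]) auto
    qed
  qed
  moreover have "(p k < \<alpha> + (c - b) \<and> \<alpha> + (c - b) < p (Suc k)) \<longleftrightarrow> k = i" if "k < m + 2" for k
  proof (cases "k = i \<or> k = Suc j")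
    case True
    thus ?thesis using pi pD pS o ij by auto
  next
    case False
    thus ?thesis using main[of k] that by auto
  qed
  moreover have "p (Suc k) < p k \<longrightarrow> p k < c" if "k < m + 2" "k \<noteq> Suc j" for k
    using main[of k] that pi o by (cases "k = i") auto
  ultimately show ?thesis unfolding peak_pair_def pD pS using ij o by auto
qed

text \<open>
  The same sequence as in \<open>peak_pair_ascending\<close>, read from another starting point: the passage from \<open>n\<close> to 1
  happens between the two insertions, so that the fall now comes first and the jump second.
\<close>

lemma peak_pair_wrapping:
  fixes l p :: "nat \<Rightarrow> nat"
  assumes ij: "i \<le> j" "j \<le> m"
    and key: "\<And>j k. j \<le> k \<Longrightarrow> k \<le> m \<Longrightarrow> (if l j < a then l j + n else l j) \<le> (if l k < a then l k + n else l k)"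
    and range: "\<And>k. k \<le> m \<Longrightarrow> 1 \<le> l k \<and> l k \<le> n"
    and ends: "a \<le> l 0" "l m < a"
    and b: "\<And>k. k \<le> m \<Longrightarrow> l k < b" and bc: "b < c" and desc: "l j < l i"
    and p1: "\<And>k. k \<le> i \<Longrightarrow> p k = block_swap (l j) (l i) b c (l k)"
    and p2: "\<And>k. i \<le> k \<Longrightarrow> k \<le> j \<Longrightarrow> p (Suc k) = block_swap (l j) (l i) b c (swap (l i) c (l k))"
    and p3: "\<And>k. j \<le> k \<Longrightarrow> k \<le> m \<Longrightarrow> p (Suc (Suc k)) =
      block_swap (l j) (l i) b c (swap (l i) c (swap (l j) b (l k)))"
  shows "peak_pair p (m + 2) i (Suc j)"
proof -
  define \<alpha> where "\<alpha> = l j"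
  define \<beta> where "\<beta> = l i"
  have ord: "a \<le> l j' \<and> l k < a \<or> l j' \<le> l k \<and> (a \<le> l j' \<longleftrightarrow> a \<le> l k)" if "j' \<le> k" "k \<le> m" for j' k
    using label_order[of m l a n, OF key range that] .
  have o: "1 \<le> \<alpha>" "\<alpha> < \<beta>" "\<beta> < b" "b < c" "\<beta> < c" "\<alpha> < b" "\<alpha> < c"
    using desc b[of i] bc range[of j] ij by (auto simp: \<alpha>_def \<beta>_def)
  have side: "a \<le> \<beta>" "\<alpha> < a" using ord[of i j] ij o by (auto simp: \<alpha>_def \<beta>_def)
  have v1: "a \<le> l k \<and> l k \<le> \<beta>" "p k = c - \<beta> + l k" if k: "k \<le> i" for k
  proof -
    show r: "a \<le> l k \<and> l k \<le> \<beta>" using ord[of k i] k ij side by (auto simp: \<beta>_def)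
    show "p k = c - \<beta> + l k"
      using p1[OF k] r side o unfolding \<alpha>_def[symmetric] \<beta>_def[symmetric] by (auto simp: block_swap_def)
  qed
  have v2: "\<beta> \<le> l k \<or> l k \<le> \<alpha>" "p (Suc k) = (if \<beta> \<le> l k then \<alpha> + (c - b) + (l k - \<beta>) else l k)"
    if k: "i \<le> k" "k \<le> j" for k
  proof -
    show r: "\<beta> \<le> l k \<or> l k \<le> \<alpha>"
      using ord[of i k] ord[of k j] k ij side by (auto simp: \<alpha>_def \<beta>_def)
    have lb: "l k < b" "l k \<noteq> c" using b[of k] k ij o by auto
    show "p (Suc k) = (if \<beta> \<le> l k then \<alpha> + (c - b) + (l k - \<beta>) else l k)"
      using p2[OF k] r lb o unfolding \<alpha>_def[symmetric] \<beta>_def[symmetric]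
      by (cases "l k = \<beta>") (auto simp: block_swap_def)
  qed
  have v3: "\<alpha> \<le> l k \<and> l k < a" "p (Suc (Suc k)) = c - \<beta> + l k" if k: "j \<le> k" "k \<le> m" for k
  proof -
    show r: "\<alpha> \<le> l k \<and> l k < a" using ord[of j k] k side by (auto simp: \<alpha>_def)
    have lb: "l k < b" "l k \<noteq> b" "l k \<noteq> c" "l k \<noteq> \<beta>" using b[of k] k o r side by auto
    have p3': "p (Suc (Suc k)) = block_swap \<alpha> \<beta> b c (swap \<beta> c (swap \<alpha> b (l k)))"
      using p3[OF k] by (simp add: \<alpha>_def \<beta>_def)
    show "p (Suc (Suc k)) = c - \<beta> + l k"
    proof (cases "l k = \<alpha>")
      case True
      have "swap \<beta> c b = b" using o by (intro transpose_apply_other) auto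
      thus ?thesis unfolding p3' using True o by (simp add: block_swap_def)
    next
      case False
      thus ?thesis unfolding p3' using r lb o side by (auto simp: block_swap_def)
    qed
  qed
  have pD: "p i = c" using v1(2)[of i] ij o by (simp add: \<beta>_def)
  have pS: "p (Suc i) = \<alpha> + (c - b)" using v2(2)[of i] ij by (simp add: \<beta>_def)
  have pj: "p (Suc j) = \<alpha>" "p (Suc (Suc j)) = c - \<beta> + \<alpha>"
    using v2(2)[of j] v3(2)[of j] ij o by (simp_all add: \<alpha>_def)
  have main: "(p (Suc k) < p k \<longrightarrow> p k < c) \<and> \<not> (p k < \<alpha> + (c - b) \<and> \<alpha> + (c - b) < p (Suc k))"
    if k: "k < m + 2" "k \<noteq> i" "k \<noteq> Suc j" for k
  proof -
    consider "k < i" | q where "k = Suc q" "i \<le> q" "q < j" | q where "k = Suc (Suc q)" "j \<le> q" "q < m"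
    proof -
      have "k < i \<or> (i < k \<and> k \<le> j) \<or> Suc (Suc j) \<le> k" using k by linarith
      thus ?thesis using that(1) that(2)[of "k - 1"] that(3)[of "k - 2"] k by fastforce
    qed
    thus ?thesis
    proof cases
      case 1
      show ?thesis using v1[of k] v1[of "Suc k"] ord[of k "Suc k"] 1 ij o side by auto
    next
      case 2
      show ?thesis using v2[of q] v2[of "Suc q"] ord[of q "Suc q"] b[of q] b[of "Suc q"] 2 ij o side
        by (auto split: if_splits)
    next
      case 3
      show ?thesis using v3[of q] v3[of "Suc q"] ord[of q "Suc q"] 3 ij o side by auto
    qed
  qed
  have "\<exists>k<m + 2. k \<noteq> i \<and> p (Suc k) < p k"
  proof -
    obtain q where q: "q < m" "a \<le> l q" "l (Suc q) < a" using wrap_step[of a l m, OF ends] .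
    consider "q < i" | "i \<le> q" "q < j" | "j \<le> q" by linarith
    thus ?thesis
    proof cases
      case 1
      hence False using v1(1)[of "Suc q"] q by auto
      thus ?thesis ..
    next
      case 2
      have "p (Suc (Suc q)) < p (Suc q)" using v2[of q] v2[of "Suc q"] 2 q o side by (auto split: if_splits)
      thus ?thesis using 2 q ij by (intro exI[of _ "Suc q"]) auto
    next
      case 3
      hence False using v3(1)[of q] q by auto
      thus ?thesis ..
    qed
  qed
  moreover have "(p k < \<alpha> + (c - b) \<and> \<alpha> + (c - b) < p (Suc k)) \<longleftrightarrow> k = Suc j" if "k < m + 2" for k
  proof (cases "k = i \<or> k = Suc j")
    case True
    thus ?thesis using pj pD pS o ij by auto
  next
    case False
    thus ?thesis using main[of k] that by auto
  qed
  moreover have "p (Suc k) < p k \<longrightarrow> p k < c" if "k < m + 2" "k \<noteq> i" for k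
    using main[of k] that pj o by (cases "k = Suc j") auto
  ultimately show ?thesis unfolding peak_pair_def pD pS using ij o by auto
qed

section \<open>Inserting two transpositions\<close>

lemma length_insert2:
  assumes "i \<le> j" "j \<le> length ts"
  shows "length (insert2 (Suc i) (j + 2) x y ts) = length ts + 2"
  using assms by (simp add: insert2_def)

lemma insert2_nth:
  assumes "i \<le> j" "j \<le> length ts"
  shows "k < i \<Longrightarrow> insert2 (Suc i) (j + 2) x y ts ! k = ts ! k"
    and "insert2 (Suc i) (j + 2) x y ts ! i = x"
    and "i \<le> k \<Longrightarrow> k < j \<Longrightarrow> insert2 (Suc i) (j + 2) x y ts ! Suc k = ts ! k"
    and "insert2 (Suc i) (j + 2) x y ts ! Suc j = y"
    and "j \<le> k \<Longrightarrow> k < length ts \<Longrightarrow> insert2 (Suc i) (j + 2) x y ts ! Suc (Suc k) = ts ! k"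
  using assms by (auto simp: insert2_def nth_append)

lemma set_insert2:
  assumes "i \<le> j" "j \<le> length ts"
  shows "set (insert2 (Suc i) (j + 2) x y ts) \<subseteq> insert x (insert y (set ts))"
  by (auto simp: insert2_def dest: in_set_takeD in_set_dropD)

definition remove2 :: "nat \<Rightarrow> nat \<Rightarrow> 'a list \<Rightarrow> 'a list" where
  "remove2 i j us = take i us @ take (j - i) (drop (Suc i) us) @ drop (j + 2) us"

lemma remove2_insert2:
  assumes "i \<le> j" "j \<le> length ts"
  shows "remove2 i j (insert2 (Suc i) (j + 2) x y ts) = ts"
proof -
  have l: "length (take i ts) = i" "length (drop i (take j ts)) = j - i" using assms by auto
  have 1: "take i (insert2 (Suc i) (j + 2) x y ts) = take i ts"
    using l by (simp add: insert2_def)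
  have d: "drop (Suc i) (insert2 (Suc i) (j + 2) x y ts) = drop i (take j ts) @ [y] @ drop j ts"
    using l by (simp add: insert2_def)
  have 2: "take (j - i) (drop (Suc i) (insert2 (Suc i) (j + 2) x y ts)) = drop i (take j ts)"
    unfolding d using l by simp
  have "drop (j + 2) (insert2 (Suc i) (j + 2) x y ts) = drop (Suc (j - i)) (drop (Suc i) (insert2 (Suc i) (j + 2) x y ts))"
    using assms by simp
  also have "\<dots> = drop j ts" unfolding d using l by simp
  finally have 3: "drop (j + 2) (insert2 (Suc i) (j + 2) x y ts) = drop j ts" .
  have "take i ts @ drop i (take j ts) = take j ts"
    using append_take_drop_id[of i "take j ts"] assms by (simp add: min_def)
  hence "take i ts @ drop i (take j ts) @ drop j ts = ts"
    using append_take_drop_id[of j ts] by (simp only: append_assoc[symmetric])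
  thus ?thesis unfolding remove2_def 1 2 3 .
qed

lemma map_remove2: "map f (remove2 i j us) = remove2 i j (map f us)"
  by (simp add: remove2_def take_map drop_map)

lemma conj_perm_comp_right: "bij f \<Longrightarrow> conj_perm f t \<circ> f = f \<circ> t"
  by (simp add: conj_perm_def comp_assoc bij_is_inj)

text \<open>
  An inserted transposition exchanges two rounds from then on, namely the ones that the labels
  it moves have at that time.
\<close>

lemma rounds_insert2:
  assumes ts: "set ts \<subseteq> transps X" and xy: "x \<in> transps X" "y \<in> transps X" and ij: "i \<le> j" "j \<le> length ts"
  defines "us \<equiv> insert2 (Suc i) (j + 2) x y ts"
  shows "k \<le> i \<Longrightarrow> rounds us k = rounds ts k"
    and "i \<le> k \<Longrightarrow> k \<le> j \<Longrightarrow> rounds us (Suc k) = conj_perm (rounds ts i) x \<circ> rounds ts k"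
    and "j \<le> k \<Longrightarrow> k \<le> length ts \<Longrightarrow>
      rounds us (Suc (Suc k)) = conj_perm (rounds ts i) x \<circ> conj_perm (rounds ts j) y \<circ> rounds ts k"
proof -
  have sub: "set us \<subseteq> transps X" using set_insert2[OF ij, of x y] ts xy unfolding us_def by blast
  have len: "length us = length ts + 2" unfolding us_def by (rule length_insert2[OF ij])
  have bij: "bij (rounds ts k)" for k by (rule permutes_bij[OF rounds_permutes[OF ts]])
  have 1: "rounds us k = rounds ts k" if "k \<le> i" for k
    using that
  proof (induction k)
    case (Suc k)
    have k: "k < length us" "k < length ts" "k < i" using Suc.prems len ij by auto
    have "us ! k = ts ! k" unfolding us_def by (rule insert2_nth(1)[OF ij k(3)])
    thus ?case using Suc by (simp only: rounds_Suc[OF sub k(1)] rounds_Suc[OF ts k(2)])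
  qed simp
  have 2: "rounds us (Suc k) = conj_perm (rounds ts i) x \<circ> rounds ts k" if "i \<le> k" "k \<le> j" for k
    using that
  proof (induction k rule: dec_induct)
    case base
    have k: "i < length us" using len ij by auto
    have "us ! i = x" unfolding us_def by (rule insert2_nth(2)[OF ij])
    thus ?case by (simp only: rounds_Suc[OF sub k] 1[OF order_refl] conj_perm_comp_right[OF bij])
  next
    case (step k)
    have k: "Suc k < length us" "k < length ts" "i \<le> k" "k < j" using step len ij by auto
    have "us ! Suc k = ts ! k" unfolding us_def by (rule insert2_nth(3)[OF ij k(3,4)])
    moreover have "rounds us (Suc k) = conj_perm (rounds ts i) x \<circ> rounds ts k"
      by (rule step.IH) (use k in simp)
    ultimately show ?case by (simp only: rounds_Suc[OF sub k(1)] rounds_Suc[OF ts k(2)] comp_assoc)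
  qed
  have 3: "rounds us (Suc (Suc k)) = conj_perm (rounds ts i) x \<circ> conj_perm (rounds ts j) y \<circ> rounds ts k"
    if "j \<le> k" "k \<le> length ts" for k
    using that
  proof (induction k rule: dec_induct)
    case base
    have k: "Suc j < length us" using len ij by auto
    have "us ! Suc j = y" unfolding us_def by (rule insert2_nth(4)[OF ij])
    thus ?case by (simp only: rounds_Suc[OF sub k] 2[OF ij(1) order_refl] conj_perm_comp_right[OF bij] comp_assoc)
  next
    case (step k)
    have k: "Suc (Suc k) < length us" "k < length ts" "j \<le> k" using step len ij by auto
    have "us ! Suc (Suc k) = ts ! k" unfolding us_def by (rule insert2_nth(5)[OF ij k(3,2)])
    moreover have "rounds us (Suc (Suc k)) = conj_perm (rounds ts i) x \<circ> conj_perm (rounds ts j) y \<circ> rounds ts k"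
      by (rule step.IH) (use k in simp)
    ultimately show ?case by (simp only: rounds_Suc[OF sub k(1)] rounds_Suc[OF ts k(2)] comp_assoc)
  qed
  show "k \<le> i \<Longrightarrow> rounds us k = rounds ts k"
    "i \<le> k \<Longrightarrow> k \<le> j \<Longrightarrow> rounds us (Suc k) = conj_perm (rounds ts i) x \<circ> rounds ts k"
    "j \<le> k \<Longrightarrow> k \<le> length ts \<Longrightarrow>
      rounds us (Suc (Suc k)) = conj_perm (rounds ts i) x \<circ> conj_perm (rounds ts j) y \<circ> rounds ts k"
    using 1 2 3 by blast+
qed

lemma transpose_mem_transps: "p \<in> X \<Longrightarrow> q \<in> X \<Longrightarrow> p \<noteq> q \<Longrightarrow> swap p q \<in> transps X"
  by (auto simp: transps_def)

lemma rounds_insert2_transpose: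
  assumes ts: "ts \<in> factorizations h n" and ij: "i \<le> j" "j \<le> length ts"
    and lab: "a \<in> {1..n}" "b \<in> {1..n}" "c \<in> {1..n}" "a \<noteq> b" "a \<noteq> c"
  defines "us \<equiv> insert2 (Suc i) (j + 2) (swap a b) (swap a c) ts"
    and "R \<equiv> rounds ts"
  shows "k \<le> i \<Longrightarrow> rounds us k z = R k z"
    and "i \<le> k \<Longrightarrow> k \<le> j \<Longrightarrow> rounds us (Suc k) z = swap (R i a) (R i b) (R k z)"
    and "j \<le> k \<Longrightarrow> k \<le> length ts \<Longrightarrow>
      rounds us (Suc (Suc k)) z = swap (R i a) (R i b) (swap (R j a) (R j c) (R k z))"
    and "prod_lr us = long_cycle n \<circ> swap (R j a) (R j c) \<circ> swap (R i a) (R i b)"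
    and "set us \<subseteq> transps {1..n}" and "length us = length ts + 2"
proof -
  note F = factorizations_D[OF ts]
  have xy: "swap a b \<in> transps {1..n}" "swap a c \<in> transps {1..n}"
    using lab by (auto intro: transpose_mem_transps)
  note r = rounds_insert2[OF F(2) xy ij, folded us_def]
  have bij: "bij (rounds ts k)" for k by (rule permutes_bij[OF rounds_permutes[OF F(2)]])
  have c1: "conj_perm (rounds ts i) (swap a b) = swap (R i a) (R i b)"
    and c2: "conj_perm (rounds ts j) (swap a c) = swap (R j a) (R j c)"
    unfolding R_def by (rule conj_perm_transpose[OF bij])+
  show "k \<le> i \<Longrightarrow> rounds us k z = R k z" using r(1) by (simp add: R_def)
  show "i \<le> k \<Longrightarrow> k \<le> j \<Longrightarrow> rounds us (Suc k) z = swap (R i a) (R i b) (R k z)"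
    using r(2)[of k] unfolding c1 by (simp add: R_def)
  show "j \<le> k \<Longrightarrow> k \<le> length ts \<Longrightarrow>
      rounds us (Suc (Suc k)) z = swap (R i a) (R i b) (swap (R j a) (R j c) (R k z))"
    using r(3)[of k] unfolding c1 c2 by (simp add: R_def)
  show sub: "set us \<subseteq> transps {1..n}"
    using set_insert2[OF ij, of "swap a b" "swap a c"] F(2) xy unfolding us_def by blast
  show len: "length us = length ts + 2" unfolding us_def by (rule length_insert2[OF ij])
  let ?t1 = "swap (R i a) (R i b)" and ?t2 = "swap (R j a) (R j c)"
  have P: "prod_lr us permutes {1..n}"
  proof (rule prod_lr_permutes)
    fix t assume "t \<in> set us"
    thus "t permutes {1..n}" using sub by (intro transps_permutes) blast
  qed
  have lc: "bij (long_cycle n)" by (rule permutes_bij[OF long_cycle_permutes])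
  have "inv (prod_lr us) = rounds us (Suc (Suc (length ts)))" using len by (simp add: rounds_def)
  also have "\<dots> = ?t1 \<circ> ?t2 \<circ> inv (long_cycle n)"
    using r(3)[OF ij(2) order_refl] unfolding c1 c2 rounds_last[OF ts] .
  finally have "inv (inv (prod_lr us)) = inv (?t1 \<circ> ?t2 \<circ> inv (long_cycle n))" by (rule arg_cong)
  also have "\<dots> = inv (inv (long_cycle n)) \<circ> inv (?t1 \<circ> ?t2)"
    by (rule o_inv_distrib) (auto intro: bij_comp bij_imp_bij_inv lc)
  also have "inv (?t1 \<circ> ?t2) = inv ?t2 \<circ> inv ?t1" by (rule o_inv_distrib) auto
  finally show "prod_lr us = long_cycle n \<circ> ?t2 \<circ> ?t1"
    by (simp only: inv_inv_eq[OF permutes_bij[OF P]] inv_inv_eq[OF lc] inv_transpose_eq comp_assoc)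
qed

lemma rounds_map_conj:
  assumes "bij \<sigma>" "set us \<subseteq> transps X"
  shows "rounds (map (conj_perm \<sigma>) us) k (\<sigma> z) = \<sigma> (rounds us k z)"
proof -
  define P where "P = prod_lr (take k us)"
  have P: "bij P"
  proof -
    have "P permutes X" unfolding P_def
    proof (rule prod_lr_permutes)
      fix t assume "t \<in> set (take k us)"
      hence "t \<in> transps X" using assms(2) in_set_takeD by fastforce
      thus "t permutes X" by (rule transps_permutes)
    qed
    thus ?thesis by (rule permutes_bij)
  qed
  have "rounds (map (conj_perm \<sigma>) us) k = inv (conj_perm \<sigma> P)"
    by (simp add: rounds_def P_def take_map prod_lr_conj[OF assms(1)])
  moreover have "inv (conj_perm \<sigma> P) (\<sigma> z) = \<sigma> (inv P z)"
  proof (rule inv_f_eq)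
    show "inj (conj_perm \<sigma> P)" unfolding conj_perm_def
      using assms(1) P by (intro bij_is_inj bij_comp bij_imp_bij_inv)
    show "conj_perm \<sigma> P (\<sigma> (inv P z)) = \<sigma> z"
      using assms(1) P by (simp add: conj_perm_def bij_is_inj bij_is_surj surj_f_inv_f)
  qed
  ultimately show ?thesis by (simp add: rounds_def P_def)
qed

text \<open>
  The distances make the rounds of \<open>a\<close>, of \<open>b\<close> and of \<open>c\<close> lie in disjoint intervals, in this order, at all
  times.
\<close>

definition good :: "nat \<Rightarrow> nat \<Rightarrow> perm list \<Rightarrow> nat \<Rightarrow> nat \<Rightarrow> nat \<Rightarrow> bool" where
  "good n M ts a b c \<longleftrightarrow> tame n M ts a \<and> tame n M ts b \<and> tame n M ts c \<and>
    2 \<le> a \<and> a + 2 * M < b \<and> b + 2 * M < c \<and> c \<le> n"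

text \<open>
  \<open>us\<close> is \<open>ts\<close> with the two transpositions inserted in some order, \<open>\<sigma>\<close> is the relabelling of Step (ii), and the rounds of \<open>a\<close> after
  the relabelling show where the two transpositions have been inserted.
\<close>

definition marked_insertion ::
  "nat \<Rightarrow> perm list \<Rightarrow> nat \<Rightarrow> nat \<Rightarrow> nat \<Rightarrow> nat \<Rightarrow> nat \<Rightarrow> perm list \<Rightarrow> perm \<Rightarrow> bool" where
  "marked_insertion n ts i j a b c us \<sigma> \<longleftrightarrow> relabels n \<sigma> (prod_lr us) \<and> set us \<subseteq> transps {1..n} \<and>
    (\<exists>x y. us = insert2 (Suc i) (j + 2) x y ts \<and>
      {x, y} = {swap a b, swap a c}) \<and>
    (\<exists>D J. peak_pair (\<lambda>k. \<sigma> (rounds us k a)) (length ts + 2) D J \<and> {D, J} = {i, Suc j})"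

text \<open>
  In terms of rounds, the insertion multiplies the long cycle by a chord from the interval of \<open>a\<close> to that
  of \<open>c\<close> and one from the interval of \<open>a\<close> to that of \<open>b\<close>. Which order of the two produces crossing
  chords, hence a full cycle, depends only on whether the round of \<open>a\<close> is lower at the second insertion
  than at the first.
\<close>

lemma good_insertion:
  assumes ts: "ts \<in> factorizations h n" and ij: "i \<le> j" "j \<le> length ts" and good: "good n M ts a b c"
  shows "\<exists>us \<sigma>. step_i n (Suc i, j + 2) (a, b, c) ts = Some us \<and> marked_insertion n ts i j a b c us \<sigma>"
proof -
  define m where "m = length ts"
  define R where "R = rounds ts"
  note F = factorizations_D[OF ts]
  have lab: "2 \<le> a" "a + 2 * M < b" "b + 2 * M < c" "c \<le> n" using good by (auto simp: good_def)
  hence mem: "a \<in> {1..n}" "b \<in> {1..n}" "c \<in> {1..n}" "a \<noteq> b" "a \<noteq> c" by auto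
  have range: "1 \<le> R k z \<and> R k z \<le> n" if "z \<in> {1..n}" for k z
    using permutes_in_image[OF rounds_permutes[OF F(2)], of k z] that by (simp add: R_def)
  have tame: "tame n M ts a" "tame n M ts b" "tame n M ts c" using good by (simp_all add: good_def)
  have near: "R k z \<le> z + M \<and> z \<le> R k z + M" if "tame n M ts z" "k \<le> m" for k z
    using that unfolding tame_def R_def m_def by blast
  have key: "(if R j' a < a then R j' a + n else R j' a) \<le> (if R k a < a then R k a + n else R k a)"
    if "j' \<le> k" "k \<le> m" for j' k
    using tame(1) that unfolding tame_def R_def m_def by blast
  have ends: "a \<le> R 0 a" "R m a < a"
    using lab by (simp_all add: R_def m_def rounds_last[OF ts] inv_long_cycle)
  have im: "i \<le> m" "j \<le> m" using ij by (auto simp: m_def)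
  have ab: "R k a < R k' b" "R k' b < R k'' c" "R k a < R k'' c" if "k \<le> m" "k' \<le> m" "k'' \<le> m" for k k' k''
    using near[OF tame(1) that(1)] near[OF tame(2) that(2)] near[OF tame(3) that(3)] near[OF tame(2) that(2)] lab
    by linarith+
  define us1 where "us1 = insert2 (Suc i) (j + 2) (swap a c) (swap a b) ts"
  define us2 where "us2 = insert2 (Suc i) (j + 2) (swap a b) (swap a c) ts"
  note r1 = rounds_insert2_transpose[OF ts ij mem(1,3,2,5,4), folded us1_def R_def]
  note r2 = rounds_insert2_transpose[OF ts ij mem, folded us2_def R_def]
  have step: "step_i n (Suc i, j + 2) (a, b, c) ts =
      (if full_cycle_on {1..n} (prod_lr us1) then Some us1
       else if full_cycle_on {1..n} (prod_lr us2) then Some us2 else None)"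
    by (simp add: step_i_def Let_def us1_def us2_def is_full_cycle_iff)
  have bound: "R k a < R k' b" if "k \<le> m" "k' \<le> m" for k k' by (rule ab(1)[OF that that(1)])
  show ?thesis
  proof (cases "R j a < R i a")
    case True
    \<comment> \<open>the chords have no common endpoint here, so their order is irrelevant\<close>
    let ?t1 = "swap (R i a) (R i c)" and ?t2 = "swap (R j a) (R j b)"
    have ord: "R j a \<le> R i a" "R i a < R j b" "R j b < R i c" "R i c \<le> n" "1 \<le> R j a"
      using True ab(1)[OF im(1,2,1)] ab(2)[OF im(1,2,1)] range[OF mem(3), of i] range[OF mem(1), of j] by auto
    have "?t1 permutes {R i a, R i c}" "?t2 permutes {R j a, R j b}" by (auto intro: permutes_swap_id)
    moreover have "{R i a, R i c} \<inter> {R j a, R j b} = {}" using True ord by auto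
    ultimately have comm: "?t1 \<circ> ?t2 = ?t2 \<circ> ?t1" by (rule permutes_commute)
    define \<sigma> where "\<sigma> = block_swap (R j a) (R i a) (R j b) (R i c)"
    have "prod_lr us1 = long_cycle n \<circ> (?t2 \<circ> ?t1)" using r1(4) by (simp only: comp_assoc)
    also have "\<dots> = long_cycle n \<circ> ?t1 \<circ> ?t2" by (simp only: comm comp_assoc)
    finally have rel: "relabels n \<sigma> (prod_lr us1)"
      using block_swap_relabels[OF ord] by (simp only: \<sigma>_def)
    have pp: "peak_pair (\<lambda>k. \<sigma> (rounds us1 k a)) (m + 2) i (Suc j)"
    proof (rule peak_pair_wrapping[where l = "\<lambda>k. R k a" and a = a and n = n and b = "R j b" and c = "R i c"])
      show "\<And>k. k \<le> i \<Longrightarrow> \<sigma> (rounds us1 k a) = block_swap (R j a) (R i a) (R j b) (R i c) (R k a)"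
        by (simp only: r1(1) \<sigma>_def)
      show "\<And>k. i \<le> k \<Longrightarrow> k \<le> j \<Longrightarrow> \<sigma> (rounds us1 (Suc k) a) = block_swap (R j a) (R i a) (R j b) (R i c) (?t1 (R k a))"
        by (simp only: r1(2) \<sigma>_def)
      show "\<And>k. j \<le> k \<Longrightarrow> k \<le> m \<Longrightarrow> \<sigma> (rounds us1 (Suc (Suc k)) a) = block_swap (R j a) (R i a) (R j b) (R i c) (?t1 (?t2 (R k a)))"
        unfolding m_def by (simp only: r1(3) \<sigma>_def)
      show "\<And>k. k \<le> m \<Longrightarrow> R k a < R j b" using bound im by simp
      show "\<And>k. k \<le> m \<Longrightarrow> 1 \<le> R k a \<and> R k a \<le> n" by (rule range[OF mem(1)])
      show "i \<le> j" "j \<le> m" by (rule ij(1), rule im(2))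
      show "\<And>j' k. j' \<le> k \<Longrightarrow> k \<le> m \<Longrightarrow>
          (if R j' a < a then R j' a + n else R j' a) \<le> (if R k a < a then R k a + n else R k a)" by (rule key)
      show "a \<le> R 0 a" "R m a < a" by (rule ends(1), rule ends(2))
      show "R j b < R i c" "R j a < R i a" by (rule ord(3), rule True)
    qed
    have st: "step_i n (Suc i, j + 2) (a, b, c) ts = Some us1"
      unfolding step using relabels_imp_full_cycle[OF rel] by (simp only: if_True)
    have "{swap a c, swap a b} = {swap a b, swap a c}"
      by (rule insert_commute)
    hence "marked_insertion n ts i j a b c us1 \<sigma>"
      unfolding marked_insertion_def using rel r1(5) us1_def pp[unfolded m_def] by blast
    thus ?thesis using st by blast
  next
    case False
    hence asc: "R i a \<le> R j a" by simp
    have ord1: "R i a \<le> R j a" "R j a < R j b" "R j b < R i c" "R i c \<le> n" "1 \<le> R i a"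
      and ord2: "R i a \<le> R j a" "R j a < R i b" "R i b < R j c" "R j c \<le> n" "1 \<le> R i a"
      using asc ab(1)[OF im(2,2,1)] ab(2)[OF im(2,2,1)] ab(1)[OF im(2,1,2)] ab(2)[OF im(2,1,2)]
        range[OF mem(3), of i] range[OF mem(3), of j] range[OF mem(1), of i] by auto
    define \<sigma> where "\<sigma> = block_swap (R i a) (R j a) (R i b) (R j c)"
    have nf: "\<not> full_cycle_on {1..n} (prod_lr us1)"
      unfolding r1(4) by (rule not_full_cycle[OF ord1])
    have rel: "relabels n \<sigma> (prod_lr us2)"
      using block_swap_relabels[OF ord2] unfolding r2(4) \<sigma>_def .
    have pp: "peak_pair (\<lambda>k. \<sigma> (rounds us2 k a)) (m + 2) (Suc j) i"
    proof (rule peak_pair_ascending[where l = "\<lambda>k. R k a" and a = a and n = n and b = "R i b" and c = "R j c"])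
      show "\<And>k. k \<le> i \<Longrightarrow> \<sigma> (rounds us2 k a) = block_swap (R i a) (R j a) (R i b) (R j c) (R k a)"
        by (simp only: r2(1) \<sigma>_def)
      show "\<And>k. i \<le> k \<Longrightarrow> k \<le> j \<Longrightarrow> \<sigma> (rounds us2 (Suc k) a) =
          block_swap (R i a) (R j a) (R i b) (R j c) (swap (R i a) (R i b) (R k a))"
        by (simp only: r2(2) \<sigma>_def)
      show "\<And>k. j \<le> k \<Longrightarrow> k \<le> m \<Longrightarrow> \<sigma> (rounds us2 (Suc (Suc k)) a) =
          block_swap (R i a) (R j a) (R i b) (R j c)
            (swap (R i a) (R i b) (swap (R j a) (R j c) (R k a)))"
        unfolding m_def by (simp only: r2(3) \<sigma>_def)
      show "\<And>k. k \<le> m \<Longrightarrow> R k a < R i b" using bound im by simp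
      show "\<And>k. k \<le> m \<Longrightarrow> 1 \<le> R k a \<and> R k a \<le> n" by (rule range[OF mem(1)])
      show "i \<le> j" "j \<le> m" by (rule ij(1), rule im(2))
      show "\<And>j' k. j' \<le> k \<Longrightarrow> k \<le> m \<Longrightarrow>
          (if R j' a < a then R j' a + n else R j' a) \<le> (if R k a < a then R k a + n else R k a)" by (rule key)
      show "a \<le> R 0 a" "R m a < a" by (rule ends(1), rule ends(2))
      show "R i b < R j c" "R i a \<le> R j a" by (rule ord2(3), rule asc)
    qed
    have st: "step_i n (Suc i, j + 2) (a, b, c) ts = Some us2"
      unfolding step using nf relabels_imp_full_cycle[OF rel] by (simp only: if_True if_False)
    have "marked_insertion n ts i j a b c us2 \<sigma>"
      unfolding marked_insertion_def using rel r2(5) us2_def pp[unfolded m_def] insert_commute[of "Suc j" i "{}"] by blast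
    thus ?thesis using st by blast
  qed
qed

text \<open>
  The rounds of the relabelled \<open>a\<close> reveal the two positions. Removing the inserted transpositions leaves
  \<open>ts\<close> up to relabelling, and the relabelling is determined by the requirement that the product is
  the long cycle.
\<close>

lemma good_insertion_inj:
  assumes ts: "ts \<in> factorizations h n" "ts' \<in> factorizations h n"
    and ij: "i \<le> j" "j \<le> length ts" "i' \<le> j'" "j' \<le> length ts'"
    and lab: "a < b" "b < c" "a' < b'" "b' < c'"
    and ins: "marked_insertion n ts i j a b c us \<sigma>" "marked_insertion n ts' i' j' a' b' c' us' \<sigma>'"
    and eq: "map (conj_perm \<sigma>) us = map (conj_perm \<sigma>') us'" "\<sigma> a = \<sigma>' a'"
  shows "ts = ts' \<and> i = i' \<and> j = j' \<and> a = a' \<and> b = b' \<and> c = c'"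
proof -
  obtain x y D J where us: "us = insert2 (Suc i) (j + 2) x y ts"
    and xy: "{x, y} = {swap a b, swap a c}"
    and rel1: "relabels n \<sigma> (prod_lr us)" and sub1: "set us \<subseteq> transps {1..n}"
    and pp1: "peak_pair (\<lambda>k. \<sigma> (rounds us k a)) (length ts + 2) D J" and DJ: "{D, J} = {i, Suc j}"
    using ins(1) unfolding marked_insertion_def by blast
  obtain x' y' D' J' where us': "us' = insert2 (Suc i') (j' + 2) x' y' ts'"
    and xy': "{x', y'} = {swap a' b', swap a' c'}"
    and rel2: "relabels n \<sigma>' (prod_lr us')" and sub2: "set us' \<subseteq> transps {1..n}"
    and pp2: "peak_pair (\<lambda>k. \<sigma>' (rounds us' k a')) (length ts' + 2) D' J'" and DJ': "{D', J'} = {i', Suc j'}"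
    using ins(2) unfolding marked_insertion_def by blast
  note rel = rel1 rel2
  have perm: "\<sigma> permutes {1..n}" "\<sigma>' permutes {1..n}" using rel by (auto simp: relabels_def)
  have bij: "bij \<sigma>" "bij \<sigma>'" using perm by (auto intro: permutes_bij)
  have len: "length ts = length ts'" using ts factorizations_D(1) by metis
  have "(\<lambda>k. \<sigma> (rounds us k a)) = (\<lambda>k. \<sigma>' (rounds us' k a'))"
  proof
    fix k
    show "\<sigma> (rounds us k a) = \<sigma>' (rounds us' k a')"
      using rounds_map_conj[OF bij(1) sub1, of k a] rounds_map_conj[OF bij(2) sub2, of k a'] eq by simp
  qed
  hence "D = D' \<and> J = J'" using pp1 pp2 len by (intro peak_pair_unique) simp_all
  hence "{i, Suc j} = {i', Suc j'}" using DJ DJ' by simp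
  hence ii: "i = i'" "j = j'" using ij by (auto simp: doubleton_eq_iff)
  have rem1: "remove2 i j us = ts" unfolding us by (rule remove2_insert2[OF ij(1,2)])
  have rem2: "remove2 i j us' = ts'" unfolding us' ii by (rule remove2_insert2[OF ij(3,4)])
  note rem = rem1 rem2
  have mts: "map (conj_perm \<sigma>) ts = map (conj_perm \<sigma>') ts'"
    using arg_cong[OF eq(1), of "remove2 i j"] unfolding map_remove2[symmetric] rem .
  have cc: "conj_perm \<sigma> (long_cycle n) = conj_perm \<sigma>' (long_cycle n)"
    using arg_cong[OF mts, of prod_lr] unfolding prod_lr_conj[OF bij(1)] prod_lr_conj[OF bij(2)]
      factorizations_D(3)[OF ts(1)] factorizations_D(3)[OF ts(2)] .
  have one: "\<sigma> 1 = 1" "\<sigma>' 1 = 1" using rel by (simp_all add: relabels_def)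
  have "relabels n (inv \<sigma>) (conj_perm \<sigma> (long_cycle n))"
    using permutes_inv[OF perm(1)] inv_fixes[OF bij(1) one(1)] map_conj_inverse(1)[OF bij(1), of "[long_cycle n]"]
    by (simp add: relabels_def)
  moreover have "relabels n (inv \<sigma>') (conj_perm \<sigma> (long_cycle n))"
    using permutes_inv[OF perm(2)] inv_fixes[OF bij(2) one(2)] map_conj_inverse(1)[OF bij(2), of "[long_cycle n]"]
    unfolding cc by (simp add: relabels_def)
  ultimately have "inv \<sigma> = inv \<sigma>'" by (rule relabels_unique)
  hence "inv (inv \<sigma>) = inv (inv \<sigma>')" by (rule arg_cong)
  hence ss: "\<sigma> = \<sigma>'" unfolding inv_inv_eq[OF bij(1)] inv_inv_eq[OF bij(2)] .
  have "map (conj_perm (inv \<sigma>)) (map (conj_perm \<sigma>) us) = map (conj_perm (inv \<sigma>)) (map (conj_perm \<sigma>) us')"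
    using eq(1) unfolding ss by (rule arg_cong)
  hence uu: "us = us'" unfolding map_conj_inverse(1)[OF bij(1)] .
  hence tt: "ts = ts'" using rem by simp
  have aa: "a = a'" using eq(2) bij_is_inj[OF bij(1)] unfolding ss[symmetric] by (simp add: inj_eq)
  have "x = us ! i" "y = us ! Suc j" unfolding us by (rule insert2_nth(2,4)[OF ij(1,2), symmetric])+
  moreover have "x' = us' ! i'" "y' = us' ! Suc j'" unfolding us' by (rule insert2_nth(2,4)[OF ij(3,4), symmetric])+
  ultimately have "{x, y} = {x', y'}" using uu ii by simp
  hence TT: "{swap a b, swap a c} = {swap a b', swap a c'}"
    using xy xy' aa by simp
  have E: "swap a p = swap a q \<Longrightarrow> a < p \<Longrightarrow> a < q \<Longrightarrow> p = q" for p q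
    using transpose_eq_iff_ordered[of a p a q] by simp
  have "b = b' \<or> b = c'" "c = b' \<or> c = c'" "b' = b \<or> b' = c"
    using TT E[of b b'] E[of b c'] E[of c b'] E[of c c'] E[of b' b] E[of b' c] lab
    unfolding aa[symmetric] doubleton_eq_iff by auto
  hence "b = b' \<and> c = c'" using lab by auto
  thus ?thesis using tt ii aa by simp
qed

section \<open>Samples of the random map\<close>

definition samples :: "nat \<Rightarrow> nat \<Rightarrow> (perm list \<times> (nat \<times> nat) \<times> (nat \<times> nat \<times> nat)) set" where
  "samples h n = factorizations h n \<times> position_pairs (Suc h) n \<times> label_triples n"

definition sample_image :: "nat \<Rightarrow> perm list \<times> (nat \<times> nat) \<times> (nat \<times> nat \<times> nat) \<Rightarrow> perm list option" where
  "sample_image n = (\<lambda>(ts, vw, abc). map_option (step_ii n) (step_i n vw abc ts))"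

text \<open>
  The name of the label \<open>a\<close> after Step (ii).
\<close>

definition sample_label :: "nat \<Rightarrow> perm list \<times> (nat \<times> nat) \<times> (nat \<times> nat \<times> nat) \<Rightarrow> nat" where
  "sample_label n = (\<lambda>(ts, vw, (a, b, c)). relabelling n (prod_lr (the (step_i n vw (a, b, c) ts))) a)"

definition good_samples :: "nat \<Rightarrow> nat \<Rightarrow> nat \<Rightarrow> (perm list \<times> (nat \<times> nat) \<times> (nat \<times> nat \<times> nat)) set" where
  "good_samples h n M = {d \<in> samples h n. (\<lambda>(ts, vw, (a, b, c)). good n M ts a b c) d}"

lemma good_sample_data:
  assumes "d \<in> good_samples h n M"
  obtains ts i j a b c us \<sigma> where
    "d = (ts, (Suc i, j + 2), (a, b, c))" "ts \<in> factorizations h n" "i \<le> j" "j \<le> length ts"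
    "a < b" "b < c" "a \<in> {1..n}" "marked_insertion n ts i j a b c us \<sigma>"
    "sample_image n d = Some (map (conj_perm \<sigma>) us)" "sample_label n d = \<sigma> a"
proof -
  obtain ts v w a b c where d: "d = (ts, (v, w), (a, b, c))" by (metis surj_pair)
  have ts: "ts \<in> factorizations h n" and vw: "1 \<le> v" "v < w" "w \<le> n - 1 + 2 * Suc h" and g: "good n M ts a b c"
    using assms by (auto simp: good_samples_def samples_def d position_pairs_def)
  define i where "i = v - 1"
  define j where "j = w - 2"
  have e: "v = Suc i" "w = j + 2" "i \<le> j" "j \<le> length ts"
    using vw factorizations_D(1)[OF ts] by (auto simp: i_def j_def)
  obtain us \<sigma> where st: "step_i n (Suc i, j + 2) (a, b, c) ts = Some us"
    and ins: "marked_insertion n ts i j a b c us \<sigma>"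
    using good_insertion[OF ts e(3,4) g] by blast
  have rel: "relabels n \<sigma> (prod_lr us)" using ins by (simp add: marked_insertion_def)
  have im: "sample_image n d = Some (map (conj_perm \<sigma>) us)"
    unfolding sample_image_def d e(1,2) by (simp only: case_prod_conv st option.map step_ii_eq[OF rel])
  have la: "sample_label n d = \<sigma> a"
    unfolding sample_label_def d e(1,2) by (simp only: case_prod_conv st option.sel relabelling_eq[OF rel])
  have lab: "a < b" "b < c" "a \<in> {1..n}" using g by (auto simp: good_def)
  show ?thesis
    by (rule that[OF d[unfolded e(1,2)] ts e(3,4) lab ins im la])
qed

lemma sample_image_properties:
  assumes "d \<in> good_samples h n M"
  shows "\<exists>G \<in> factorizations (Suc h) n. sample_image n d = Some G \<and>
    sample_label n d \<in> {x \<in> {1..n}. 2 \<le> card (descents G x)}"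
proof -
  obtain ts i j a b c us \<sigma> where
    d: "d = (ts, (Suc i, j + 2), (a, b, c))" "ts \<in> factorizations h n" "i \<le> j" "j \<le> length ts"
    "a < b" "b < c" "a \<in> {1..n}" "marked_insertion n ts i j a b c us \<sigma>"
    "sample_image n d = Some (map (conj_perm \<sigma>) us)" "sample_label n d = \<sigma> a"
    by (rule good_sample_data[OF assms])
  obtain D J x y where rel: "relabels n \<sigma> (prod_lr us)" and us: "set us \<subseteq> transps {1..n}"
    and ins: "us = insert2 (Suc i) (j + 2) x y ts"
    and peak: "peak_pair (\<lambda>k. \<sigma> (rounds us k a)) (length ts + 2) D J"
    using d(8) unfolding marked_insertion_def by blast
  have lus: "length us = length ts + 2" unfolding ins by (rule length_insert2[OF d(3,4)])
  define G where "G = map (conj_perm \<sigma>) us"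
  have perm: "\<sigma> permutes {1..n}" using rel by (simp add: relabels_def)
  have bij: "bij \<sigma>" by (rule permutes_bij[OF perm])
  have n: "n \<ge> 1" using d(7) by simp
  have len: "length G = length ts + 2" by (simp add: G_def lus)
  have "map (conj_perm \<sigma>) us \<in> words (\<sigma> ` {1..n}) (length us)"
    by (rule map_conj_mem_words[OF bij]) (use us in \<open>simp add: words_def\<close>)
  hence sub: "set G \<subseteq> transps {1..n}" unfolding permutes_image[OF perm] G_def by (simp add: words_def)
  have "prod_lr G = long_cycle n" unfolding G_def prod_lr_conj[OF bij] using rel by (simp add: relabels_def)
  hence GF: "G \<in> factorizations (Suc h) n"
    using len sub factorizations_D(1)[OF d(2)] by (simp add: factorizations_def transpositions_eq_transps)
  have pp: "peak_pair (\<lambda>k. rounds G k (\<sigma> a)) (length G) D J"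
    using peak unfolding len unfolding G_def rounds_map_conj[OF bij us] .
  then obtain k where k: "k < length G" "k \<noteq> D" "rounds G (Suc k) (\<sigma> a) < rounds G k (\<sigma> a)"
    and D: "D < length G" "rounds G (Suc D) (\<sigma> a) < rounds G D (\<sigma> a)"
    unfolding peak_pair_def by blast
  have "{D, k} \<subseteq> descents G (\<sigma> a)" using k D by (simp add: descents_def)
  hence "card {D, k} \<le> card (descents G (\<sigma> a))" by (intro card_mono) simp_all
  hence "2 \<le> card (descents G (\<sigma> a))" using k by simp
  moreover have "\<sigma> a \<in> {1..n}" using permutes_in_image[OF perm] d(7) by simp
  ultimately show ?thesis using GF d(9,10) unfolding G_def by (intro bexI[of _ "map (conj_perm \<sigma>) us"]) simp_all
qed

text \<open>
  Among the good samples with image \<open>G\<close>, a sample is determined by the label that \<open>a\<close> becomes, and this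
  label has two descents in \<open>G\<close>.
\<close>

lemma card_fibre:
  assumes G: "G \<in> factorizations (Suc h) n" and n: "n \<ge> 1"
  shows "card {d \<in> good_samples h n M. sample_image n d = Some G} \<le> 2 * Suc h"
proof -
  let ?S = "{d \<in> good_samples h n M. sample_image n d = Some G}"
  have inj: "inj_on (sample_label n) ?S"
  proof (rule inj_onI)
    fix d d' assume d: "d \<in> ?S" and d': "d' \<in> ?S" and lab: "sample_label n d = sample_label n d'"
    have m: "d \<in> good_samples h n M" "d' \<in> good_samples h n M" using d d' by blast+
    obtain ts i j a b c us \<sigma> where
      e: "d = (ts, (Suc i, j + 2), (a, b, c))" "ts \<in> factorizations h n" "i \<le> j" "j \<le> length ts"
      "a < b" "b < c" "a \<in> {1..n}" "marked_insertion n ts i j a b c us \<sigma>"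
      "sample_image n d = Some (map (conj_perm \<sigma>) us)" "sample_label n d = \<sigma> a"
      by (rule good_sample_data[OF m(1)])
    obtain ts' i' j' a' b' c' us' \<sigma>' where
      e': "d' = (ts', (Suc i', j' + 2), (a', b', c'))" "ts' \<in> factorizations h n" "i' \<le> j'" "j' \<le> length ts'"
      "a' < b'" "b' < c'" "a' \<in> {1..n}" "marked_insertion n ts' i' j' a' b' c' us' \<sigma>'"
      "sample_image n d' = Some (map (conj_perm \<sigma>') us')" "sample_label n d' = \<sigma>' a'"
      by (rule good_sample_data[OF m(2)])
    have "sample_image n d = sample_image n d'" using d d' by simp
    hence q: "map (conj_perm \<sigma>) us = map (conj_perm \<sigma>') us'" unfolding e(9) e'(9) by (rule option.inject[THEN iffD1])
    have q': "\<sigma> a = \<sigma>' a'" using lab unfolding e(10) e'(10) .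
    have "ts = ts' \<and> i = i' \<and> j = j' \<and> a = a' \<and> b = b' \<and> c = c'"
      by (rule good_insertion_inj[OF e(2) e'(2) e(3,4) e'(3,4) e(5,6) e'(5,6) e(8) e'(8) q q'])
    thus "d = d'" unfolding e(1) e'(1) by simp
  qed
  have "sample_label n d \<in> {x \<in> {1..n}. 2 \<le> card (descents G x)}" if d: "d \<in> ?S" for d
  proof -
    have "d \<in> good_samples h n M" using d by blast
    from sample_image_properties[OF this] obtain G' where
      G': "sample_image n d = Some G'" "sample_label n d \<in> {x \<in> {1..n}. 2 \<le> card (descents G' x)}" by blast
    have "G' = G" using G'(1) d by simp
    thus ?thesis using G'(2) by simp
  qed
  hence "sample_label n ` ?S \<subseteq> {x \<in> {1..n}. 2 \<le> card (descents G x)}" by (rule image_subsetI)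
  hence "card (sample_label n ` ?S) \<le> card {x \<in> {1..n}. 2 \<le> card (descents G x)}" by (intro card_mono) simp_all
  also have "\<dots> \<le> 2 * Suc h" by (rule card_multiple_descents[OF G n])
  finally show ?thesis unfolding card_image[OF inj] .
qed

lemma card_increasing_pairs: "card {(v, w). 1 \<le> v \<and> v < w \<and> w \<le> m} = m choose 2"
  and finite_increasing_pairs: "finite {(v :: nat, w). 1 \<le> v \<and> v < w \<and> w \<le> m}"
proof -
  show fin: "finite {(v :: nat, w). 1 \<le> v \<and> v < w \<and> w \<le> m}" for m
    by (rule finite_subset[of _ "{1..m} \<times> {1..m}"]) auto
  show "card {(v, w). 1 \<le> v \<and> v < w \<and> w \<le> m} = m choose 2"
  proof (induction m)
    case 0
    have "{(v :: nat, w). 1 \<le> v \<and> v < w \<and> w \<le> 0} = {}" by auto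
    thus ?case by (simp only: card.empty binomial_eq_0 zero_less_numeral)
  next
    case (Suc m)
    have "{(v, w). 1 \<le> v \<and> v < w \<and> w \<le> Suc m} = {(v, w). 1 \<le> v \<and> v < w \<and> w \<le> m} \<union> (\<lambda>v. (v, Suc m)) ` {1..m}"
      by auto
    also have "card \<dots> = (m choose 2) + card ((\<lambda>v. (v, Suc m)) ` {1..m})"
      by (subst card_Un_disjoint) (use fin Suc.IH in auto)
    also have "card ((\<lambda>v. (v, Suc m)) ` {1..m}) = m" by (subst card_image) (auto simp: inj_on_def)
    finally show ?case by (simp add: numeral_2_eq_2)
  qed
qed

lemma card_position_pairs: "card (position_pairs g n) = (n - 1 + 2 * g) choose 2"
  and finite_position_pairs: "finite (position_pairs g n)"
  unfolding position_pairs_def by (rule card_increasing_pairs, rule finite_increasing_pairs)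

lemma finite_label_triples: "finite (label_triples n)"
  unfolding label_triples_def by (rule finite_subset[of _ "{1..n} \<times> {1..n} \<times> {1..n}"]) auto

lemma card_label_triples: "card (label_triples n) = n choose 3"
proof (induction n)
  case 0
  have "label_triples 0 = {}" by (auto simp: label_triples_def)
  thus ?case by simp
next
  case (Suc n)
  let ?P = "{(v, w). 1 \<le> v \<and> v < w \<and> w \<le> n}"
  have "label_triples (Suc n) = label_triples n \<union> (\<lambda>(a, b). (a, b, Suc n)) ` ?P"
    by (auto simp: label_triples_def image_iff)
  also have "card \<dots> = (n choose 3) + card ((\<lambda>(a, b). (a, b, Suc n)) ` ?P)"
  proof (subst card_Un_disjoint)
    show "finite ((\<lambda>(a, b). (a, b, Suc n)) ` ?P)" by (rule finite_imageI[OF finite_increasing_pairs])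
    show "label_triples n \<inter> (\<lambda>(a, b). (a, b, Suc n)) ` ?P = {}" by (auto simp: label_triples_def)
  qed (simp_all add: finite_label_triples Suc.IH)
  also have "card ((\<lambda>(a, b). (a, b, Suc n)) ` ?P) = n choose 2"
    unfolding card_increasing_pairs[symmetric] by (rule card_image) (auto simp: inj_on_def)
  finally show ?case by (simp add: numeral_2_eq_2 numeral_3_eq_3)
qed

text \<open>
  A triple is bad because of a label that is not tame, because \<open>a = 1\<close>, or because two labels are close
  to each other.
\<close>

lemma card_bad_triples:
  "card {(a, b, c) \<in> label_triples n. \<not> good n M ts a b c} \<le>
    (3 * card {x \<in> {1..n}. \<not> tame n M ts x} + 1 + 2 * (2 * M + 1)) * n ^ 2"
proof -
  define B where "B = {x \<in> {1..n}. \<not> tame n M ts x}"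
  let ?N = "{1..n}"
  \<comment> \<open>a list rather than a set, since two of the covering sets may coincide\<close>
  define S where "S = [B \<times> ?N \<times> ?N, ?N \<times> B \<times> ?N, ?N \<times> ?N \<times> B, {1} \<times> ?N \<times> ?N,
    (\<lambda>(a, e, c). (a, a + e, c)) ` (?N \<times> {0..2 * M} \<times> ?N), (\<lambda>(a, b, e). (a, b, b + e)) ` (?N \<times> ?N \<times> {0..2 * M})]"
  have finB: "finite B" by (simp add: B_def)
  have sub: "{(a, b, c) \<in> label_triples n. \<not> good n M ts a b c} \<subseteq> \<Union> (set S)"
  proof (rule subsetI)
    fix z assume "z \<in> {(a, b, c) \<in> label_triples n. \<not> good n M ts a b c}"
    then obtain a b c where z: "z = (a, b, c)" "1 \<le> a" "a < b" "b < c" "c \<le> n" "\<not> good n M ts a b c"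
      by (auto simp: label_triples_def)
    hence N: "a \<in> ?N" "b \<in> ?N" "c \<in> ?N" by auto
    consider "a \<in> B" | "b \<in> B" | "c \<in> B" | "a = 1" | "b \<le> a + 2 * M" | "c \<le> b + 2 * M"
      using z N by (auto simp: good_def B_def not_less not_le)
    thus "z \<in> \<Union> (set S)"
    proof cases
      case 5
      hence "z \<in> (\<lambda>(a, e, c). (a, a + e, c)) ` (?N \<times> {0..2 * M} \<times> ?N)"
        using z N by (intro image_eqI[of _ _ "(a, b - a, c)"]) auto
      thus ?thesis by (simp add: S_def)
    next
      case 6
      hence "z \<in> (\<lambda>(a, b, e). (a, b, b + e)) ` (?N \<times> ?N \<times> {0..2 * M})"
        using z N by (intro image_eqI[of _ _ "(a, b, c - b)"]) auto
      thus ?thesis by (simp add: S_def)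
    qed (use z(1) N in \<open>simp_all add: S_def\<close>)
  qed
  have "card {(a, b, c) \<in> label_triples n. \<not> good n M ts a b c} \<le> card (\<Union> (set S))"
    by (rule card_mono[OF _ sub]) (use finB in \<open>simp add: S_def\<close>)
  also have "\<dots> \<le> (\<Sum>A\<leftarrow>S. card A)"
  proof (induction S)
    case (Cons A S)
    have "card (\<Union> (set (A # S))) \<le> card A + card (\<Union> (set S))" using card_Un_le[of A "\<Union> (set S)"] by simp
    thus ?case using Cons by simp
  qed simp
  also have "\<dots> \<le> card B * n * n + n * card B * n + n * n * card B + n * n + n * (2 * M + 1) * n + n * n * (2 * M + 1)"
  proof -
    have "card ((\<lambda>(a, e, c). (a, a + e, c)) ` (?N \<times> {0..2 * M} \<times> ?N)) \<le> card (?N \<times> {0..2 * M} \<times> ?N)"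
      by (rule card_image_le) simp
    moreover have "card ((\<lambda>(a, b, e). (a, b, b + e)) ` (?N \<times> ?N \<times> {0..2 * M})) \<le> card (?N \<times> ?N \<times> {0..2 * M})"
      by (rule card_image_le) simp
    ultimately show ?thesis by (simp add: S_def card_cartesian_product algebra_simps)
  qed
  also have "\<dots> = (3 * card B + 1 + 2 * (2 * M + 1)) * n ^ 2" by (simp add: power2_eq_square algebra_simps)
  finally show ?thesis unfolding B_def .
qed

lemma finite_samples: "finite (samples h n)"
  by (simp add: samples_def finite_factorizations finite_position_pairs finite_label_triples)

lemma card_samples: "real (card (samples h n)) = hurwitz h n * real ((n - 1 + 2 * Suc h) choose 2) * real (n choose 3)"
  by (simp add: samples_def card_cartesian_product hurwitz_def card_position_pairs card_label_triples)

lemma card_bad_samples: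
  "real (card (samples h n - good_samples h n M)) \<le> real (card (position_pairs (Suc h) n)) *
    (3 * (\<Sum>ts\<in>factorizations h n. real (card {x \<in> {1..n}. \<not> tame n M ts x})) + real (4 * M + 3) * hurwitz h n) * real n ^ 2"
proof -
  let ?F = "factorizations h n" and ?P = "position_pairs (Suc h) n"
  let ?B = "\<lambda>ts. {(a, b, c) \<in> label_triples n. \<not> good n M ts a b c}"
  have eq: "samples h n - good_samples h n M = (SIGMA ts:?F. ?P \<times> ?B ts)"
    by (auto simp: samples_def good_samples_def)
  have fB: "finite (?B ts)" for ts by (rule finite_subset[OF _ finite_label_triples[of n]]) auto
  have "card (samples h n - good_samples h n M) = (\<Sum>ts\<in>?F. card ?P * card (?B ts))"
    unfolding eq by (subst card_SigmaI) (use fB in \<open>auto simp: finite_factorizations finite_position_pairs card_cartesian_product\<close>)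
  also have "\<dots> \<le> (\<Sum>ts\<in>?F. card ?P * ((3 * card {x \<in> {1..n}. \<not> tame n M ts x} + 1 + 2 * (2 * M + 1)) * n ^ 2))"
    by (intro sum_mono mult_left_mono card_bad_triples) simp
  finally have "real (card (samples h n - good_samples h n M)) \<le>
      real (\<Sum>ts\<in>?F. card ?P * ((3 * card {x \<in> {1..n}. \<not> tame n M ts x} + 1 + 2 * (2 * M + 1)) * n ^ 2))"
    by (rule of_nat_mono)
  also have "\<dots> = (\<Sum>ts\<in>?F. real (card ?P) * ((3 * real (card {x \<in> {1..n}. \<not> tame n M ts x}) + real (4 * M + 3)) * real n ^ 2))"
    unfolding of_nat_sum by (intro sum.cong refl) (simp add: algebra_simps)
  also have "\<dots> = real (card ?P) * (\<Sum>ts\<in>?F. 3 * real (card {x \<in> {1..n}. \<not> tame n M ts x}) + real (4 * M + 3)) * real n ^ 2"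
    by (simp only: sum_distrib_left sum_distrib_right mult.assoc)
  also have "(\<Sum>ts\<in>?F. 3 * real (card {x \<in> {1..n}. \<not> tame n M ts x}) + real (4 * M + 3)) =
      3 * (\<Sum>ts\<in>?F. real (card {x \<in> {1..n}. \<not> tame n M ts x})) + real (4 * M + 3) * hurwitz h n"
    by (simp only: sum.distrib sum_distrib_left[symmetric] sum_constant hurwitz_def mult.commute)
  finally show ?thesis .
qed

lemma few_bad_samples:
  assumes "\<delta> > 0"
  obtains M where "\<forall>\<^sub>F n in sequentially.
    real (card (samples h n - good_samples h n M)) \<le> \<delta> * real (card (samples h n))"
proof -
  have "\<delta> / 72 > 0" using assms by simp
  then obtain M where M: "\<forall>\<^sub>F n in sequentially.
    (\<Sum>ts\<in>factorizations h n. real (card {x \<in> {1..n}. \<not> tame n M ts x})) \<le> \<delta> / 72 * real n * hurwitz h n"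
    by (rule few_not_tame)
  obtain n0 :: nat where n0: "real n0 > 24 * real (4 * M + 3) / \<delta>" using reals_Archimedean2 by blast
  have "\<forall>\<^sub>F n in sequentially. real (card (samples h n - good_samples h n M)) \<le> \<delta> * real (card (samples h n))"
    using M eventually_ge_at_top[of n0] eventually_ge_at_top[of 6]
  proof eventually_elim
    case (elim n)
    let ?P = "real (card (position_pairs (Suc h) n))"
    have np: "hurwitz h n \<ge> 0" by (simp add: hurwitz_def)
    have c: "real (4 * M + 3) \<le> \<delta> / 24 * real n"
    proof -
      have "24 * real (4 * M + 3) / \<delta> \<le> real n" using n0 elim(2) by linarith
      thus ?thesis using assms by (simp add: field_simps)
    qed
    \<comment> \<open>a crude comparison, valid from \<open>n = 6\<close> on, which explains the constants above\<close>
    have c3: "real n ^ 3 \<le> 12 * real (n choose 3)"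
    proof -
      have "real n * (real n - 1) * (real n - 2) = 6 * real (n choose 3)"
      proof -
        have "real n * (real n - 1) * (real n - 2) = fact 3 * (real n gchoose 3)"
          by (simp add: gbinomial_prod_rev numeral_3_eq_3 fact_numeral)
        thus ?thesis by (simp add: binomial_gbinomial fact_numeral)
      qed
      moreover have "real n ^ 3 \<le> 2 * (real n * (real n - 1) * (real n - 2))"
      proof -
        have n6: "real n \<ge> 6" using elim(3) by simp
        have "real n * 6 \<le> real n * real n" using n6 by (intro mult_left_mono) auto
        hence "real n ^ 2 \<le> 2 * ((real n - 1) * (real n - 2))"
          by (simp add: power2_eq_square algebra_simps)
        hence "real n * real n ^ 2 \<le> real n * (2 * ((real n - 1) * (real n - 2)))" by (intro mult_left_mono) auto
        thus ?thesis by (simp add: power3_eq_cube power2_eq_square algebra_simps)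
      qed
      ultimately show ?thesis by simp
    qed
    have "real (card (samples h n - good_samples h n M)) \<le>
        ?P * (3 * (\<Sum>ts\<in>factorizations h n. real (card {x \<in> {1..n}. \<not> tame n M ts x})) + real (4 * M + 3) * hurwitz h n) * real n ^ 2"
      by (rule card_bad_samples)
    also have "\<dots> \<le> ?P * (3 * (\<delta> / 72 * real n * hurwitz h n) + (\<delta> / 24 * real n) * hurwitz h n) * real n ^ 2"
      using elim(1) c np by (intro mult_right_mono mult_left_mono add_mono) auto
    also have "\<dots> = ?P * hurwitz h n * (\<delta> / 12) * real n ^ 3"
      by (simp add: power3_eq_cube power2_eq_square field_simps)
    also have "\<dots> \<le> ?P * hurwitz h n * (\<delta> / 12) * (12 * real (n choose 3))"
      using c3 np assms by (intro mult_left_mono) auto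
    also have "\<dots> = \<delta> * real (card (samples h n))"
      by (simp add: card_samples card_position_pairs)
    finally show ?case .
  qed
  thus ?thesis by (rule that)
qed

section \<open>Total variation distance\<close>

lemma pmf_of_set_Times:
  fixes A :: "'a set" and B :: "'b set"
  assumes "finite A" "A \<noteq> {}" "finite B" "B \<noteq> {}"
  shows "pmf_of_set (A \<times> B) = pair_pmf (pmf_of_set A) (pmf_of_set B)"
proof (rule pmf_eqI)
  fix z :: "'a \<times> 'b"
  obtain x y where z: "z = (x, y)" by (cases z)
  have "finite (A \<times> B)" "A \<times> B \<noteq> {}" using assms by auto
  thus "pmf (pmf_of_set (A \<times> B)) z = pmf (pair_pmf (pmf_of_set A) (pmf_of_set B)) z"
    unfolding z pmf_pair using assms
    by (simp add: pmf_of_set card_cartesian_product indicator_def)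
qed

lemma Lambda_law:
  assumes "factorizations h n \<noteq> {}" "position_pairs (Suc h) n \<noteq> {}" "label_triples n \<noteq> {}"
  shows "bind_pmf (uniform_factorization h n) (Lambda (Suc h) n) = map_pmf (sample_image n) (pmf_of_set (samples h n))"
proof -
  have "pmf_of_set (samples h n) =
      pair_pmf (pmf_of_set (factorizations h n)) (pair_pmf (pmf_of_set (position_pairs (Suc h) n)) (pmf_of_set (label_triples n)))"
    unfolding samples_def using assms
    by (subst pmf_of_set_Times; (subst pmf_of_set_Times)?)
      (auto simp: finite_factorizations finite_position_pairs finite_label_triples)
  thus ?thesis
    by (simp add: uniform_factorization_def map_pmf_def pair_pmf_def bind_assoc_pmf bind_return_pmf sample_image_def)
qed

text \<open>
  A factorization of genus \<open>h + 1\<close> has at most \<open>2 (h + 1)\<close> good preimages, so the sum of what is missing from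
  this number over all of them is controlled by the total number of good samples.
\<close>

lemma tv_one_sided:
  assumes h: "factorizations h n \<noteq> {}" "factorizations (Suc h) n \<noteq> {}"
    and ne: "position_pairs (Suc h) n \<noteq> {}" "label_triples n \<noteq> {}" and n: "n \<ge> 1"
  defines "\<kappa> \<equiv> 2 * real (Suc h) * hurwitz (Suc h) n / real (card (samples h n))"
    and "p \<equiv> bind_pmf (uniform_factorization h n) (Lambda (Suc h) n)" and "q \<equiv> uniform_factorization (Suc h) n"
  shows "measure_pmf.prob q A - measure_pmf.prob p A \<le>
    2 * \<bar>\<kappa> - 1\<bar> + real (card (samples h n - good_samples h n M)) / real (card (samples h n))"
proof -
  let ?\<Omega> = "samples h n" and ?F = "factorizations (Suc h) n" and ?g = "good_samples h n M"
  define N where "N G = card {d \<in> ?g. sample_image n d = Some G}" for G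
  define tot where "tot = real (card ?\<Omega>)"
  define f where "f = hurwitz (Suc h) n"
  define F' where "F' = ?F \<inter> Some -` A"
  have gsub: "?g \<subseteq> ?\<Omega>" by (auto simp: good_samples_def)
  have fing: "finite ?g" by (rule finite_subset[OF gsub finite_samples])
  have one: "?\<Omega> \<noteq> {}" using h ne by (simp add: samples_def)
  have tot: "tot > 0" using one finite_samples by (simp add: tot_def card_gt_0_iff)
  have f: "f > 0" using h finite_factorizations by (simp add: f_def hurwitz_def card_gt_0_iff)
  have fin: "finite ?F" "finite F'" by (simp_all add: finite_factorizations F'_def)
  have qA: "measure_pmf.prob q A = real (card F') / f"
    unfolding q_def uniform_factorization_def measure_map_pmf
    by (simp add: measure_pmf_of_set[OF h(2) fin(1)] F'_def f_def hurwitz_def)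
  have union: "card (\<Union>G\<in>H. {d \<in> ?g. sample_image n d = Some G}) = (\<Sum>G\<in>H. N G)" if "finite H" for H
    unfolding N_def by (rule card_UN_disjoint) (use that fing in auto)
  have pA: "real (\<Sum>G\<in>F'. N G) / tot \<le> measure_pmf.prob p A"
  proof -
    have "measure_pmf.prob p A = real (card (?\<Omega> \<inter> sample_image n -` A)) / tot"
      unfolding p_def Lambda_law[OF h(1) ne] measure_map_pmf
      by (simp add: measure_pmf_of_set[OF one finite_samples] tot_def)
    moreover have "card (\<Union>G\<in>F'. {d \<in> ?g. sample_image n d = Some G}) \<le> card (?\<Omega> \<inter> sample_image n -` A)"
      by (rule card_mono) (use finite_samples gsub in \<open>auto simp: F'_def\<close>)
    hence "real (\<Sum>G\<in>F'. N G) \<le> real (card (?\<Omega> \<inter> sample_image n -` A))"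
      unfolding union[OF fin(2)] by (rule of_nat_mono)
    hence "real (\<Sum>G\<in>F'. N G) / tot \<le> real (card (?\<Omega> \<inter> sample_image n -` A)) / tot"
      using tot by (intro divide_right_mono) auto
    ultimately show ?thesis by (simp only:)
  qed
  have total: "(\<Sum>G\<in>?F. N G) = card ?g"
  proof -
    have "(\<Union>G\<in>?F. {d \<in> ?g. sample_image n d = Some G}) = ?g"
      using sample_image_properties[of _ h n M] by blast
    thus ?thesis using union[OF fin(1)] by simp
  qed
  have NG: "real (N G) \<le> 2 * real (Suc h)" if "G \<in> ?F" for G
    using of_nat_mono[OF card_fibre[OF that n, of M], where 'a = real] by (simp add: N_def)
  \<comment> \<open>the masses \<open>1 / f\<close> and \<open>2 (h + 1) / tot\<close> agree only asymptotically; \<open>e\<close> is the error for one \<open>G\<close>\<close>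
  define e where "e = \<bar>1 / f - 2 * real (Suc h) / tot\<bar>"
  have bnd: "\<kappa> - (1 - r) + \<bar>1 - \<kappa>\<bar> \<le> 2 * \<bar>\<kappa> - 1\<bar> + r" for r
    by (cases "\<kappa> \<le> 1") auto
  have "measure_pmf.prob q A - measure_pmf.prob p A \<le> real (card F') / f - real (\<Sum>G\<in>F'. N G) / tot"
    using qA pA by linarith
  also have "\<dots> = (\<Sum>G\<in>F'. 1 / f - real (N G) / tot)"
    by (simp add: sum_subtractf sum_divide_distrib)
  also have "\<dots> \<le> (\<Sum>G\<in>F'. (2 * real (Suc h) - real (N G)) / tot + e)"
  proof (rule sum_mono)
    fix G
    have "1 / f - 2 * real (Suc h) / tot \<le> e" unfolding e_def by (rule abs_ge_self)
    thus "1 / f - real (N G) / tot \<le> (2 * real (Suc h) - real (N G)) / tot + e"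
      unfolding diff_divide_distrib by linarith
  qed
  also have "\<dots> \<le> (\<Sum>G\<in>?F. (2 * real (Suc h) - real (N G)) / tot + e)"
    using fin tot NG by (intro sum_mono2) (auto simp: F'_def e_def intro!: add_nonneg_nonneg divide_nonneg_nonneg)
  also have "\<dots> = (2 * real (Suc h) * f - real (\<Sum>G\<in>?F. N G)) / tot + f * e"
    by (simp add: sum.distrib sum_divide_distrib[symmetric] sum_subtractf f_def hurwitz_def mult_ac)
  also have "\<dots> = \<kappa> - real (card ?g) / tot + \<bar>1 - \<kappa>\<bar>"
  proof -
    have "f * e = \<bar>f * (1 / f - 2 * real (Suc h) / tot)\<bar>" using f by (simp add: e_def abs_mult)
    also have "f * (1 / f - 2 * real (Suc h) / tot) = 1 - \<kappa>"
      using f by (simp add: \<kappa>_def f_def[symmetric] tot_def[symmetric] right_diff_distrib)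
    finally show ?thesis unfolding total by (simp add: \<kappa>_def f_def tot_def diff_divide_distrib)
  qed
  also have "real (card ?g) / tot = 1 - real (card (?\<Omega> - ?g)) / tot"
  proof -
    have "card (?\<Omega> - ?g) = card ?\<Omega> - card ?g" by (rule card_Diff_subset[OF fing gsub])
    moreover have "card ?g \<le> card ?\<Omega>" by (rule card_mono[OF finite_samples gsub])
    ultimately have "real (card ?g) = tot - real (card (?\<Omega> - ?g))" by (simp add: tot_def of_nat_diff)
    thus ?thesis using tot by (simp add: diff_divide_distrib)
  qed
  also have "\<kappa> - (1 - real (card (?\<Omega> - ?g)) / tot) + \<bar>1 - \<kappa>\<bar> \<le> 2 * \<bar>\<kappa> - 1\<bar> + real (card (?\<Omega> - ?g)) / tot"
    using bnd[of "real (card (?\<Omega> - ?g)) / tot"] .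
  finally show ?thesis unfolding tot_def .
qed

text \<open>
  Passing to complements exchanges the two signs of the difference, so a one-sided bound suffices.
\<close>

lemma tv_dist_le:
  assumes "\<And>A. measure_pmf.prob q A - measure_pmf.prob p A \<le> e"
  shows "tv_dist p q \<le> e"
  unfolding tv_dist_def
proof (rule cSUP_least)
  fix A
  have "measure_pmf.prob q (UNIV - A) - measure_pmf.prob p (UNIV - A) \<le> e" by (rule assms)
  moreover have "measure_pmf.prob r (UNIV - A) = 1 - measure_pmf.prob r A" for r :: "'a pmf"
    using measure_pmf.prob_compl[of A r] by simp
  ultimately show "\<bar>measure_pmf.prob p A - measure_pmf.prob q A\<bar> \<le> e"
    using assms[of A] by (simp add: abs_if)
qed simp

lemma tv_dist_nonneg: "tv_dist p q \<ge> 0"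
  unfolding tv_dist_def
proof (rule cSUP_upper2[of _ _ "{}"])
  have "\<bar>measure_pmf.prob p A - measure_pmf.prob q A\<bar> \<le> 1" for A
    using measure_pmf.prob_le_1[of p A] measure_pmf.prob_le_1[of q A]
      measure_nonneg[of "measure_pmf p" A] measure_nonneg[of "measure_pmf q" A] by linarith
  thus "bdd_above (range (\<lambda>A. \<bar>measure_pmf.prob p A - measure_pmf.prob q A\<bar>))"
    by (intro bdd_aboveI2[of _ _ 1]) simp
qed simp_all

theorem theorem1p1:
  fixes g :: nat
  assumes "g \<ge> 1"
  shows "(\<lambda>n. tv_dist (bind_pmf (uniform_factorization (g - 1) n) (Lambda g n))
                      (uniform_factorization g n)) \<longlonglongrightarrow> 0"
proof -
  obtain h where g: "g = Suc h" using assms by (cases g) auto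
  let ?tv = "\<lambda>n. tv_dist (bind_pmf (uniform_factorization h n) (Lambda (Suc h) n)) (uniform_factorization (Suc h) n)"
  define \<kappa> where "\<kappa> n = 2 * real (Suc h) * hurwitz (Suc h) n / real (card (samples h n))" for n
  have "\<kappa> \<longlonglongrightarrow> 1"
    using ratio_genus_tendsto[of "Suc h"] unfolding \<kappa>_def card_samples by simp
  hence \<kappa>: "(\<lambda>n. 2 * \<bar>\<kappa> n - 1\<bar>) \<longlonglongrightarrow> 0"
    by (auto intro!: tendsto_eq_intros)
  have "?tv \<longlonglongrightarrow> 0"
  proof (rule tendstoI)
    fix e :: real assume e: "e > 0"
    hence "e / 2 > 0" by simp
    then obtain M where M: "\<forall>\<^sub>F n in sequentially.
        real (card (samples h n - good_samples h n M)) \<le> e / 2 * real (card (samples h n))"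
      by (rule few_bad_samples)
    have "\<forall>\<^sub>F n in sequentially. 2 * \<bar>\<kappa> n - 1\<bar> < e / 2"
      by (rule order_tendstoD(2)[OF \<kappa>]) (use e in simp)
    thus "\<forall>\<^sub>F n in sequentially. dist (?tv n) 0 < e"
      using M eventually_hurwitz_pos[of h] eventually_hurwitz_pos[of "Suc h"] eventually_ge_at_top[of 3]
    proof eventually_elim
      case (elim n)
      have ne: "factorizations h n \<noteq> {}" "factorizations (Suc h) n \<noteq> {}"
        using elim(3,4) by (auto simp: hurwitz_def)
      have "(1, 2) \<in> position_pairs (Suc h) n" "(1, 2, 3) \<in> label_triples n"
        using elim(5) by (auto simp: position_pairs_def label_triples_def)
      hence ne': "position_pairs (Suc h) n \<noteq> {}" "label_triples n \<noteq> {}" by blast+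
      have pos: "real (card (samples h n)) > 0"
        using ne ne' finite_samples[of h n] by (simp add: card_gt_0_iff samples_def)
      have "?tv n \<le> 2 * \<bar>\<kappa> n - 1\<bar> + real (card (samples h n - good_samples h n M)) / real (card (samples h n))"
        unfolding \<kappa>_def by (rule tv_dist_le, rule tv_one_sided[OF ne ne']) (use elim(5) in simp)
      also have "\<dots> < e / 2 + e / 2"
        using elim(1,2) pos by (intro add_less_le_mono) (simp_all add: pos_divide_le_eq)
      finally have "?tv n < e" by simp
      moreover have "?tv n \<ge> 0" by (rule tv_dist_nonneg)
      ultimately show ?case by (simp add: dist_real_def)
    qed
  qed
  thus ?thesis by (simp add: g)
qed

end
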